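(* Let $\rho^+,\rho^-$ be specializations such that there exist constants $r_+,r_->0$ with $\min(1,1/r_+)>r_->0$ and $k^{-1}p_k(\rho^{\pm})=O(r_\pm^k)$ as $k\to\infty$. Consider the (possibly complex) measures on partitions $$m_{sp}(\lambda)=Z_{sp}^{-1}\,sp_\lambda(\rho^+)s_\lambda(\rho^-),\qquad m_o(\lambda)=Z_o^{-1}\,o_\lambda(\rho^+)s_\lambda(\rho^-),$$ where $Z_{sp/o}=\exp\sum_{k\ge1}\Big(\frac{p_k(\rho^+)p_k(\rho^-)}{k}\pm\frac{p_{2k}(\rho^-)}{2k}-\frac{p_k(\rho^-)^2}{2k}\Big)$ (sign $+$ for $sp$, $-$ for $o$). Then for every $n\ge1$ and every $k_1,\dots,k_n\in\mathbb Z+\tfrac12$, $$m_{sp/o}\big(\{k_1,\dots,k_n\}\subset\{\lambda_i-i+\tfrac12: i\ge1\}\big)=\det[K_{sp/o}(k_i,k_j)]_{1\le i,j\le n},$$ with $$K_{sp}(a,b)=\oint\oint\frac{F(z)}{F(w)}\frac{1-w^2}{(1-wz)(1-wz^{-1})}\frac{dz\,dw}{(2\pi i)^2 z^{a+3/2}w^{-b+1/2}},\qquad K_{o}(a,b)=\oint\oint\frac{F(z)}{F(w)}\frac{1-z^2}{(1-wz)(1-wz^{-1})}\frac{dz\,dw}{(2\pi i)^2 z^{a+3/2}w^{-b+1/2}},$$ where $F(z)=\dfrac{H(\rho^+;z)}{H(\rho^-;z)H(\rho^-;z^{-1})}$ and the contours are simple closed counterclockwise curves around $0$ with $\min(1/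|w|,1/r_+,1/r_-)>|z|>|w|>r_->0$.
   Context: A specialization $\rho$ is a sequence of complex numbers $(p_n(\rho))_{n\ge1}$ (its values on power sums); set $H(\rho;z)=\exp\big(\sum_{n\ge1}p_n(\rho)z^n/n\big)=\sum_{k\ge0}h_k(\rho)z^k$, which defines $h_k(\rho)$ (with $h_k=0$ for $k<0$). For a partition $\lambda$ of length $\ell(\lambda)$, with determinants of size $\ell(\lambda)$ (equal to $1$ for the empty partition): $s_\lambda(\rho)=\det[h_{\lambda_i-i+j}(\rho)]$, $sp_\lambda(\rho)=\tfrac12\det[h_{\lambda_i-i+j}(\rho)+h_{\lambda_i-i-j+2}(\rho)]$, $o_\lambda(\rho)=\det[h_{\lambda_i-i+j}(\rho)-h_{\lambda_i-i-j}(\rho)]$. The constants $Z_{sp},Z_o$ equal $\sum_\lambda sp_\lambda(\rho^+)s_\lambda(\rho^-)$ and $\sum_\lambda o_\lambda(\rho^+)s_\lambda(\rho^-)$ respectively, so $m_{sp},m_o$ have total mass $1$. The probability of an event $E$ means $\sum_{\lambda\in E}m(\lambda)$.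
   Formalization: The points k_1,…,k_n are assumed pairwise distinct (with a repeated point the determinant is 0 while the probability need not be), and sp of the empty partition is taken to be 1, as total mass 1 requires. *)

theory Defs
  imports "HOL-Complex_Analysis.Complex_Analysis"
          "HOL-Computational_Algebra.Formal_Power_Series"
          "HOL-Library.Landau_Symbols"
begin

text \<open>A specialization is given by its power-sum values p n (n >= 1); p 0 is ignored.\<close>

definition H_fps :: "(nat \<Rightarrow> complex) \<Rightarrow> complex fps" where
  "H_fps p = fps_compose (fps_exp 1)
              (Abs_fps (\<lambda>n. if n = 0 then 0 else p n / of_nat n))"

definition hh :: "(nat \<Rightarrow> complex) \<Rightarrow> int \<Rightarrow> complex" where
  "hh p k = (if k < 0 then 0 else fps_nth (H_fps p) (nat k))"

definition Hf :: "(nat \<Rightarrow> complex) \<Rightarrow> complex \<Rightarrow> complex" where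
  "Hf p z = exp (\<Sum>n. p (Suc n) * z ^ Suc n / of_nat (Suc n))"

definition Ffun :: "(nat \<Rightarrow> complex) \<Rightarrow> (nat \<Rightarrow> complex) \<Rightarrow> complex \<Rightarrow> complex" where
  "Ffun pp pm z = Hf pp z / (Hf pm z * Hf pm (1 / z))"

definition detn :: "nat \<Rightarrow> (nat \<Rightarrow> nat \<Rightarrow> complex) \<Rightarrow> complex" where
  "detn n A = (\<Sum>q \<in> {q. q permutes {..<n}}. of_int (sign q) * (\<Prod>i<n. A i (q i)))"

definition partitions :: "nat list set" where
  "partitions = {l. sorted_wrt (\<ge>) l \<and> (\<forall>x\<in>set l. 0 < x)}"

definition parts :: "nat list \<Rightarrow> nat \<Rightarrow> nat" where
  "parts l i = (if 1 \<le> i \<and> i \<le> length l then l ! (i - 1) else 0)"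

text \<open>{lambda_i - i : i >= 1}; the half-integer k = m + 1/2 lies in
  {lambda_i - i + 1/2} iff the integer m lies in this set.\<close>
definition shifted_set :: "nat list \<Rightarrow> int set" where
  "shifted_set l = {int (parts l i) - int i | i. 1 \<le> i}"

text \<open>Schur, symplectic and orthogonal characters (0-based indices i' = i-1, j' = j-1).\<close>
definition schur :: "(nat \<Rightarrow> complex) \<Rightarrow> nat list \<Rightarrow> complex" where
  "schur p l = detn (length l)
     (\<lambda>i j. hh p (int (parts l (Suc i)) - int i + int j))"

definition sympl :: "(nat \<Rightarrow> complex) \<Rightarrow> nat list \<Rightarrow> complex" where
  "sympl p l = (if l = [] then 1 else 1/2 * detn (length l)
     (\<lambda>i j. hh p (int (parts l (Suc i)) - int i + int j)
          + hh p (int (parts l (Suc i)) - int i - int j)))"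

definition orth :: "(nat \<Rightarrow> complex) \<Rightarrow> nat list \<Rightarrow> complex" where
  "orth p l = detn (length l)
     (\<lambda>i j. hh p (int (parts l (Suc i)) - int i + int j)
          - hh p (int (parts l (Suc i)) - int i - int j - 2))"

definition Z_sp :: "(nat \<Rightarrow> complex) \<Rightarrow> (nat \<Rightarrow> complex) \<Rightarrow> complex" where
  "Z_sp pp pm = exp (\<Sum>n. let k = Suc n in
      pp k * pm k / of_nat k + pm (2*k) / of_nat (2*k) - (pm k)^2 / of_nat (2*k))"

definition Z_o :: "(nat \<Rightarrow> complex) \<Rightarrow> (nat \<Rightarrow> complex) \<Rightarrow> complex" where
  "Z_o pp pm = exp (\<Sum>n. let k = Suc n in
      pp k * pm k / of_nat k - pm (2*k) / of_nat (2*k) - (pm k)^2 / of_nat (2*k))"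

definition m_sp :: "(nat \<Rightarrow> complex) \<Rightarrow> (nat \<Rightarrow> complex) \<Rightarrow> nat list \<Rightarrow> complex" where
  "m_sp pp pm l = sympl pp l * schur pm l / Z_sp pp pm"

definition m_o :: "(nat \<Rightarrow> complex) \<Rightarrow> (nat \<Rightarrow> complex) \<Rightarrow> nat list \<Rightarrow> complex" where
  "m_o pp pm l = orth pp l * schur pm l / Z_o pp pm"

definition admissible_contours ::
  "real \<Rightarrow> real \<Rightarrow> (real \<Rightarrow> complex) \<Rightarrow> (real \<Rightarrow> complex) \<Rightarrow> bool" where
  "admissible_contours rp rm gz gw \<longleftrightarrow>
     valid_path gz \<and> simple_path gz \<and> pathfinish gz = pathstart gz \<and>
     0 \<notin> path_image gz \<and> winding_number gz 0 = 1 \<and>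
     valid_path gw \<and> simple_path gw \<and> pathfinish gw = pathstart gw \<and>
     0 \<notin> path_image gw \<and> winding_number gw 0 = 1 \<and>
     (\<forall>z\<in>path_image gz. \<forall>w\<in>path_image gw.
        rm < norm w \<and> norm w < norm z \<and> norm z < 1 / norm w \<and>
        norm z < 1 / rp \<and> norm z < 1 / rm)"

text \<open>Kernels, with a = ma + 1/2, b = mb + 1/2, so z^(a+3/2) = z^(ma+2), w^(-b+1/2) = w^(-mb).\<close>
definition K_sp :: "(nat \<Rightarrow> complex) \<Rightarrow> (nat \<Rightarrow> complex) \<Rightarrow> (real \<Rightarrow> complex) \<Rightarrow>
    (real \<Rightarrow> complex) \<Rightarrow> int \<Rightarrow> int \<Rightarrow> complex" where
  "K_sp pp pm gz gw ma mb =
     contour_integral gz (\<lambda>z. contour_integral gw (\<lambda>w.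
        Ffun pp pm z / Ffun pp pm w * (1 - w^2) / ((1 - w*z) * (1 - w/z))
        / (z powi (ma + 2) * w powi (- mb)))) / (2 * pi * \<i>)^2"

definition K_o :: "(nat \<Rightarrow> complex) \<Rightarrow> (nat \<Rightarrow> complex) \<Rightarrow> (real \<Rightarrow> complex) \<Rightarrow>
    (real \<Rightarrow> complex) \<Rightarrow> int \<Rightarrow> int \<Rightarrow> complex" where
  "K_o pp pm gz gw ma mb =
     contour_integral gz (\<lambda>z. contour_integral gw (\<lambda>w.
        Ffun pp pm z / Ffun pp pm w * (1 - z^2) / ((1 - w*z) * (1 - w/z))
        / (z powi (ma + 2) * w powi (- mb)))) / (2 * pi * \<i>)^2"

end

theory Submission
  imports Defs "Jordan_Normal_Form.Determinant"
begin

text \<open>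
  Write \<open>a\<close>, \<open>b\<close>, \<open>e\<close> for the coefficients of \<open>H(\<rho>\<^sup>+;z)\<close>, \<open>H(\<rho>\<^sup>-;z)\<close>, \<open>1/H(\<rho>\<^sup>-;z)\<close>. With the points
  \<open>x\<^sub>i = \<lambda>\<^sub>i - i\<close>, both weights are products \<open>det \<phi>\<^sub>j(x\<^sub>i) det \<psi>\<^sub>j(x\<^sub>i)\<close> with \<open>\<psi>\<^sub>j(x) = b(x+1+j)\<close> and
  \<open>\<phi>\<^sub>j(x) = a(x+1+j) + \<tau>\<^sub>j a(x+c-j)\<close>, where \<open>c = 1\<close> in the symplectic and \<open>c = -1\<close> in the orthogonal case.

  If \<open>1/H(\<rho>\<^sup>-;z)\<close> is a polynomial of degree at most \<open>N\<close>, only partitions of length at most \<open>N\<close> occur and the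
  points form a biorthogonal ensemble. Its kernel is the coefficient array of
  \<open>F(z)/F(w)\<close> times a geometric series: it reproduces the \<open>\<psi>\<^sub>j\<close>, and it lies in the span of
  \<open>\<phi>\<^sub>0, \<dots>, \<phi>\<^sub>N\<^sub>-\<^sub>1\<close> because \<open>1/(H(\<rho>\<^sup>-;z) H(\<rho>\<^sup>-;1/z))\<close> is symmetric under \<open>z \<mapsto> 1/z\<close>. The general case
  follows by truncating \<open>e\<close> and dominated convergence; the dominating series comes from column operations with
  the coefficients of \<open>1/H\<close>, as in Giambelli's formula.

  This gives the correlation functions up to the total mass \<open>W\<close>. Under the scaling \<open>p\<^sub>k(\<rho>\<^sup>-) \<mapsto> t\<^sup>k p\<^sub>k(\<rho>\<^sup>-)\<close>, the quantity
  \<open>t W'(t)\<close> is the sum of \<open>\<bar>\<lambda>\<bar>\<close> against the weights, which the one-point function expresses as \<open>W(t)\<close> times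
  the logarithmic derivative of the claimed constant. Finally, a Laurent expansion of the integrand identifies the double
  contour integral with the kernel.
\<close>

section \<open>Weighted convolution algebras of two-sided sequences\<close>

text \<open>The weights are complex, so no monotone limit is available: every interchange of sums
  rests on absolute convergence, and all series live in weighted l1 algebras, the weight
  \<open>q\<close> standing for the circle of radius \<open>q\<close>. Two radii
  \<open>q1 < q2 < 1\<close> between r_- and min(1, 1/r_+) are fixed; the gap between them pays for
  the geometric factors in the bounds. The functions \<phi>_j come from expanding the rational
  factor in w: (1 - w^2)/((1 - wz)(1 - w/z)) = 1 + sum_(j >= 1) (z^j + z^(-j)) w^j, and with the
  numerator 1 - z^2 it is sum_(j >= 0) (z^(-j) - z^(j+2)) w^j. All coefficients are symmetric or
  antisymmetric under z^m -> z^(1-c-m). After summation against 1/F, multiplication by the symmetric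
  Laurent polynomial E(z) E(1/z), E = 1/H(rho-), preserves this and makes the support finite, so
  only N coefficients are free; pairing m with 1 - c - m and multiplying by H(rho+) gives exactly
  \<phi>_0, ..., \<phi>_(N-1). The mass of the finite ensemble appears as a Gram determinant that is
  not evaluated; this is why the constant has its own argument.\<close>

definition conv :: "(int \<Rightarrow> complex) \<Rightarrow> (int \<Rightarrow> complex) \<Rightarrow> int \<Rightarrow> complex" where
  "conv f g n = (\<Sum>\<^sub>\<infinity>k. f k * g (n - k))"

definition tw :: "real \<Rightarrow> (int \<Rightarrow> complex) \<Rightarrow> int \<Rightarrow> complex" where
  "tw q f k = f k * of_real (q powi k)"

text \<open>Absolute convergence of the Laurent series sum_k f k z^k on the circle of radius
  \<open>q\<close>: for complex terms \<open>summable_on\<close> is already absolute.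
  \<open>nl q\<close> is the corresponding Banach algebra norm.\<close>

definition wl :: "real \<Rightarrow> (int \<Rightarrow> complex) \<Rightarrow> bool" where
  "wl q f \<longleftrightarrow> tw q f summable_on UNIV"

definition nl :: "real \<Rightarrow> (int \<Rightarrow> complex) \<Rightarrow> real" where
  "nl q f = (\<Sum>\<^sub>\<infinity>k. norm (tw q f k))"

lemma csum_norm: "f summable_on A \<Longrightarrow> (\<lambda>x. norm (f x :: complex)) summable_on A"
  using summable_on_iff_abs_summable_on_complex by blast

lemma csum_normD: "(\<lambda>x. norm (f x :: complex)) summable_on A \<Longrightarrow> f summable_on A"
  using summable_on_iff_abs_summable_on_complex by blast

lemma csum_comparison:
  "g summable_on A \<Longrightarrow> (\<And>x. x \<in> A \<Longrightarrow> norm (f x :: complex) \<le> g x) \<Longrightarrow> f summable_on A"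
  by (rule csum_normD, rule summable_on_comparison_test[of g]) auto

lemma norm_tw: "q > 0 \<Longrightarrow> norm (tw q f k) = norm (f k) * q powi k"
  by (simp add: tw_def norm_mult norm_power_int)

lemma wl_abs: "wl q f \<Longrightarrow> (\<lambda>k. norm (tw q f k)) summable_on UNIV"
  unfolding wl_def using summable_on_iff_abs_summable_on_complex by blast

lemma wl_iff: "q > 0 \<Longrightarrow> wl q f \<longleftrightarrow> (\<lambda>k. norm (f k) * q powi k) summable_on UNIV"
  unfolding wl_def using summable_on_iff_abs_summable_on_complex[of "tw q f"]
  by (simp add: norm_tw)

lemma nl_eq: "q > 0 \<Longrightarrow> nl q f = (\<Sum>\<^sub>\<infinity>k. norm (f k) * q powi k)"
  by (simp add: nl_def norm_tw)

lemma nl_nonneg: "nl q f \<ge> 0"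
  unfolding nl_def by (rule infsum_nonneg) auto

lemma norm_le_nl: "wl q f \<Longrightarrow> q > 0 \<Longrightarrow> norm (f k) * q powi k \<le> nl q f"
  using finite_sum_le_infsum[OF wl_abs[of q f], of "{k}"]
  by (simp add: nl_def norm_tw)

lemma sum_le_nl: "wl q f \<Longrightarrow> q > 0 \<Longrightarrow> finite F \<Longrightarrow> (\<Sum>k\<in>F. norm (f k) * q powi k) \<le> nl q f"
  using finite_sum_le_infsum[OF wl_abs[of q f], of F]
  by (simp add: nl_def norm_tw)

text \<open>Since q^k q^(n-k) = q^n, twisting is an algebra homomorphism, and the weighted algebra
  inherits its properties from the case \<open>q = 1\<close>.\<close>

lemma conv_tw: "q > 0 \<Longrightarrow> conv (tw q f) (tw q g) = tw q (conv f g)"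
proof
  fix n assume q: "q > 0"
  have *: "tw q f k * tw q g (n - k) = f k * g (n - k) * of_real (q powi n)" for k
  proof -
    have "q powi k * q powi (n - k) = q powi n"
      using q by (simp flip: power_int_add)
    then show ?thesis unfolding tw_def
      by (metis (no_types, lifting) mult.assoc mult.left_commute of_real_mult)
  qed
  then show "conv (tw q f) (tw q g) n = tw q (conv f g) n"
    unfolding conv_def * infsum_cmult_left' by (simp only: tw_def)
qed

lemma conv_commute: "conv f g = conv g f"
proof
  fix n
  show "conv f g n = conv g f n" unfolding conv_def
    by (rule infsum_reindex_bij_witness[where i = "\<lambda>k. n - k" and j = "\<lambda>k. n - k"]) auto
qed

lemma conv_pair_summable:
  fixes f g :: "int \<Rightarrow> complex"
  assumes "f summable_on UNIV" "g summable_on UNIV"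
  shows "(\<lambda>(k, n). f k * g (n - k)) summable_on UNIV \<times> UNIV"
    "(\<Sum>\<^sub>\<infinity>(k, n)\<in>UNIV\<times>UNIV. norm (f k * g (n - k))) = (\<Sum>\<^sub>\<infinity>k. norm (f k)) * (\<Sum>\<^sub>\<infinity>k. norm (g k))"
proof -
  have f: "(\<lambda>k. norm (f k)) summable_on UNIV" and g: "(\<lambda>k. norm (g k)) summable_on UNIV"
    using assms summable_on_iff_abs_summable_on_complex by blast+
  have inner: "(\<lambda>n. norm (f k * g (n - k))) summable_on UNIV" 
     "(\<Sum>\<^sub>\<infinity>n. norm (f k * g (n - k))) = norm (f k) * (\<Sum>\<^sub>\<infinity>k. norm (g k))" for k :: int
  proof -
    have "(\<lambda>n. norm (g (n - k))) summable_on UNIV"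
      using g summable_on_reindex_bij_witness[of UNIV "\<lambda>n. n + k" "\<lambda>n. n - k" UNIV "\<lambda>k. norm (g k)" "\<lambda>n. norm (g (n - k))"]
      by auto
    then show "(\<lambda>n. norm (f k * g (n - k))) summable_on UNIV"
      unfolding norm_mult by (rule summable_on_cmult_right)
    have "(\<Sum>\<^sub>\<infinity>n. norm (g (n - k))) = (\<Sum>\<^sub>\<infinity>k. norm (g k))"
      by (rule infsum_reindex_bij_witness[of UNIV "\<lambda>n. n + k" "\<lambda>n. n - k" UNIV "\<lambda>k. norm (g k)" "\<lambda>n. norm (g (n - k))"])
        auto
    then show "(\<Sum>\<^sub>\<infinity>n. norm (f k * g (n - k))) = norm (f k) * (\<Sum>\<^sub>\<infinity>k. norm (g k))"
      by (simp add: norm_mult infsum_cmult_right')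
  qed
  have abs: "(\<lambda>(k, n). norm (f k * g (n - k))) summable_on UNIV \<times> UNIV"
    by (rule summable_on_SigmaI[where g = "\<lambda>k. norm (f k) * (\<Sum>\<^sub>\<infinity>k. norm (g k))"])
       (auto simp only: inner(2)[symmetric] prod.case intro!: has_sum_infsum inner(1),
        auto simp: inner(2) intro: summable_on_cmult_left f)
  then show "(\<lambda>(k, n). f k * g (n - k)) summable_on UNIV \<times> UNIV"
    by (intro csum_normD) (simp add: case_prod_unfold)
  from abs have "(\<Sum>\<^sub>\<infinity>(k, n)\<in>UNIV\<times>UNIV. norm (f k * g (n - k))) = (\<Sum>\<^sub>\<infinity>k. \<Sum>\<^sub>\<infinity>n. norm (f k * g (n - k)))"
    using infsum_Sigma'_banach[of "\<lambda>k n. norm (f k * g (n - k))" UNIV "\<lambda>_. UNIV"] by simp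
  then show "(\<Sum>\<^sub>\<infinity>(k, n)\<in>UNIV\<times>UNIV. norm (f k * g (n - k))) = (\<Sum>\<^sub>\<infinity>k. norm (f k)) * (\<Sum>\<^sub>\<infinity>k. norm (g k))"
    by (simp add: inner infsum_cmult_left')
qed

lemma conv_pair_summable':
  fixes f g :: "int \<Rightarrow> complex"
  assumes "f summable_on UNIV" "g summable_on UNIV"
  shows "(\<lambda>(n, k). f k * g (n - k)) summable_on UNIV \<times> UNIV"
  using conv_pair_summable(1)[OF assms] summable_on_swap[of "\<lambda>(k, n). f k * g (n - k)" UNIV UNIV] by simp

lemma conv_l1:
  assumes "f summable_on UNIV" "g summable_on UNIV"
  shows "(\<lambda>k. f k * g (n - k)) summable_on UNIV"
    and "conv f g summable_on UNIV"
    and "(\<Sum>\<^sub>\<infinity>n. norm (conv f g n)) \<le> (\<Sum>\<^sub>\<infinity>k. norm (f k)) * (\<Sum>\<^sub>\<infinity>k. norm (g k))"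
proof -
  note S = conv_pair_summable'[OF assms]
  show 1: "(\<lambda>k. f k * g (n - k)) summable_on UNIV" for n
    using summable_on_SigmaD1[OF S, of n] by simp
  show 2: "conv f g summable_on UNIV"
    using summable_on_Sigma_banach[OF S] by (simp add: conv_def[abs_def])
  have A: "(\<lambda>(k,n). norm (f k * g (n - k))) summable_on UNIV \<times> UNIV"
    using conv_pair_summable(1)[OF assms, unfolded summable_on_iff_abs_summable_on_complex]
    by (simp add: case_prod_unfold)
  then have A': "(\<lambda>(n,k). norm (f k * g (n - k))) summable_on UNIV \<times> UNIV"
    using summable_on_swap[of "\<lambda>(k, n). norm (f k * g (n - k))" UNIV UNIV] by simp
  have "(\<Sum>\<^sub>\<infinity>n. norm (conv f g n)) \<le> (\<Sum>\<^sub>\<infinity>n. \<Sum>\<^sub>\<infinity>k. norm (f k * g (n - k)))"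
  proof (rule infsum_mono)
    show "(\<lambda>n. norm (conv f g n)) summable_on UNIV"
      using 2 summable_on_iff_abs_summable_on_complex by blast
    show "(\<lambda>n. \<Sum>\<^sub>\<infinity>k. norm (f k * g (n - k))) summable_on UNIV"
      using summable_on_Sigma_banach[OF A'] .
    show "norm (conv f g n) \<le> (\<Sum>\<^sub>\<infinity>k. norm (f k * g (n - k)))" for n
      unfolding conv_def
      by (rule norm_infsum_bound) (rule csum_norm[OF 1])
  qed
  also have "\<dots> = (\<Sum>\<^sub>\<infinity>k. \<Sum>\<^sub>\<infinity>n. norm (f k * g (n - k)))"
    by (rule infsum_swap_banach[OF A'])
  also have "\<dots> = (\<Sum>\<^sub>\<infinity>(k, n)\<in>UNIV\<times>UNIV. norm (f k * g (n - k)))"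
    using infsum_Sigma'_banach[OF A] .
  finally show "(\<Sum>\<^sub>\<infinity>n. norm (conv f g n)) \<le> (\<Sum>\<^sub>\<infinity>k. norm (f k)) * (\<Sum>\<^sub>\<infinity>k. norm (g k))"
    unfolding conv_pair_summable(2)[OF assms] .
qed

lemma l1_bounded:
  assumes "(h :: int \<Rightarrow> complex) summable_on UNIV"
  shows "\<exists>B. \<forall>k. norm (h k) \<le> B"
proof -
  have "(\<lambda>k. norm (h k)) summable_on UNIV"
    using assms summable_on_iff_abs_summable_on_complex by blast
  then have "norm (h k) \<le> (\<Sum>\<^sub>\<infinity>k. norm (h k))" for k
    using finite_sum_le_infsum[of "\<lambda>k. norm (h k)" UNIV "{k}"] by simp
  then show ?thesis by blast
qed

text \<open>The two orders of summation agree by Fubini; as the l1 sequence \<open>h\<close> is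
  bounded, the double series of \<open>f\<close> and \<open>g\<close> dominates.\<close>

lemma conv_assoc_l1:
  assumes "f summable_on UNIV" "g summable_on UNIV" "h summable_on UNIV"
  shows "conv (conv f g) h = conv f (conv g h)"
proof
  fix n
  obtain B where B: "\<And>k. norm (h k) \<le> B" using l1_bounded[OF assms(3)] by auto
  have "(\<lambda>(k,j). norm (f j * g (k - j)) * B) summable_on UNIV \<times> UNIV"
    using conv_pair_summable'[OF assms(1,2), unfolded summable_on_iff_abs_summable_on_complex]
      summable_on_cmult_left[of "\<lambda>(k,j). norm (f j * g (k - j))" "UNIV \<times> UNIV" B]
    by (simp add: case_prod_unfold)
  then have S: "(\<lambda>(k,j). f j * g (k - j) * h (n - k)) summable_on UNIV \<times> UNIV"
    by (rule csum_comparison)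
       (auto simp: norm_mult intro!: mult_left_mono B)
  have "conv (conv f g) h n = (\<Sum>\<^sub>\<infinity>k. \<Sum>\<^sub>\<infinity>j. f j * g (k - j) * h (n - k))"
    by (simp add: conv_def infsum_cmult_left')
  also have "\<dots> = (\<Sum>\<^sub>\<infinity>j. \<Sum>\<^sub>\<infinity>k. f j * g (k - j) * h (n - k))"
    by (rule infsum_swap_banach[OF S])
  also have "\<dots> = (\<Sum>\<^sub>\<infinity>j. f j * conv g h (n - j))"
  proof (rule infsum_cong)
    fix j
    have "(\<Sum>\<^sub>\<infinity>k. f j * g (k - j) * h (n - k)) = f j * (\<Sum>\<^sub>\<infinity>k. g (k - j) * h (n - k))"
      by (simp add: infsum_cmult_right' mult.assoc)
    also have "(\<Sum>\<^sub>\<infinity>k. g (k - j) * h (n - k)) = conv g h (n - j)"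
      unfolding conv_def
      by (rule infsum_reindex_bij_witness[where i = "\<lambda>k. k + j" and j = "\<lambda>k. k - j"])
         (auto simp: algebra_simps)
    finally show "(\<Sum>\<^sub>\<infinity>k. f j * g (k - j) * h (n - k)) = f j * conv g h (n - j)" .
  qed
  finally show "conv (conv f g) h n = conv f (conv g h) n"
    by (simp add: conv_def)
qed

lemma tw_inject: "q > 0 \<Longrightarrow> tw q f = tw q g \<Longrightarrow> f = g"
proof
  fix k assume "q > 0" "tw q f = tw q g"
  then have "tw q f k = tw q g k" by simp
  with \<open>q > 0\<close> show "f k = g k" by (simp add: tw_def)
qed

lemma conv_assoc:
  assumes "q > 0" "wl q f" "wl q g" "wl q h"
  shows "conv (conv f g) h = conv f (conv g h)"
  using conv_assoc_l1[of "tw q f" "tw q g" "tw q h"] assms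
  by (auto simp: wl_def conv_tw intro: tw_inject)

lemma wl_conv: "q > 0 \<Longrightarrow> wl q f \<Longrightarrow> wl q g \<Longrightarrow> wl q (conv f g)"
  using conv_l1(2)[of "tw q f" "tw q g"] by (simp add: wl_def conv_tw)

lemma nl_conv: "q > 0 \<Longrightarrow> wl q f \<Longrightarrow> wl q g \<Longrightarrow> nl q (conv f g) \<le> nl q f * nl q g"
  using conv_l1(3)[of "tw q f" "tw q g"] by (simp add: wl_def conv_tw nl_def)

lemma conv_summable:
  assumes "q > 0" "wl q f" "wl q g"
  shows "(\<lambda>k. f k * g (n - k)) summable_on UNIV"
proof -
  have "tw q f k * tw q g (n - k) = f k * g (n - k) * of_real (q powi n)" for k
  proof -
    have "q powi k * q powi (n - k) = q powi n"
      using assms(1) by (simp flip: power_int_add)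
    then show ?thesis unfolding tw_def
      by (metis (no_types, lifting) mult.assoc mult.left_commute of_real_mult)
  qed
  then have "(\<lambda>k. f k * g (n - k) * of_real (q powi n)) summable_on UNIV"
    using conv_l1(1)[of "tw q f" "tw q g" n] assms by (simp add: wl_def)
  then show ?thesis
    using assms(1) by (subst (asm) summable_on_cmult_left') auto
qed

lemma wl_add: "wl q f \<Longrightarrow> wl q g \<Longrightarrow> wl q (\<lambda>k. f k + g k)"
  using summable_on_add[of "tw q f" UNIV "tw q g"]
  by (simp add: wl_def tw_def[abs_def] algebra_simps)

lemma wl_cmult: "wl q f \<Longrightarrow> wl q (\<lambda>k. c * f k)"
  using summable_on_cmult_right[of "tw q f" UNIV c]
  by (simp add: wl_def tw_def[abs_def] algebra_simps)

lemma wl_diff: "wl q f \<Longrightarrow> wl q g \<Longrightarrow> wl q (\<lambda>k. f k - g k)"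
  using wl_add[of q f "\<lambda>k. (-1) * g k"] wl_cmult[of q g "-1"] by simp

lemma nl_add: 
  assumes "wl q f" "wl q g" shows "nl q (\<lambda>k. f k + g k) \<le> nl q f + nl q g"
proof -
  have "nl q (\<lambda>k. f k + g k) \<le> (\<Sum>\<^sub>\<infinity>k. norm (tw q f k) + norm (tw q g k))"
    unfolding nl_def
  proof (rule infsum_mono)
    show "norm (tw q (\<lambda>k. f k + g k) k) \<le> norm (tw q f k) + norm (tw q g k)" for k
      using norm_triangle_ineq[of "tw q f k" "tw q g k"] by (simp add: tw_def distrib_right)
  qed (intro wl_abs assms wl_add summable_on_add)+
  then show ?thesis using assms by (simp add: nl_def infsum_add wl_abs)
qed

lemma conv_add_left:
  assumes "q > 0" "wl q f" "wl q g" "wl q h"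
  shows "conv (\<lambda>k. f k + g k) h n = conv f h n + conv g h n"
  unfolding conv_def
  using conv_summable[OF assms(1,2,4)] conv_summable[OF assms(1,3,4)]
  by (simp add: distrib_right infsum_add)

lemma conv_cmult_left: "conv (\<lambda>k. c * f k) h n = c * conv f h n"
  unfolding conv_def by (simp add: mult.assoc infsum_cmult_right')

lemma conv_diff_left:
  assumes "q > 0" "wl q f" "wl q g" "wl q h"
  shows "conv (\<lambda>k. f k - g k) h n = conv f h n - conv g h n"
  using conv_add_left[OF assms(1,2) wl_cmult[OF assms(3), of "-1"] assms(4), of n]
    conv_cmult_left[of "-1" g h n] by simp

lemma conv_diff_right:
  assumes "q > 0" "wl q f" "wl q g" "wl q h"
  shows "conv h (\<lambda>k. f k - g k) n = conv h f n - conv h g n"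
  using conv_diff_left[OF assms] by (simp add: conv_commute[of h])

text \<open>The substitution z -> 1/z on Laurent coefficients; it exchanges the radii
  \<open>q\<close> and \<open>1/q\<close>.\<close>

definition rev_seq :: "(int \<Rightarrow> complex) \<Rightarrow> int \<Rightarrow> complex" where
  "rev_seq f k = f (- k)"

lemma tw_rev: "q > 0 \<Longrightarrow> tw q (rev_seq f) k = tw (1/q) f (- k)"
  by (simp add: tw_def rev_seq_def power_int_minus power_int_inverse inverse_eq_divide[symmetric])

lemma wl_rev: "q > 0 \<Longrightarrow> wl q (rev_seq f) \<longleftrightarrow> wl (1/q) f"
  unfolding wl_def
  by (rule summable_on_reindex_bij_witness[where i = uminus and j = uminus]) (auto simp: tw_rev)

lemma nl_rev: "q > 0 \<Longrightarrow> nl q (rev_seq f) = nl (1/q) f"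
  unfolding nl_def
  by (rule infsum_reindex_bij_witness[where i = uminus and j = uminus]) (auto simp: tw_rev)

lemma conv_rev: "conv (rev_seq f) (rev_seq g) = rev_seq (conv f g)"
proof
  fix n show "conv (rev_seq f) (rev_seq g) n = rev_seq (conv f g) n"
    unfolding conv_def rev_seq_def
    by (rule infsum_reindex_bij_witness[where i = uminus and j = uminus]) (auto simp: algebra_simps)
qed

definition delta :: "int \<Rightarrow> complex" where "delta k = (if k = 0 then 1 else 0)"

lemma conv_delta: "conv delta f = f"
proof
  fix n
  have "conv delta f n = (\<Sum>\<^sub>\<infinity>k\<in>{0}. delta k * f (n - k))"
    unfolding conv_def by (rule infsum_cong_neutral) (auto simp: delta_def)
  then show "conv delta f n = f n" by (simp add: delta_def)
qed

lemma conv_delta_right: "conv f delta = f"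
  by (simp add: conv_commute[of f] conv_delta)

lemma rev_delta: "rev_seq delta = delta"
  by (auto simp: rev_seq_def delta_def)

lemma wl_finite: "finite {k. f k \<noteq> 0} \<Longrightarrow> wl q f"
  unfolding wl_def
  by (rule finite_nonzero_values_imp_summable_on)
     (auto simp: tw_def elim!: rev_finite_subset)

subsection \<open>One-sided sequences\<close>

definition cf :: "complex fps \<Rightarrow> int \<Rightarrow> complex" where
  "cf A k = (if k < 0 then 0 else fps_nth A (nat k))"

lemma cf_neg [simp]: "k < 0 \<Longrightarrow> cf A k = 0"
  by (simp add: cf_def)

lemma cf_of_nat [simp]: "cf A (int k) = fps_nth A k"
  by (simp add: cf_def)

lemma cf_1: "cf 1 = delta"
  by (auto simp: cf_def delta_def)

lemma infsum_int_ge0: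
  assumes "\<And>k::int. k < 0 \<Longrightarrow> f k = 0"
  shows "infsum f UNIV = (\<Sum>\<^sub>\<infinity>k. f (int k))"
proof -
  have "infsum f UNIV = infsum f (range int)"
  proof (rule infsum_cong_neutral)
    fix x assume "x \<in> UNIV - range int"
    then have "x < 0" using zero_le_imp_eq_int[of x] by (cases "x < 0") auto
    then show "f x = 0" by (rule assms)
  qed auto
  then show ?thesis by (simp add: infsum_reindex o_def)
qed

lemma conv_cf: "conv (cf A) (cf B) = cf (A * B)"
proof
  fix n :: int
  show "conv (cf A) (cf B) n = cf (A * B) n"
  proof (cases "n < 0")
    case True
    then have "(\<lambda>k. cf A k * cf B (n - k)) = (\<lambda>k. 0)"
      by (intro ext) (auto simp: cf_def)
    then show ?thesis using True by (simp add: conv_def)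
  next
    case False
    then obtain m where m: "n = int m" using zero_le_imp_eq_int by (metis not_le)
    have "conv (cf A) (cf B) n = (\<Sum>\<^sub>\<infinity>k. cf A (int k) * cf B (n - int k))"
      unfolding conv_def by (rule infsum_int_ge0) auto
    also have "\<dots> = (\<Sum>\<^sub>\<infinity>k\<in>{0..m}. fps_nth A k * fps_nth B (m - k))"
    proof (rule infsum_cong_neutral)
      fix k assume "k \<in> UNIV \<inter> {0..m}"
      then have "n - int k = int (m - k)" by (simp add: m of_nat_diff)
      then show "cf A (int k) * cf B (n - int k) = fps_nth A k * fps_nth B (m - k)" by simp
    qed (auto simp: m)
    also have "\<dots> = cf (A * B) n"
      by (simp add: m fps_mult_nth)
    finally show ?thesis .
  qed
qed

text \<open>At nonnegative exponents powers increase with the radius. For two-sided sequences this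
  fails, hence the restriction to \<open>cf\<close>.\<close>

lemma wl_cf_mono:
  assumes "wl Q (cf A)" "0 < q" "q \<le> Q"
  shows "wl q (cf A)" "nl q (cf A) \<le> nl Q (cf A)"
proof -
  have Q: "Q > 0" using assms by simp
  have le: "norm (cf A k) * q powi k \<le> norm (cf A k) * Q powi k" for k
  proof (cases "k < 0")
    case False
    then have "q powi k \<le> Q powi k"
      using assms by (auto simp: power_int_def intro: power_mono)
    then show ?thesis by (rule mult_left_mono) simp
  qed simp
  have S: "(\<lambda>k. norm (cf A k) * Q powi k) summable_on UNIV" using assms Q wl_iff by blast
  show "wl q (cf A)"
    unfolding wl_iff[OF assms(2)]
    by (rule summable_on_comparison_test[OF S le]) (use assms in auto)
  then show "nl q (cf A) \<le> nl Q (cf A)"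
    unfolding nl_eq[OF assms(2)] nl_eq[OF Q] 
    by (intro infsum_mono le S) (simp add: wl_iff assms)
qed

subsection \<open>Convergence in the weighted norm\<close>

text \<open>Norm convergence on one circle makes convolution continuous; coefficientwise convergence
  alone would not.\<close>

definition wtends :: "real \<Rightarrow> (nat \<Rightarrow> int \<Rightarrow> complex) \<Rightarrow> (int \<Rightarrow> complex) \<Rightarrow> bool" where
  "wtends q F f \<longleftrightarrow> (\<forall>N. wl q (F N)) \<and> wl q f \<and> (\<lambda>N. nl q (\<lambda>k. F N k - f k)) \<longlonglongrightarrow> 0"

lemma wtends_const: "wl q f \<Longrightarrow> wtends q (\<lambda>_. f) f"
  by (simp add: wtends_def nl_def tw_def)

lemma wtends_pointwise:
  assumes "q > 0" "wtends q F f"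
  shows "(\<lambda>N. F N k) \<longlonglongrightarrow> f k"
proof -
  have 1: "(\<lambda>N. nl q (\<lambda>k. F N k - f k)) \<longlonglongrightarrow> 0" using assms by (simp add: wtends_def)
  have "norm (F N k - f k) \<le> nl q (\<lambda>k. F N k - f k) * (1 / q powi k)" for N
  proof -
    have "wl q (\<lambda>k. F N k - f k)" using assms(2) by (auto simp: wtends_def intro: wl_diff)
    from norm_le_nl[OF this assms(1), of k] show ?thesis
      using zero_less_power_int[OF assms(1), of k] by (simp add: pos_le_divide_eq)
  qed
  then have ev: "\<forall>N. norm (F N k - f k) \<le> nl q (\<lambda>k. F N k - f k) * (1 / q powi k)" by blast
  have "(\<lambda>N. nl q (\<lambda>k. F N k - f k) * (1 / q powi k)) \<longlonglongrightarrow> 0"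
    using tendsto_mult_right[OF 1, of "1 / q powi k"] by simp
  from Lim_null_comparison[OF always_eventually[OF ev] this] have "(\<lambda>N. F N k - f k) \<longlonglongrightarrow> 0" .
  then show ?thesis by (simp add: LIM_zero_iff)
qed

lemma wtends_conv:
  assumes "q > 0" "wtends q F f" "wtends q G g"
  shows "wtends q (\<lambda>N. conv (F N) (G N)) (conv f g)"
proof -
  have w: "wl q (F N)" "wl q f" "wl q (G N)" "wl q g" for N using assms by (auto simp: wtends_def)
  let ?a = "\<lambda>N. nl q (\<lambda>k. F N k - f k)" and ?b = "\<lambda>N. nl q (\<lambda>k. G N k - g k)"
  have lim: "?a \<longlonglongrightarrow> 0" "?b \<longlonglongrightarrow> 0" using assms by (auto simp: wtends_def)
  have bound: "nl q (\<lambda>k. conv (F N) (G N) k - conv f g k) \<le> ?a N * (?b N + nl q g) + nl q f * ?b N" for N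
  proof -
    have "(\<lambda>k. conv (F N) (G N) k - conv f g k) = (\<lambda>k. conv (\<lambda>k. F N k - f k) (G N) k + conv f (\<lambda>k. G N k - g k) k)"
      by (rule ext, subst conv_diff_left[OF assms(1) w(1) w(2) w(3)],
          subst conv_diff_right[OF assms(1) w(3) w(4) w(2)]) simp
    then have "nl q (\<lambda>k. conv (F N) (G N) k - conv f g k) \<le>
       nl q (conv (\<lambda>k. F N k - f k) (G N)) + nl q (conv f (\<lambda>k. G N k - g k))"
      using nl_add[of q "conv (\<lambda>k. F N k - f k) (G N)" "conv f (\<lambda>k. G N k - g k)"] w assms(1)
      by (simp add: wl_conv wl_diff)
    also have "\<dots> \<le> ?a N * nl q (G N) + nl q f * ?b N"
      using nl_conv[OF assms(1) wl_diff[OF w(1,2)] w(3), of N N]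
        nl_conv[OF assms(1) w(2) wl_diff[OF w(3,4)], of N] by (rule add_mono)
    also have "\<dots> \<le> ?a N * (?b N + nl q g) + nl q f * ?b N"
    proof -
      have "nl q (G N) \<le> ?b N + nl q g"
        using nl_add[of q "\<lambda>k. G N k - g k" g] w by (simp add: wl_diff)
      then show ?thesis by (intro add_right_mono mult_left_mono nl_nonneg)
    qed
    finally show ?thesis .
  qed
  have lim2: "(\<lambda>N. ?a N * (?b N + nl q g) + nl q f * ?b N) \<longlonglongrightarrow> 0"
    using tendsto_add[OF tendsto_mult[OF lim(1) tendsto_add[OF lim(2) tendsto_const[of "nl q g"]]]
        tendsto_mult[OF tendsto_const[of "nl q f"] lim(2)]] by simp
  have "(\<lambda>N. nl q (\<lambda>k. conv (F N) (G N) k - conv f g k)) \<longlonglongrightarrow> 0"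
    by (rule tendsto_sandwich[OF always_eventually always_eventually tendsto_const lim2])
       (use bound nl_nonneg in blast)+
  then show ?thesis using w assms(1) unfolding wtends_def by (blast intro: wl_conv)
qed

lemma wtends_rev:
  assumes "q > 0" "wtends (1/q) F f"
  shows "wtends q (\<lambda>N. rev_seq (F N)) (rev_seq f)"
proof -
  have "(\<lambda>k. rev_seq (F N) k - rev_seq f k) = rev_seq (\<lambda>k. F N k - f k)" for N
    by (auto simp: rev_seq_def)
  then show ?thesis using assms by (simp add: wtends_def wl_rev nl_rev)
qed

section \<open>Determinants\<close>

lemma detn_det: "detn n A = Determinant.det (Matrix.mat n n (\<lambda>(i,j). A i j))"
proof -
  have "Determinant.det (Matrix.mat n n (\<lambda>(i,j). A i j)) =
     (\<Sum>p\<in>{p. p permutes {0..<n}}. of_int (sign p) * (\<Prod>i = 0..<n. Matrix.mat n n (\<lambda>(i,j). A i j) $$ (i, p i)))"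
    by (subst Determinant.det_def'[of _ n]) (auto simp: sign_def)
  also have "\<dots> = detn n A"
    unfolding detn_def lessThan_atLeast0
    by (intro sum.cong refl arg_cong2[where f = "(*)"] prod.cong) (auto dest: permutes_in_image)
  finally show ?thesis ..
qed

lemma detn_cong:
  assumes "\<And>i j. i < n \<Longrightarrow> j < n \<Longrightarrow> A i j = B i j"
  shows "detn n A = detn n B"
  unfolding detn_def
  by (intro sum.cong refl arg_cong2[where f = "(*)"] prod.cong) (auto intro!: assms dest: permutes_in_image)

lemma detn_mult: "detn n (\<lambda>i j. \<Sum>k<n. A i k * B k j) = detn n A * detn n B"
proof -
  let ?M = "\<lambda>A. Matrix.mat n n (\<lambda>(i,j). A i j)"
  have "?M (\<lambda>i j. \<Sum>k<n. A i k * B k j) = ?M A * ?M B"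
    by (rule eq_matI) (auto simp: scalar_prod_def lessThan_atLeast0)
  then show ?thesis
    by (simp add: detn_det Determinant.det_mult[of _ n])
qed

lemma detn_transpose: "detn n (\<lambda>i j. A j i) = detn n A"
proof -
  have "Matrix.mat n n (\<lambda>(i,j). A j i) = Matrix.transpose_mat (Matrix.mat n n (\<lambda>(i,j). A i j))"
    by (rule eq_matI) auto
  then show ?thesis by (simp add: detn_det Determinant.det_transpose[of _ n])
qed

lemma detn_mult_transpose: "detn n (\<lambda>i j. \<Sum>k<n. A i k * B j k) = detn n A * detn n B"
  using detn_mult[of n A "\<lambda>k j. B j k"] detn_transpose[of n B] by simp

lemma detn_permute_rows:
  assumes "p permutes {..<n}"
  shows "detn n (\<lambda>i j. A (p i) j) = of_int (sign p) * detn n A"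
proof -
  have p: "p permutes {0..<n}" using assms by (simp add: lessThan_atLeast0)
  have "Matrix.mat n n (\<lambda>(i,j). A (p i) j) = Matrix.mat n n (\<lambda>(i,j). Matrix.mat n n (\<lambda>(i,j). A i j) $$ (p i, j))"
    using permutes_in_image[OF p] by (intro eq_matI) auto
  then show ?thesis
    by (simp add: detn_det Determinant.det_permute_rows[OF _ p] sign_def)
qed

lemma detn_identical_rows:
  assumes "i < n" "k < n" "i \<noteq> k" "\<And>j. j < n \<Longrightarrow> A i j = A k j"
  shows "detn n A = 0"
  unfolding detn_det
  by (rule Determinant.det_identical_rows[of _ n i k]) (use assms in \<open>auto intro!: eq_vecI\<close>)

text \<open>Every permutation of 0..n is the transposition of \<open>n\<close> and some
  \<open>b\<close> after a permutation fixing \<open>n\<close>; the transposition costs a sign and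
  puts column \<open>n\<close> in place of column \<open>b\<close>. Unlike a cofactor expansion this
  keeps rows and columns 0..n-1 in place and changes a single column, which is the form needed for
  summing over the last point of a kernel determinant.\<close>

lemma detn_Suc:
  "detn (Suc n) A = A n n * detn n A - (\<Sum>b<n. A n b * detn n (\<lambda>i j. A i (if j = b then n else j)))"
proof -
  let ?f = "\<lambda>p. of_int (sign p) * (\<Prod>i<Suc n. A i (p i))"
  let ?P = "{q. q permutes {..<n}}"
  have perm: "permutation q" if "q \<in> ?P" for q
    using that permutation_permutes by blast
  have term_b: "?f (Transposition.transpose n b \<circ> q) =
      - (A n b * (of_int (sign q) * (\<Prod>i<n. A i (if q i = b then n else q i))))" if "q \<in> ?P" "b < n" for q b
  proof -
    have s: "sign (Transposition.transpose n b \<circ> q) = - sign q"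
      using that perm[OF that(1)] by (simp add: sign_compose permutation_swap_id sign_swap_id)
    have qn: "q n = n" using that(1) by (auto simp: permutes_def)
    have "(\<Prod>i<n. A i ((Transposition.transpose n b \<circ> q) i)) = (\<Prod>i<n. A i (if q i = b then n else q i))"
    proof (rule prod.cong)
      fix i assume "i \<in> {..<n}"
      then have "q i < n" using that(1) permutes_in_image by fastforce
      then show "A i ((Transposition.transpose n b \<circ> q) i) = A i (if q i = b then n else q i)"
        by (auto simp: Transposition.transpose_def)
    qed simp
    then show ?thesis using s qn by (simp add: mult_ac)
  qed
  have "detn (Suc n) A = (\<Sum>b\<in>insert n {..<n}. \<Sum>q\<in>?P. ?f (Transposition.transpose n b \<circ> q))"
    unfolding detn_def lessThan_Suc by (subst sum_over_permutations_insert) simp_all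
  also have "\<dots> = (\<Sum>q\<in>?P. ?f q) + (\<Sum>b<n. \<Sum>q\<in>?P. ?f (Transposition.transpose n b \<circ> q))"
    by simp
  also have "(\<Sum>q\<in>?P. ?f q) = A n n * detn n A"
    unfolding detn_def sum_distrib_left
    by (rule sum.cong) (auto simp: permutes_def mult_ac)
  also have "(\<Sum>b<n. \<Sum>q\<in>?P. ?f (Transposition.transpose n b \<circ> q)) =
      (\<Sum>b<n. - (A n b * detn n (\<lambda>i j. A i (if j = b then n else j))))"
    unfolding detn_def sum_distrib_left sum_negf[symmetric]
    by (intro sum.cong refl term_b) auto
  finally show ?thesis by (simp add: sum_negf)
qed

lemma detn_0 [simp]: "detn 0 A = 1"
  by (simp add: detn_def)

lemma detn_Suc_last_row:
  assumes "\<And>j. j < n \<Longrightarrow> A n j = 0" "A n n = 1"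
  shows "detn (Suc n) A = detn n A"
  by (simp add: detn_Suc assms)

lemma detn_unitriangular:
  assumes "\<And>i j. j < i \<Longrightarrow> A i j = 0" "\<And>i. A i i = 1"
  shows "detn n A = 1"
  by (induction n) (simp_all add: detn_Suc_last_row assms)

section \<open>Summation of determinants over one variable\<close>

lemma csum_diff:
  fixes f g :: "'a \<Rightarrow> complex"
  assumes "(f has_sum a) X" "(g has_sum b) X"
  shows "((\<lambda>x. f x - g x) has_sum (a - b)) X"
proof -
  have "((\<lambda>x. - g x) has_sum - b) X" using assms(2) by (simp add: has_sum_uminus)
  from has_sum_add[OF assms(1) this] show ?thesis by simp
qed

lemma has_sum_sum:
  fixes f :: "'i \<Rightarrow> 'a \<Rightarrow> complex"
  assumes "\<And>i. i \<in> I \<Longrightarrow> (f i has_sum s i) X"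
  shows "((\<lambda>x. \<Sum>i\<in>I. f i x) has_sum (\<Sum>i\<in>I. s i)) X"
  using assms
proof (induction I rule: infinite_finite_induct)
  case (insert a F)
  then show ?case by (simp add: has_sum_add)
qed auto

text \<open>Each Leibniz term contains exactly one factor from column \<open>b\<close>, namely the
  one in row \<open>inv_into UNIV q b\<close>, so the sum passes through term by term.\<close>

lemma detn_column_has_sum:
  assumes b: "b < n" and s: "\<And>i. i < n \<Longrightarrow> ((\<lambda>x. c x * u i x) has_sum s i) X"
  shows "((\<lambda>x. c x * detn n (\<lambda>i j. if j = b then u i x else B i j)) has_sum
      detn n (\<lambda>i j. if j = b then s i else B i j)) X"
proof -
  let ?P = "{q. q permutes {..<n}}"
  have split: "(\<Prod>i<n. if q i = b then v i else B i (q i)) =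
      v (inv_into UNIV q b) * (\<Prod>i\<in>{..<n} - {inv_into UNIV q b}. B i (q i))" and lt: "inv_into UNIV q b < n" if "q \<in> ?P" for q and v :: "nat \<Rightarrow> complex"
  proof -
    have q: "q permutes {..<n}" using that by simp
    show lt: "inv_into UNIV q b < n"
      using permutes_in_image[OF permutes_inv[OF q], of b] b by simp
    have inv: "q i = b \<longleftrightarrow> i = inv_into UNIV q b" for i using permutes_inv_eq[OF q] by metis
    show "(\<Prod>i<n. if q i = b then v i else B i (q i)) = v (inv_into UNIV q b) * (\<Prod>i\<in>{..<n} - {inv_into UNIV q b}. B i (q i))"
      unfolding inv using lt by (subst prod.remove[of _ "inv_into UNIV q b"]) (auto intro!: prod.cong)
  qed
  have "((\<lambda>x. \<Sum>q\<in>?P. (of_int (sign q) * (\<Prod>i\<in>{..<n} - {inv_into UNIV q b}. B i (q i))) * (c x * u (inv_into UNIV q b) x)) has_sum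
     (\<Sum>q\<in>?P. (of_int (sign q) * (\<Prod>i\<in>{..<n} - {inv_into UNIV q b}. B i (q i))) * s (inv_into UNIV q b))) X"
    by (intro has_sum_sum has_sum_cmult_right s lt)
  moreover have "(\<lambda>x. c x * detn n (\<lambda>i j. if j = b then u i x else B i j)) =
     (\<lambda>x. \<Sum>q\<in>?P. (of_int (sign q) * (\<Prod>i\<in>{..<n} - {inv_into UNIV q b}. B i (q i))) * (c x * u (inv_into UNIV q b) x))"
    unfolding detn_def sum_distrib_left
    by (intro ext sum.cong refl, subst split) (auto simp: mult_ac)
  moreover have "detn n (\<lambda>i j. if j = b then s i else B i j) =
     (\<Sum>q\<in>?P. (of_int (sign q) * (\<Prod>i\<in>{..<n} - {inv_into UNIV q b}. B i (q i))) * s (inv_into UNIV q b))"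
    unfolding detn_def
    by (intro sum.cong refl, subst split) (auto simp: mult_ac)
  ultimately show ?thesis by simp
qed

text \<open>Dyson--Mehta integration of a projection kernel of rank \<open>N\<close> over the last variable.\<close>
lemma detn_kernel_has_sum:
  fixes K :: "'a \<Rightarrow> 'a \<Rightarrow> complex"
  assumes tr: "((\<lambda>x. K x x) has_sum of_nat N) X"
    and proj: "\<And>i j. i < n \<Longrightarrow> j < n \<Longrightarrow> ((\<lambda>x. K (k i) x * K x (k j)) has_sum K (k i) (k j)) X"
    and "n \<le> N"
  shows "((\<lambda>x. detn (Suc n) (\<lambda>i j. K ((k(n := x)) i) ((k(n := x)) j))) has_sum
     of_nat (N - n) * detn n (\<lambda>i j. K (k i) (k j))) X"
proof -
  let ?D = "detn n (\<lambda>i j. K (k i) (k j))"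
  have e: "detn (Suc n) (\<lambda>i j. K ((k(n := x)) i) ((k(n := x)) j)) =
     K x x * ?D - (\<Sum>b<n. K x (k b) * detn n (\<lambda>i j. if j = b then K (k i) x else K (k i) (k j)))" for x
    unfolding detn_Suc
    by (intro arg_cong2[where f = "(-)"] arg_cong2[where f = "(*)"] sum.cong detn_cong) auto
  have 1: "((\<lambda>x. K x x * ?D) has_sum of_nat N * ?D) X"
    by (rule has_sum_cmult_left[OF tr])
  have 2: "((\<lambda>x. \<Sum>b<n. K x (k b) * detn n (\<lambda>i j. if j = b then K (k i) x else K (k i) (k j))) has_sum
      (\<Sum>b<n. detn n (\<lambda>i j. if j = b then K (k i) (k b) else K (k i) (k j)))) X"
    by (intro has_sum_sum detn_column_has_sum) (use proj in \<open>auto simp: mult.commute\<close>)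
  \<comment> \<open>The projection property restores the original column \<open>b\<close> in each of
    the \<open>n\<close> terms, so together they take \<open>n\<close> copies of the smaller
    determinant away from the \<open>N\<close> copies given by the trace.\<close>
  have "(\<Sum>b<n. detn n (\<lambda>i j. if j = b then K (k i) (k b) else K (k i) (k j))) = (\<Sum>b<n. ?D)"
    by (intro sum.cong detn_cong) auto
  with csum_diff[OF 1 2] show ?thesis
    unfolding e using assms(3) by (simp add: algebra_simps of_nat_diff)
qed

lemma right_inverse_exists:
  fixes G :: "nat \<Rightarrow> nat \<Rightarrow> complex"
  assumes "detn n G \<noteq> 0"
  shows "\<exists>H. \<forall>i<n. \<forall>j<n. (\<Sum>l<n. G i l * H l j) = (if i = j then 1 else 0)"
proof -
  let ?M = "Matrix.mat n n (\<lambda>(i,j). G i j)"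
  have d: "Determinant.det ?M \<noteq> 0" using assms by (simp add: detn_det)
  then obtain H where H: "H \<in> carrier_mat n n" "?M * H = 1\<^sub>m n"
    using det_non_zero_imp_unit[of "?M" n "TYPE(complex)"]
    by (auto simp: Units_def ring_mat_def)
  have "(\<Sum>l<n. G i l * H $$ (l, j)) = (if i = j then 1 else 0)" if "i < n" "j < n" for i j
  proof -
    have "(\<Sum>l<n. G i l * H $$ (l, j)) = (?M * H) $$ (i, j)"
      using that H(1) by (auto simp: scalar_prod_def lessThan_atLeast0)
    then show ?thesis using that by (simp add: H(2))
  qed
  then show ?thesis by (intro exI[of _ "\<lambda>l j. H $$ (l, j)"]) simp
qed

section \<open>Partitions and point configurations\<close>

text \<open>Indices start at 0, so this is \<lambda>_(i+1) - (i+1), a point of the configuration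
  moved by 1/2 to the integers.\<close>

definition part_pt :: "nat list \<Rightarrow> nat \<Rightarrow> int" where
  "part_pt l i = int (parts l (Suc i)) - int i - 1"

text \<open>For a partition of length at most \<open>N\<close> the remaining points are all the
  integers below \<open>- int N\<close>, so these \<open>N\<close> points carry the whole
  information.\<close>

definition pts :: "nat \<Rightarrow> nat list \<Rightarrow> int set" where
  "pts N l = part_pt l ` {..<N}"

definition parts_le :: "nat \<Rightarrow> nat list set" where
  "parts_le N = {l \<in> partitions. length l \<le> N}"

lemma parts_Suc: "parts l (Suc i) = (if i < length l then l ! i else 0)"
  by (simp add: parts_def)

lemma parts_antimono:
  assumes "l \<in> partitions" "i \<le> j"
  shows "parts l (Suc j) \<le> parts l (Suc i)"
proof (cases "i < j \<and> j < length l")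
  case True
  then have "l ! i \<ge> l ! j"
    using assms(1) by (auto simp: partitions_def sorted_wrt_iff_nth_less)
  then show ?thesis using True by (simp add: parts_Suc)
next
  case False
  then show ?thesis using assms(2) by (cases "i = j") (auto simp: parts_Suc)
qed

lemma part_pt_less: "l \<in> partitions \<Longrightarrow> i < j \<Longrightarrow> part_pt l j < part_pt l i"
  using parts_antimono[of l i j] by (simp add: part_pt_def)

lemma part_pt_inj: "l \<in> partitions \<Longrightarrow> inj_on (part_pt l) A"
  by (rule inj_onI) (metis part_pt_less less_irrefl linorder_less_linear)

lemma card_pts: "l \<in> partitions \<Longrightarrow> card (pts N l) = N"
  unfolding pts_def by (simp add: card_image part_pt_inj)

lemma finite_pts: "finite (pts N l)"
  by (simp add: pts_def)

lemma pts_ge: "x \<in> pts N l \<Longrightarrow> x \<ge> - int N"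
  by (auto simp: pts_def part_pt_def)

text \<open>Both functions list the same finite set in decreasing order.\<close>

lemma strict_antimono_image_unique:
  fixes f g :: "nat \<Rightarrow> int"
  assumes "\<And>i j. i < j \<Longrightarrow> f j < f i" "\<And>i j. i < j \<Longrightarrow> g j < g i" "f ` {..<N} = g ` {..<N}" "i < N"
  shows "f i = g i"
proof -
  have s: "sorted (map h (rev [0..<N])) \<and> distinct (map h (rev [0..<N]))"
    if h: "\<And>i j. i < j \<Longrightarrow> h j < h i" for h :: "nat \<Rightarrow> int"
  proof
    show "sorted (map h (rev [0..<N]))"
      unfolding rev_map[symmetric] sorted_wrt_rev sorted_wrt_map
      by (auto simp: sorted_wrt_iff_nth_less intro!: less_imp_le h)
    have "inj h" by (rule injI) (metis h less_irrefl linorder_less_linear)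
    then show "distinct (map h (rev [0..<N]))" by (auto simp: distinct_map intro: inj_on_subset)
  qed
  have "map f (rev [0..<N]) = map g (rev [0..<N])"
    by (rule sorted_distinct_set_unique)
       (use s[of f] s[of g] assms(1-3) in \<open>auto simp: lessThan_atLeast0\<close>)
  then show ?thesis using assms(4) by auto
qed

lemma partition_eqI:
  assumes "l \<in> partitions" "l' \<in> partitions" "\<And>i. parts l (Suc i) = parts l' (Suc i)"
  shows "l = l'"
proof (rule nth_equalityI)
  have le: "length l \<le> length l'" if "l \<in> partitions" "\<And>i. parts l (Suc i) = parts l' (Suc i)" for l l'
  proof (rule ccontr)
    assume "\<not> ?thesis"
    then have "parts l (Suc (length l')) > 0"
      using that(1) by (auto simp: parts_Suc partitions_def)
    then show False by (simp add: that(2)) (simp add: parts_Suc)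
  qed
  show len: "length l = length l'" using le assms by (metis le_antisym)
  show "l ! i = l' ! i" if "i < length l" for i
    using assms(3)[of i] that len by (simp add: parts_Suc)
qed

lemma pts_inj:
  assumes "l \<in> parts_le N" "l' \<in> parts_le N" "pts N l = pts N l'"
  shows "l = l'"
proof (rule partition_eqI)
  show P: "l \<in> partitions" "l' \<in> partitions" using assms by (auto simp: parts_le_def)
  fix i
  show "parts l (Suc i) = parts l' (Suc i)"
  proof (cases "i < N")
    case True
    have "part_pt l i = part_pt l' i"
      by (rule strict_antimono_image_unique[OF part_pt_less[OF P(1)] part_pt_less[OF P(2)] assms(3)[unfolded pts_def] True])
    then show ?thesis by (simp add: part_pt_def)
  qed (use assms in \<open>auto simp: parts_le_def parts_Suc\<close>)
qed

lemma sorted_wrt_greater_gap: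
  fixes xs :: "int list"
  assumes "sorted_wrt (>) xs" "i + d < length xs"
  shows "xs ! i \<ge> xs ! (i + d) + int d"
  using assms(2)
proof (induction d)
  case (Suc d)
  have "xs ! (i + d) > xs ! (i + Suc d)"
    using assms(1) Suc.prems by (auto simp: sorted_wrt_iff_nth_less)
  with Suc show ?case by simp
qed simp

text \<open>List \<open>A\<close> in decreasing order and add i + 1 to its i-th element: strict
  decrease and the lower bound give weakly decreasing nonnegative parts. The zeros are therefore at
  the end, and \<open>takeWhile\<close> cuts them off.\<close>

lemma pts_surj:
  assumes "finite A" "card A = N" "\<And>x. x \<in> A \<Longrightarrow> x \<ge> - int N"
  shows "\<exists>l\<in>parts_le N. pts N l = A"
proof -
  define xs where "xs = rev (sorted_list_of_set A)"
  have len: "length xs = N" and set: "set xs = A" using assms by (auto simp: xs_def)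
  have sw: "sorted_wrt (>) xs"
    unfolding xs_def sorted_wrt_rev using strict_sorted_list_of_set[of A] by simp
  have ge: "xs ! i \<ge> - int i - 1" if "i < N" for i
  proof -
    have "xs ! i \<ge> xs ! (i + (N - 1 - i)) + int (N - 1 - i)"
      by (rule sorted_wrt_greater_gap[OF sw]) (use that len in auto)
    moreover have "xs ! (N - 1) \<in> set xs" by (rule nth_mem) (use that len in auto)
    then have "xs ! (N - 1) \<ge> - int N" using assms(3) set by blast
    ultimately show ?thesis using that by simp
  qed
  define f where "f i = nat (xs ! i + 1 + int i)" for i
  define ys where "ys = map f [0..<N]"
  have f: "int (f i) = xs ! i + 1 + int i" if "i < N" for i
    using ge[OF that] by (simp add: f_def)
  have anti: "f j \<le> f i" if "i \<le> j" "j < N" for i j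
    using sorted_wrt_greater_gap[OF sw, of i "j - i"] that len f[of i] f[of j] by simp
  define l where "l = takeWhile (\<lambda>x. 0 < x) ys"
  have l_len: "length l \<le> N" unfolding l_def ys_def using length_takeWhile_le[of _ ys] by (simp add: ys_def)
  have l_nth: "l ! i = f i" if "i < length l" for i
  proof -
    have "l ! i = ys ! i" using that unfolding l_def by (rule takeWhile_nth)
    then show ?thesis using that l_len by (simp add: ys_def)
  qed
  have "l \<in> partitions"
    unfolding partitions_def
  proof (intro CollectI conjI ballI)
    show "sorted_wrt (\<ge>) l"
      unfolding sorted_wrt_iff_nth_less using l_nth l_len anti by auto
    show "0 < x" if "x \<in> set l" for x using that unfolding l_def by (auto dest: set_takeWhileD)
  qed
  then have lP: "l \<in> parts_le N" using l_len by (simp add: parts_le_def)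
  have parts: "parts l (Suc i) = f i" if "i < N" for i
  proof (cases "i < length l")
    case True
    then show ?thesis by (simp add: parts_Suc l_nth)
  next
    case False
    then have ll: "length l < N" using that by simp
    have "\<not> 0 < ys ! length l"
      unfolding l_def by (rule nth_length_takeWhile) (use ll in \<open>simp add: l_def ys_def\<close>)
    then have "f (length l) = 0" using ll by (simp add: ys_def)
    then have "f i = 0" using anti[of "length l" i] False that by simp
    then show ?thesis using False by (simp add: parts_Suc)
  qed
  have "part_pt l i = xs ! i" if "i < N" for i
    using parts[OF that] f[OF that] by (simp add: part_pt_def)
  then have "pts N l = (\<lambda>i. xs ! i) ` {..<N}" by (auto simp: pts_def)
  also have "\<dots> = A" using set len by (auto simp: set_conv_nth)
  finally show ?thesis using lP by blast
qed

lemma sum_part_pt: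
  assumes "l \<in> parts_le N"
  shows "(\<Sum>i<N. part_pt l i + 1 + int i) = int (sum_list l)"
proof -
  have "(\<Sum>i<N. part_pt l i + 1 + int i) = (\<Sum>i<N. int (parts l (Suc i)))"
    by (simp add: part_pt_def)
  also have "\<dots> = (\<Sum>i<length l. int (parts l (Suc i)))"
    by (rule sum.mono_neutral_right) (use assms in \<open>auto simp: parts_le_def parts_Suc\<close>)
  also have "\<dots> = int (\<Sum>i<length l. l ! i)" by (simp add: parts_Suc)
  finally show ?thesis by (simp add: sum_list_sum_nth lessThan_atLeast0)
qed

lemma shifted_set_eq: "shifted_set l = range (part_pt l)"
proof -
  have "shifted_set l = (\<lambda>i. int (parts l i) - int i) ` {1..}"
    by (auto simp: shifted_set_def)
  also have "{1..} = Suc ` UNIV" by (auto simp: image_iff) presburger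
  finally show ?thesis by (simp add: image_image part_pt_def algebra_simps)
qed

lemma pts_iff_shifted:
  assumes "l \<in> parts_le N" "x \<ge> - int N"
  shows "x \<in> pts N l \<longleftrightarrow> x \<in> shifted_set l"
proof -
  have "i < N" if "x = part_pt l i" for i
  proof (rule ccontr)
    assume "\<not> i < N"
    then have "part_pt l i = - int i - 1" using assms(1) by (auto simp: part_pt_def parts_Suc parts_le_def)
    then show False using that assms(2) \<open>\<not> i < N\<close> by simp
  qed
  then show ?thesis by (auto simp: pts_def shifted_set_eq)
qed

section \<open>Correlation functions of biorthogonal ensembles\<close>

lemma permutation_onto_pts:
  assumes "l \<in> partitions" "inj_on k {..<N}" "pts N l = k ` {..<N}"
  shows "\<exists>p. p permutes {..<N} \<and> (\<forall>i<N. part_pt l i = k (p i))"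
proof -
  define p where "p i = (if i < N then inv_into {..<N} k (part_pt l i) else i)" for i
  have "bij_betw (inv_into {..<N} k \<circ> part_pt l) {..<N} {..<N}"
  proof (rule bij_betw_trans)
    show "bij_betw (part_pt l) {..<N} (k ` {..<N})"
      unfolding bij_betw_def using part_pt_inj[OF assms(1)] assms(3) by (simp add: pts_def)
    show "bij_betw (inv_into {..<N} k) (k ` {..<N}) {..<N}"
      by (rule bij_betw_inv_into) (simp add: bij_betw_def assms(2))
  qed
  then have "bij_betw p {..<N} {..<N}"
    by (rule bij_betw_cong[THEN iffD1, rotated]) (simp add: p_def)
  then have "p permutes {..<N}"
    by (rule bij_imp_permutes) (simp add: p_def)
  moreover have "part_pt l i = k (p i)" if "i < N" for i
  proof -
    have "part_pt l i \<in> k ` {..<N}" using that assms(3) by (auto simp: pts_def)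
    then show ?thesis using that by (simp add: p_def f_inv_into_f)
  qed
  ultimately show ?thesis by blast
qed

text \<open>Downward induction on \<open>n\<close>. For n = N the event is one configuration, and
  the product of the two determinants is det G times the kernel determinant because
  \<open>\<psi>\<close> is \<open>V\<close> times \<open>G\<close>. One point is removed by counting
  pairs of a configuration and an additional point in it.\<close>

lemma ensemble_correlation:
  fixes \<phi> \<psi> V :: "nat \<Rightarrow> int \<Rightarrow> complex" and w :: "nat list \<Rightarrow> complex" and k :: "nat \<Rightarrow> int"
  assumes psi: "\<And>l y. l < N \<Longrightarrow> y \<ge> - int N \<Longrightarrow> \<psi> l y = (\<Sum>j<N. V j y * G j l)"
    and biorth: "\<And>i j. i < N \<Longrightarrow> j < N \<Longrightarrow>
        ((\<lambda>x. \<phi> i x * V j x) has_sum (if i = j then 1 else 0)) {- int N..}"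
    and w: "\<And>l. l \<in> parts_le N \<Longrightarrow> w l = detn N (\<lambda>i j. \<phi> j (part_pt l i)) * detn N (\<lambda>i j. \<psi> j (part_pt l i))"
    and sw: "w summable_on parts_le N"
    and "n \<le> N" and "inj_on k {..<n}" and "\<And>i. i < n \<Longrightarrow> k i \<ge> - int N"
  shows "(w has_sum detn N G * detn n (\<lambda>i j. \<Sum>m<N. \<phi> m (k i) * V m (k j)))
     {l \<in> parts_le N. k ` {..<n} \<subseteq> pts N l}"
proof -
  define K where "K x y = (\<Sum>m<N. \<phi> m x * V m y)" for x y
  let ?Y = "{- int N..}"
  have "((\<lambda>x. \<phi> i x * V i x) has_sum 1) ?Y" if "i < N" for i using biorth[OF that that] by simp
  then have tr: "((\<lambda>x. K x x) has_sum of_nat N) ?Y"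
    using has_sum_sum[of "{..<N}" "\<lambda>m x. \<phi> m x * V m x" ?Y "\<lambda>_. 1"]
    by (simp add: K_def)
  have proj: "((\<lambda>x. K y x * K x z) has_sum K y z) ?Y" for y z
  proof -
    have e: "K y x * K x z = (\<Sum>m<N. \<Sum>m'<N. (\<phi> m y * V m' z) * (\<phi> m' x * V m x))" for x
      by (simp add: K_def sum_product mult_ac)
    have "((\<lambda>x. K y x * K x z) has_sum
        (\<Sum>m<N. \<Sum>m'<N. (\<phi> m y * V m' z) * (if m' = m then 1 else 0))) ?Y"
      unfolding e by (intro has_sum_sum has_sum_cmult_right biorth) auto
    moreover have "(\<Sum>m<N. \<Sum>m'<N. (\<phi> m y * V m' z) * (if m' = m then 1 else 0)) = K y z"
      by (simp add: K_def if_distrib cong: if_cong)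
    ultimately show ?thesis by simp
  qed
  have "(w has_sum detn N G * detn n (\<lambda>i j. K (k i) (k j))) {l \<in> parts_le N. k ` {..<n} \<subseteq> pts N l}"
    using assms(5-7)
  proof (induction "N - n" arbitrary: n k)
    case 0
    then have nN: "n = N" by simp
    have ck: "card (k ` {..<N}) = N" using 0 nN by (simp add: card_image)
    obtain l0 where l0: "l0 \<in> parts_le N" "pts N l0 = k ` {..<N}"
      using pts_surj[of "k ` {..<N}" N] ck 0 nN by auto
    have P: "l \<in> partitions" if "l \<in> parts_le N" for l using that by (simp add: parts_le_def)
    have "l = l0" if "l \<in> parts_le N" "k ` {..<N} \<subseteq> pts N l" for l
    proof -
      have "k ` {..<N} = pts N l"
        by (rule card_subset_eq[OF finite_pts that(2)]) (simp add: ck card_pts P that)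
      then show ?thesis using pts_inj that l0 by metis
    qed
    then have set: "{l \<in> parts_le N. k ` {..<n} \<subseteq> pts N l} = {l0}" unfolding nN using l0 by blast
    obtain p where p: "p permutes {..<N}" "\<And>i. i < N \<Longrightarrow> part_pt l0 i = k (p i)"
      using permutation_onto_pts[OF P[OF l0(1)] _ l0(2)] 0 nN by blast
    \<comment> \<open>The decreasing order of the points and the order of \<open>k\<close> differ by
      \<open>p\<close>; its sign enters both determinants and cancels.\<close>
    have perm: "detn N (\<lambda>i j. f j (part_pt l0 i)) = of_int (sign p) * detn N (\<lambda>i j. f j (k i))"
      for f :: "nat \<Rightarrow> int \<Rightarrow> complex"
    proof -
      have "detn N (\<lambda>i j. f j (part_pt l0 i)) = detn N (\<lambda>i j. f j (k (p i)))"
        by (rule detn_cong) (simp add: p)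
      then show ?thesis using detn_permute_rows[OF p(1), of "\<lambda>i j. f j (k i)"] by simp
    qed
    have "detn N (\<lambda>i j. \<psi> j (k i)) = detn N (\<lambda>i j. \<Sum>m<N. V m (k i) * G m j)"
      by (rule detn_cong) (use psi 0 nN in auto)
    then have 1: "detn N (\<lambda>i j. \<psi> j (k i)) = detn N (\<lambda>i j. V j (k i)) * detn N G"
      by (simp add: detn_mult)
    have 2: "detn N (\<lambda>i j. K (k i) (k j)) = detn N (\<lambda>i j. \<phi> j (k i)) * detn N (\<lambda>i j. V j (k i))"
      unfolding K_def by (rule detn_mult_transpose)
    have s: "of_int (sign p) * (of_int (sign p) :: complex) = 1"
      by (metis of_int_1 of_int_mult sign_idempotent)
    have "w l0 = (of_int (sign p) * of_int (sign p)) * (detn N (\<lambda>i j. \<phi> j (k i)) * (detn N (\<lambda>i j. V j (k i)) * detn N G))"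
      unfolding w[OF l0(1)] perm 1 by (simp only: mult_ac)
    then have "w l0 = detn N G * detn N (\<lambda>i j. K (k i) (k j))"
      unfolding s 2 by (simp only: mult_ac mult_1_left)
    then have "(w has_sum detn N G * detn n (\<lambda>i j. K (k i) (k j))) {l0}"
      unfolding nN by (intro has_sum_finiteI) auto
    then show ?case unfolding set .
  next
    case (Suc d)
    then have nN: "n < N" by simp
    define S where "S = {l \<in> parts_le N. k ` {..<n} \<subseteq> pts N l}"
    define S' where "S' x = {l \<in> parts_le N. (k(n := x)) ` {..<Suc n} \<subseteq> pts N l}" for x
    define B where "B l = pts N l - k ` {..<n}" for l
    define D where "D x = detn (Suc n) (\<lambda>i j. K ((k(n := x)) i) ((k(n := x)) j))" for x
    have cardB: "finite (B l)" "card (B l) = N - n" if "l \<in> S" for l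
    proof -
      have "card (k ` {..<n}) = n" using Suc.prems by (simp add: card_image)
      moreover have "card (pts N l) = N" "k ` {..<n} \<subseteq> pts N l"
        using that card_pts by (auto simp: S_def parts_le_def)
      ultimately show "card (B l) = N - n" unfolding B_def by (subst card_Diff_subset) auto
      show "finite (B l)" using finite_pts by (simp add: B_def)
    qed
    have swS: "w summable_on S" by (rule summable_on_subset_banach[OF sw]) (auto simp: S_def)
    have sumP: "(\<lambda>(l, x). w l) summable_on Sigma S B"
    proof (rule csum_normD, rule summable_on_SigmaI[where g = "\<lambda>l. of_nat (N - n) * norm (w l)"])
      show "((\<lambda>x. norm (case (l, x) of (l, x) \<Rightarrow> w l)) has_sum of_nat (N - n) * norm (w l)) (B l)" if "l \<in> S" for l
        by (rule has_sum_finiteI) (use cardB[OF that] in auto)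
      show "(\<lambda>l. of_nat (N - n) * norm (w l)) summable_on S"
        by (intro summable_on_cmult_right csum_norm swS)
    qed auto
    define T where "T = infsum w S"
    have hT: "(w has_sum T) S" using swS by (simp add: T_def)
    \<comment> \<open>A configuration in \<open>S\<close> has exactly N - n points outside
      \<open>k\<close>, so each weight is counted N - n times.\<close>
    have hP: "((\<lambda>(l, x). w l) has_sum of_nat (N - n) * T) (Sigma S B)"
    proof (rule has_sum_SigmaI[where g = "\<lambda>l. of_nat (N - n) * w l"])
      show "((\<lambda>x. case (l, x) of (l, x) \<Rightarrow> w l) has_sum of_nat (N - n) * w l) (B l)" if "l \<in> S" for l
        by (rule has_sum_finiteI) (use cardB[OF that] in auto)
      show "((\<lambda>l. of_nat (N - n) * w l) has_sum of_nat (N - n) * T) S"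
        by (intro has_sum_cmult_right hT)
    qed (use sumP in simp)
    have hQ: "((\<lambda>(x, l). w l) has_sum of_nat (N - n) * T) (Sigma (?Y - k ` {..<n}) S')"
    proof (rule has_sum_reindex_bij_witness[THEN iffD1, OF _ _ _ _ _ _ hP])
      show "prod.swap b \<in> Sigma S B" if "b \<in> Sigma (?Y - k ` {..<n}) S'" for b
        using that by (force simp: S_def S'_def B_def lessThan_Suc image_iff)
      show "prod.swap a \<in> Sigma (?Y - k ` {..<n}) S'" if "a \<in> Sigma S B" for a
        using that pts_ge by (force simp: S_def S'_def B_def lessThan_Suc image_iff)
    qed auto
    have inner: "(w has_sum detn N G * D x) (S' x)" if "x \<in> ?Y - k ` {..<n}" for x
      unfolding S'_def D_def
    proof (rule Suc.hyps(1))
      show "d = N - Suc n" using Suc.hyps(2) by simp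
      show "inj_on (k(n := x)) {..<Suc n}"
        using Suc.prems(2) that by (auto simp: inj_on_def less_Suc_eq)
    qed (use that Suc.prems nN in \<open>auto simp: less_Suc_eq\<close>)
    have h1: "((\<lambda>x. detn N G * D x) has_sum of_nat (N - n) * T) (?Y - k ` {..<n})"
      by (rule has_sum_SigmaD[OF hQ]) (use inner in simp)
    have "(D has_sum of_nat (N - n) * detn n (\<lambda>i j. K (k i) (k j))) ?Y"
      unfolding D_def by (rule detn_kernel_has_sum[OF tr proj]) (use nN in simp)
    then have h2: "((\<lambda>x. detn N G * D x) has_sum detn N G * (of_nat (N - n) * detn n (\<lambda>i j. K (k i) (k j)))) ?Y"
      by (rule has_sum_cmult_right)
    \<comment> \<open>At a point that is already used two rows coincide. Hence the new point may run
      over all of \<open>?Y\<close>, where the trace and projection properties hold.\<close>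
    have D0: "D x = 0" if x: "x \<in> k ` {..<n}" for x
    proof -
      obtain i where i: "i < n" "x = k i" using x by auto
      show ?thesis unfolding D_def
        by (rule detn_identical_rows[of i _ n]) (use i in auto)
    qed
    have "((\<lambda>x. detn N G * D x) has_sum detn N G * (of_nat (N - n) * detn n (\<lambda>i j. K (k i) (k j)))) (?Y - k ` {..<n})"
      by (rule has_sum_cong_neutral[THEN iffD1, OF _ _ _ h2]) (auto simp: D0)
    with h1 have "of_nat (N - n) * T = detn N G * (of_nat (N - n) * detn n (\<lambda>i j. K (k i) (k j)))"
      by (rule has_sum_unique)
    then have "of_nat (N - n) * T = of_nat (N - n) * (detn N G * detn n (\<lambda>i j. K (k i) (k j)))"
      by (simp only: mult_ac)
    moreover have "of_nat (N - n) \<noteq> (0 :: complex)" using nN by simp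
    ultimately have "T = detn N G * detn n (\<lambda>i j. K (k i) (k j))"
      by (metis mult_cancel_left)
    then show ?case using hT by (simp add: S_def)
  qed
  then show ?thesis by (simp add: K_def)
qed

section \<open>Absolute bounds for Jacobi--Trudi determinants\<close>

text \<open>After the Leibniz expansion, pairs of a partition and a permutation inject into the maps
  from columns to points; summing over all such maps factors over the columns. In each factor the
  negative points contribute exactly 1, and 1 + s <= exp s gives a bound that is uniform in
  \<open>N\<close>.\<close>

lemma det_weight_sum_le:
  fixes M :: "int \<Rightarrow> nat \<Rightarrow> complex"
  assumes q: "q > 0"
    and neg: "\<And>x j. x < 0 \<Longrightarrow> M x j = (if x = - 1 - int j then 1 else 0)"
    and C: "\<And>J B. (\<Sum>j<J. \<Sum>x<B. norm (M (int x) j) * q powi (int x + 1 + int j)) \<le> C"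
    and F: "finite F" "F \<subseteq> parts_le N"
  shows "(\<Sum>l\<in>F. norm (detn N (\<lambda>i j. M (part_pt l i) j)) * q ^ sum_list l) \<le> exp C"
proof -
  let ?P = "{s. s permutes {..<N}}"
  define m where "m x j = norm (M x j) * q powi (x + 1 + int j)" for x j
  have m0: "m x j \<ge> 0" for x j using q by (simp add: m_def)
  have bound: "norm (detn N (\<lambda>i j. M (part_pt l i) j)) * q ^ sum_list l
      \<le> (\<Sum>s\<in>?P. \<Prod>j<N. m (part_pt l (s j)) j)" if l: "l \<in> parts_le N" for l
  proof -
    \<comment> \<open>The exponents add up to |\<lambda>| for every permutation, so the weight can
      be distributed over the columns.\<close>
    have pw: "(\<Prod>j<N. q powi (part_pt l (s j) + 1 + int j)) = q ^ sum_list l" if s: "s \<in> ?P" for s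
    proof -
      have "(\<Prod>j<N. q powi (part_pt l (s j) + 1 + int j)) = q powi (\<Sum>j<N. part_pt l (s j) + 1 + int j)"
        using q by (induction N) (simp_all add: power_int_add)
      also have "(\<Sum>j<N. part_pt l (s j) + 1 + int j) = (\<Sum>j<N. part_pt l (s j)) + (\<Sum>j<N. 1 + int j)"
        by (simp add: sum.distrib)
      also have "(\<Sum>j<N. part_pt l (s j)) = (\<Sum>j<N. part_pt l j)"
        using sum.permute[of s "{..<N}" "part_pt l"] s by (simp add: o_def)
      also have "\<dots> + (\<Sum>j<N. 1 + int j) = int (sum_list l)"
        using sum_part_pt[OF l] by (simp add: sum.distrib)
      finally show ?thesis by simp
    qed
    have "detn N (\<lambda>i j. M (part_pt l i) j) = (\<Sum>s\<in>?P. of_int (sign s) * (\<Prod>j<N. M (part_pt l (s j)) j))"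
      using detn_transpose[of N "\<lambda>i j. M (part_pt l i) j"] by (simp add: detn_def)
    also have "norm \<dots> \<le> (\<Sum>s\<in>?P. norm (\<Prod>j<N. M (part_pt l (s j)) j))"
      by (rule order.trans[OF norm_sum]) (auto intro!: sum_mono simp: norm_mult sign_def)
    finally have "norm (detn N (\<lambda>i j. M (part_pt l i) j)) * q ^ sum_list l
        \<le> (\<Sum>s\<in>?P. norm (\<Prod>j<N. M (part_pt l (s j)) j)) * q ^ sum_list l"
      using q by (intro mult_right_mono) auto
    also have "\<dots> = (\<Sum>s\<in>?P. norm (\<Prod>j<N. M (part_pt l (s j)) j) * (\<Prod>j<N. q powi (part_pt l (s j) + 1 + int j)))"
      unfolding sum_distrib_right by (rule sum.cong) (simp_all add: pw)
    also have "\<dots> = (\<Sum>s\<in>?P. \<Prod>j<N. m (part_pt l (s j)) j)"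
      by (simp add: m_def prod_norm[symmetric] prod.distrib)
    finally show ?thesis .
  qed
  have "finite (\<Union>l\<in>F. pts N l)" using F finite_pts by auto
  then obtain B0 where B0: "\<And>x. x \<in> (\<Union>l\<in>F. pts N l) \<Longrightarrow> x \<le> B0"
    using bdd_above_finite[of "\<Union>l\<in>F. pts N l"] by (auto simp: bdd_above_def)
  define B where "B = nat (B0 + 1)"
  define I where "I = {- int N..<int B}"
  define \<Phi> where "\<Phi> = (\<lambda>(l, s). restrict (\<lambda>j. part_pt l (s j)) {..<N})"
  have img: "\<Phi> ` (F \<times> ?P) \<subseteq> PiE {..<N} (\<lambda>_. I)"
  proof clarify
    fix l s assume ls: "l \<in> F" "s permutes {..<N}"
    have "part_pt l (s j) \<in> I" if "j < N" for j
    proof -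
      have "s j < N" using permutes_in_image[OF ls(2), of j] that by simp
      then have x: "part_pt l (s j) \<in> pts N l" by (simp add: pts_def)
      then have "part_pt l (s j) \<le> B0" using B0 ls by blast
      then show ?thesis using pts_ge[OF x] unfolding I_def B_def by auto
    qed
    then show "\<Phi> (l, s) \<in> PiE {..<N} (\<lambda>_. I)" by (auto simp: \<Phi>_def)
  qed
  have inj: "inj_on \<Phi> (F \<times> ?P)"
  proof (rule inj_onI, clarify)
    fix l s l' s'
    assume A: "l \<in> F" "s permutes {..<N}" "l' \<in> F" "s' permutes {..<N}" and eq: "\<Phi> (l, s) = \<Phi> (l', s')"
    have e: "part_pt l (s j) = part_pt l' (s' j)" if "j < N" for j
      using fun_cong[OF eq, of j] that by (simp add: \<Phi>_def)
    have im: "pts N l = (\<lambda>j. part_pt l (s j)) ` {..<N}" if "s permutes {..<N}" for l s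
      unfolding pts_def image_image[symmetric, of "part_pt l" s] using permutes_image[OF that] by simp
    have "pts N l = pts N l'"
      unfolding im[OF A(2), of l] im[OF A(4), of l'] by (rule image_cong) (simp_all add: e)
    then have ll: "l = l'" using pts_inj A F by blast
    have P: "l \<in> partitions" using A F by (auto simp: parts_le_def)
    have "s j = s' j" for j
    proof (cases "j < N")
      case True
      then show ?thesis using e[OF True] part_pt_inj[OF P, of UNIV] by (simp add: ll inj_on_def)
    next
      case False
      then show ?thesis using permutes_not_in[OF A(2), of j] permutes_not_in[OF A(4), of j] by simp
    qed
    with ll show "l = l' \<and> s = s'" by blast
  qed
  have "(\<Sum>l\<in>F. norm (detn N (\<lambda>i j. M (part_pt l i) j)) * q ^ sum_list l)
      \<le> (\<Sum>l\<in>F. \<Sum>s\<in>?P. \<Prod>j<N. m (part_pt l (s j)) j)"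
    by (intro sum_mono bound) (use F in auto)
  also have "\<dots> = (\<Sum>p\<in>F \<times> ?P. \<Prod>j<N. m (\<Phi> p j) j)"
    unfolding sum.cartesian_product by (intro sum.cong) (auto simp: \<Phi>_def)
  also have "\<dots> = (\<Sum>g\<in>\<Phi> ` (F \<times> ?P). \<Prod>j<N. m (g j) j)"
    using inj by (simp add: sum.reindex)
  also have "\<dots> \<le> (\<Sum>g\<in>PiE {..<N} (\<lambda>_. I). \<Prod>j<N. m (g j) j)"
    by (rule sum_mono2[OF _ img]) (auto intro!: finite_PiE prod_nonneg m0 simp: I_def)
  also have "\<dots> = (\<Prod>j<N. \<Sum>x\<in>I. m x j)"
    by (rule prod_sum_PiE[symmetric]) (auto simp: I_def)
  also have "\<dots> \<le> (\<Prod>j<N. exp (\<Sum>x<B. m (int x) j))"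
  proof (rule prod_mono, intro conjI)
    fix j assume "j \<in> {..<N}"
    then have j: "j < N" by simp
    show "0 \<le> (\<Sum>x\<in>I. m x j)" by (intro sum_nonneg m0)
    have I: "I = {- int N..<0} \<union> int ` {..<B}"
      using image_int_atLeastLessThan[of 0 B] by (auto simp: I_def lessThan_atLeast0)
    have neg_m: "m x j = (if x = - 1 - int j then 1 else 0)" if "x \<in> {- int N..<0}" for x
      using that neg[of x j] by (auto simp: m_def)
    have "(\<Sum>x\<in>I. m x j) = (\<Sum>x\<in>{- int N..<0}. m x j) + (\<Sum>x\<in>int ` {..<B}. m x j)"
      unfolding I by (rule sum.union_disjoint) auto
    also have "(\<Sum>x\<in>{- int N..<0}. m x j) = (\<Sum>x\<in>{- int N..<0}. if x = - 1 - int j then 1 else 0)"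
      by (rule sum.cong[OF refl neg_m])
    also have "\<dots> = 1" using j by simp
    also have "(\<Sum>x\<in>int ` {..<B}. m x j) = (\<Sum>x<B. m (int x) j)"
      by (simp add: sum.reindex)
    also have "1 + \<dots> \<le> exp (\<Sum>x<B. m (int x) j)" by (rule exp_ge_add_one_self)
    finally show "(\<Sum>x\<in>I. m x j) \<le> exp (\<Sum>x<B. m (int x) j)" .
  qed
  also have "\<dots> = exp (\<Sum>j<N. \<Sum>x<B. m (int x) j)" by (simp add: exp_sum)
  also have "\<dots> \<le> exp C" using C[of B N] by (simp add: m_def)
  finally show ?thesis .
qed

text \<open>At the point x = \<lambda>_(i+1) - i - 1 the first index is \<lambda>_(i+1) - i + j; the
  second one is \<lambda>_(i+1) - i - j for c = 1 and \<lambda>_(i+1) - i - j - 2 for c = -1, as in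
  the two characters. With \<open>t = 0\<close> this is the Jacobi-Trudi entry.\<close>

definition jt_fun :: "(int \<Rightarrow> complex) \<Rightarrow> (nat \<Rightarrow> complex) \<Rightarrow> int \<Rightarrow> nat \<Rightarrow> int \<Rightarrow> complex" where
  "jt_fun a t c j x = a (x + 1 + int j) + t j * a (x + c - int j)"

lemma sum_convolution_le:
  fixes u v :: "nat \<Rightarrow> real"
  assumes "\<And>k. u k \<ge> 0" "\<And>k. v k \<ge> 0" "\<And>J. (\<Sum>k<J. u k) \<le> U" "\<And>J. (\<Sum>k<J. v k) \<le> V"
  shows "(\<Sum>j<J. \<Sum>k\<le>j. u k * v (j - k)) \<le> U * V"
proof -
  have "(\<Sum>j<J. \<Sum>k\<le>j. u k * v (j - k)) = (\<Sum>(i,j)\<in>{(i,j). i + j < J}. u i * v j)"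
    by (rule sum.triangle_reindex[symmetric])
  also have "\<dots> \<le> (\<Sum>(i,j)\<in>{..<J} \<times> {..<J}. u i * v j)"
    by (rule sum_mono2) (auto simp: assms)
  also have "\<dots> = (\<Sum>k<J. u k) * (\<Sum>k<J. v k)"
    by (simp add: sum_product sum.cartesian_product)
  also have "\<dots> \<le> U * V"
    using assms(3)[of 0] by (intro mult_mono assms sum_nonneg) auto
  finally show ?thesis .
qed

lemma geometric_sum_le:
  fixes r :: real
  assumes "0 \<le> r" "r < 1"
  shows "(\<Sum>k<J. r ^ k) \<le> 1 / (1 - r)"
  using sum_le_suminf[of "\<lambda>k. r ^ k" "{..<J}"] assms by (simp add: suminf_geometric summable_geometric)

lemma nl_cf_sum_le:
  assumes "q > 0" "wl q (cf A)"
  shows "(\<Sum>k<J. norm (fps_nth A k) * q ^ k) \<le> nl q (cf A)"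
proof -
  have "(\<Sum>k<J. norm (fps_nth A k) * q ^ k) = (\<Sum>k\<in>int ` {..<J}. norm (cf A k) * q powi k)"
    by (simp add: sum.reindex)
  also have "\<dots> \<le> nl q (cf A)" by (rule sum_le_nl) (use assms in auto)
  finally show ?thesis .
qed

text \<open>Column operations with the coefficients of the inverse series turn the rows indexed by negative
  points into unit vectors (as in Giambelli's formula); what is left decays in both indices.\<close>
lemma jt_det_sum_le:
  fixes A :: "complex fps" and t :: "nat \<Rightarrow> complex"
  assumes q: "0 < q" "q < Q" and wA: "wl Q (cf A)" and wI: "wl Q (cf (inverse A))"
    and A0: "fps_nth A 0 = 1"
    and CA: "nl Q (cf A) \<le> CA" and CI: "nl Q (cf (inverse A)) \<le> CI"
    and t: "\<And>j. norm (t j) \<le> \<tau>" and \<tau>: "q < 1 \<or> \<tau> = 0"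
    and t0: "\<And>i x. x < 0 \<Longrightarrow> t i * cf A (x + c - int i) = 0"
    and F: "finite F" "F \<subseteq> parts_le N"
  shows "(\<Sum>l\<in>F. norm (detn N (\<lambda>i j. jt_fun (cf A) t c j (part_pt l i))) * q ^ sum_list l)
     \<le> exp (CA * CI / (1 - q / Q)^2 + \<tau> * q powi (1 - c) * CA * CI / (1 - q^2))"
proof -
  define \<alpha> where "\<alpha> k = fps_nth (inverse A) k" for k
  define M where "M x j = (\<Sum>k\<le>j. \<alpha> k * jt_fun (cf A) t c (j - k) x)" for x j
  have Q: "Q > 0" using q by simp
  have r: "0 \<le> q / Q" "q / Q < 1" using q by auto
  have CA0: "CA \<ge> 0" and CI0: "CI \<ge> 0" using nl_nonneg CA CI order.trans by blast+
  have \<tau>0: "\<tau> \<ge> 0" using t[of 0] norm_ge_zero order.trans by blast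
  have det_eq: "detn N (\<lambda>i j. M (part_pt l i) j) = detn N (\<lambda>i j. jt_fun (cf A) t c j (part_pt l i))" for l
  proof -
    define U where "U m j = (if m \<le> j then \<alpha> (j - m) else 0)" for m j
    have e: "M x j = (\<Sum>m<N. jt_fun (cf A) t c m x * U m j)" if "j < N" for x j
    proof -
      have "M x j = (\<Sum>m\<le>j. \<alpha> (j - m) * jt_fun (cf A) t c m x)"
        unfolding M_def by (rule sum.reindex_bij_witness[where i = "\<lambda>m. j - m" and j = "\<lambda>m. j - m"]) auto
      also have "\<dots> = (\<Sum>m<N. jt_fun (cf A) t c m x * U m j)"
        by (rule sum.mono_neutral_cong_left) (use that in \<open>auto simp: U_def\<close>)
      finally show ?thesis .
    qed
    have "detn N (\<lambda>i j. M (part_pt l i) j) = detn N (\<lambda>i j. \<Sum>m<N. jt_fun (cf A) t c m (part_pt l i) * U m j)"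
      by (rule detn_cong) (simp add: e)
    moreover have "detn N U = 1"
      by (rule detn_unitriangular) (auto simp: U_def \<alpha>_def A0)
    ultimately show ?thesis by (simp add: detn_mult)
  qed
  have neg: "M x j = (if x = - 1 - int j then 1 else 0)" if x: "x < 0" for x j
  proof -
    have "M x j = (\<Sum>k\<le>j. \<alpha> k * cf A (x + 1 + int j - int k))"
      unfolding M_def
    proof (rule sum.cong[OF refl])
      fix k assume k: "k \<in> {..j}"
      have z: "t (j - k) * cf A (x + c - int (j - k)) = 0" by (rule t0[OF x])
      have a: "x + 1 + int (j - k) = x + 1 + int j - int k" using k by simp
      show "\<alpha> k * jt_fun (cf A) t c (j - k) x = \<alpha> k * cf A (x + 1 + int j - int k)"
        unfolding jt_fun_def z a by simp
    qed
    also have "\<dots> = (if x = - 1 - int j then 1 else 0)"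
    proof (cases "x + 1 + int j < 0")
      case False
      then obtain n where n: "x + 1 + int j = int n" using zero_le_imp_eq_int by (metis not_le)
      have nj: "n \<le> j" using n x by simp
      have "(\<Sum>k\<le>j. \<alpha> k * cf A (x + 1 + int j - int k)) = (\<Sum>k=0..n. \<alpha> k * fps_nth A (n - k))"
        unfolding n
      proof (rule sum.mono_neutral_cong_right)
        fix k assume "k \<in> {0..n}"
        then have nk: "int n - int k = int (n - k)" by simp
        show "\<alpha> k * cf A (int n - int k) = \<alpha> k * fps_nth A (n - k)" unfolding nk cf_of_nat ..
      qed (use nj in auto)
      also have "\<dots> = fps_nth (inverse A * A) n" by (simp add: fps_mult_nth \<alpha>_def)
      also have "inverse A * A = 1" by (rule inverse_mult_eq_1) (simp add: A0)
      finally show ?thesis using n by auto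
    qed auto
    finally show ?thesis .
  qed
  have wq: "wl q (cf A)" "nl q (cf A) \<le> CA" "wl q (cf (inverse A))" "nl q (cf (inverse A)) \<le> CI"
    using wl_cf_mono[OF wA] wl_cf_mono[OF wI] q CA CI by fastforce+
  \<comment> \<open>Passing from \<open>Q\<close> to the smaller radius \<open>q\<close> gives
    geometric decay in the index, hence in x and in the column separately.\<close>
  have dec: "norm (cf A (int m)) * q ^ m \<le> CA * (q / Q) ^ m" for m
  proof -
    have "norm (cf A (int m)) * Q ^ m \<le> CA"
      using norm_le_nl[OF wA Q, of "int m"] CA by simp
    then have "norm (cf A (int m)) * Q ^ m * (q / Q) ^ m \<le> CA * (q / Q) ^ m"
      using r by (intro mult_right_mono) auto
    then show ?thesis using Q by (simp add: power_divide)
  qed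
  have al: "(\<Sum>k<J. norm (\<alpha> k) * q ^ k) \<le> CI" for J
    using nl_cf_sum_le[OF q(1) wq(3), of J] wq(4) by (simp add: \<alpha>_def)
  have entry: "norm (M (int x) j) * q powi (int x + 1 + int j) \<le>
      (\<Sum>k\<le>j. (norm (\<alpha> k) * q ^ k) * (CA * (q / Q) ^ x * (q / Q) ^ (j - k))) +
      (\<Sum>k\<le>j. (norm (\<alpha> k) * q ^ k) * (\<tau> * q powi (1 - c) * (norm (cf A (int x + c - int (j - k))) * q powi (int x + c - int (j - k))) * (q\<^sup>2) ^ (j - k)))"
    for x j
  proof -
    have term_le: "norm (\<alpha> k * jt_fun (cf A) t c (j - k) (int x)) * q powi (int x + 1 + int j) \<le>
       (norm (\<alpha> k) * q ^ k) * (CA * (q / Q) ^ x * (q / Q) ^ (j - k)) +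
       (norm (\<alpha> k) * q ^ k) * (\<tau> * q powi (1 - c) * (norm (cf A (int x + c - int (j - k))) * q powi (int x + c - int (j - k))) * (q\<^sup>2) ^ (j - k))"
      if k: "k \<le> j" for k
    proof -
      define i where "i = j - k"
      have j: "j = k + i" using k by (simp add: i_def)
      have p1: "q powi (int x + 1 + int j) = q ^ k * q ^ (x + 1 + i)"
      proof -
        have "int x + 1 + int j = int (k + (x + 1 + i))" by (simp add: j)
        then show ?thesis by (simp only: power_int_of_nat power_add)
      qed
      \<comment> \<open>The reflected index x + c - i falls short of x + 1 + i by 2i + 1 - c, so a
        factor q^(2i) is left over; its summation is where \<open>q < 1\<close> enters when \<tau>
        is nonzero.\<close>
      have p2: "q powi (int x + 1 + int j) = q ^ k * (q powi (1 - c) * q powi (int x + c - int i) * (q\<^sup>2) ^ i)"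
      proof -
        have "(q\<^sup>2) ^ i = q powi (2 * int i)" "q ^ k = q powi int k" by (simp_all add: power_mult[symmetric] power_int_def nat_mult_distrib)
        moreover have "q powi (int x + 1 + int j) = q powi (int k + ((1 - c) + (int x + c - int i) + 2 * int i))"
          by (rule arg_cong[where f = "\<lambda>n. q powi n"]) (simp add: j)
        moreover have qn: "q \<noteq> 0" using q by simp
        ultimately show ?thesis by (simp only: power_int_add[OF disjI1[OF qn]] mult.assoc)
      qed
      have "norm (jt_fun (cf A) t c i (int x)) \<le> norm (cf A (int (x + 1 + i))) + \<tau> * norm (cf A (int x + c - int i))"
        unfolding jt_fun_def
        by (rule order.trans[OF norm_triangle_ineq])
           (auto simp: norm_mult algebra_simps intro!: mult_right_mono t)
      then have "norm (\<alpha> k * jt_fun (cf A) t c i (int x)) * q powi (int x + 1 + int j) \<le>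
          norm (\<alpha> k) * (norm (cf A (int (x + 1 + i))) + \<tau> * norm (cf A (int x + c - int i))) * q powi (int x + 1 + int j)"
        unfolding norm_mult using q by (intro mult_right_mono mult_left_mono) auto
      also have "\<dots> = norm (\<alpha> k) * norm (cf A (int (x + 1 + i))) * q powi (int x + 1 + int j) +
          norm (\<alpha> k) * (\<tau> * norm (cf A (int x + c - int i))) * q powi (int x + 1 + int j)"
        by (simp only: distrib_left distrib_right)
      also have "norm (\<alpha> k) * norm (cf A (int (x + 1 + i))) * q powi (int x + 1 + int j) =
          (norm (\<alpha> k) * q ^ k) * (norm (cf A (int (x + 1 + i))) * q ^ (x + 1 + i))"
        unfolding p1 by (simp only: mult_ac)
      also have "norm (\<alpha> k) * (\<tau> * norm (cf A (int x + c - int i))) * q powi (int x + 1 + int j) =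
          (norm (\<alpha> k) * q ^ k) * (\<tau> * q powi (1 - c) * (norm (cf A (int x + c - int i)) * q powi (int x + c - int i)) * (q\<^sup>2) ^ i)"
        unfolding p2 by (simp only: mult_ac)
      also have "(norm (\<alpha> k) * q ^ k) * (norm (cf A (int (x + 1 + i))) * q ^ (x + 1 + i)) \<le>
          (norm (\<alpha> k) * q ^ k) * (CA * (q / Q) ^ x * (q / Q) ^ i)"
      proof (rule mult_left_mono)
        have "norm (cf A (int (x + 1 + i))) * q ^ (x + 1 + i) \<le> CA * (q / Q) ^ (x + 1 + i)" by (rule dec)
        also have "\<dots> \<le> CA * (q / Q) ^ (x + i)"
          using CA0 r by (intro mult_left_mono power_decreasing) auto
        finally show "norm (cf A (int (x + 1 + i))) * q ^ (x + 1 + i) \<le> CA * (q / Q) ^ x * (q / Q) ^ i"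
          by (simp only: power_add mult.assoc)
      qed (use q in auto)
      finally show ?thesis by (simp add: i_def)
    qed
    have "norm (M (int x) j) * q powi (int x + 1 + int j) \<le>
       (\<Sum>k\<le>j. norm (\<alpha> k * jt_fun (cf A) t c (j - k) (int x))) * q powi (int x + 1 + int j)"
      unfolding M_def using q by (intro mult_right_mono norm_sum) auto
    also have "\<dots> = (\<Sum>k\<le>j. norm (\<alpha> k * jt_fun (cf A) t c (j - k) (int x)) * q powi (int x + 1 + int j))"
      by (rule sum_distrib_right)
    also have "\<dots> \<le> (\<Sum>k\<le>j. (norm (\<alpha> k) * q ^ k) * (CA * (q / Q) ^ x * (q / Q) ^ (j - k)) +
       (norm (\<alpha> k) * q ^ k) * (\<tau> * q powi (1 - c) * (norm (cf A (int x + c - int (j - k))) * q powi (int x + c - int (j - k))) * (q\<^sup>2) ^ (j - k)))"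
      by (rule sum_mono, rule term_le) simp
    finally show ?thesis by (simp only: sum.distrib)
  qed
  have u0: "norm (\<alpha> k) * q ^ k \<ge> 0" for k using q by simp
  have part1: "(\<Sum>j<J. \<Sum>x<B. \<Sum>k\<le>j. (norm (\<alpha> k) * q ^ k) * (CA * (q / Q) ^ x * (q / Q) ^ (j - k)))
      \<le> CA * CI / (1 - q / Q)^2" for J B
  proof -
    define S where "S j = (\<Sum>k\<le>j. (norm (\<alpha> k) * q ^ k) * (q / Q) ^ (j - k))" for j
    have "(\<Sum>j<J. \<Sum>x<B. \<Sum>k\<le>j. (norm (\<alpha> k) * q ^ k) * (CA * (q / Q) ^ x * (q / Q) ^ (j - k)))
       = (\<Sum>j<J. \<Sum>x<B. (CA * (q / Q) ^ x) * S j)"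
      unfolding S_def by (simp only: sum_distrib_left mult_ac)
    also have "\<dots> = CA * (\<Sum>x<B. (q / Q) ^ x) * (\<Sum>j<J. S j)"
      by (simp only: sum_distrib_left[symmetric] sum_distrib_right[symmetric])
    also have "\<dots> = CA * (\<Sum>x<B. (q / Q) ^ x) * (\<Sum>j<J. \<Sum>k\<le>j. (norm (\<alpha> k) * q ^ k) * (q / Q) ^ (j - k))"
      by (simp only: S_def)
    also have "\<dots> \<le> CA * (1 / (1 - q / Q)) * (CI * (1 / (1 - q / Q)))"
      using CA0 CI0 r q
      by (intro mult_mono order.refl geometric_sum_le sum_convolution_le al u0 sum_nonneg mult_nonneg_nonneg) auto
    finally show ?thesis by (simp add: power2_eq_square)
  qed
  have part2: "(\<Sum>j<J. \<Sum>x<B. \<Sum>k\<le>j. (norm (\<alpha> k) * q ^ k) * (\<tau> * q powi (1 - c) * (norm (cf A (int x + c - int (j - k))) * q powi (int x + c - int (j - k))) * (q\<^sup>2) ^ (j - k)))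
      \<le> \<tau> * q powi (1 - c) * CA * CI / (1 - q^2)" for J B
  proof (cases "\<tau> = 0")
    case False
    then have q1: "q < 1" using \<tau> by simp
    then have q2: "0 \<le> q\<^sup>2" "q\<^sup>2 < 1" using q by (simp_all add: power_less_one_iff)
    let ?h = "\<lambda>n. norm (cf A n) * q powi n"
    have inner: "(\<Sum>x<B. ?h (int x + c - int i)) \<le> CA" for i
    proof -
      have "(\<Sum>x<B. ?h (int x + c - int i)) = (\<Sum>n\<in>(\<lambda>x. int x + c - int i) ` {..<B}. ?h n)"
        by (simp add: sum.reindex inj_on_def)
      also have "\<dots> \<le> nl q (cf A)" by (rule sum_le_nl) (use wq q in auto)
      finally show ?thesis using wq by simp
    qed
    have "(\<Sum>j<J. \<Sum>x<B. \<Sum>k\<le>j. (norm (\<alpha> k) * q ^ k) * (\<tau> * q powi (1 - c) * ?h (int x + c - int (j - k)) * (q\<^sup>2) ^ (j - k)))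
       = (\<Sum>j<J. \<Sum>k\<le>j. (\<tau> * q powi (1 - c)) * ((norm (\<alpha> k) * q ^ k) * (q\<^sup>2) ^ (j - k)) * (\<Sum>x<B. ?h (int x + c - int (j - k))))"
    proof (rule sum.cong[OF refl])
      fix j
      show "(\<Sum>x<B. \<Sum>k\<le>j. (norm (\<alpha> k) * q ^ k) * (\<tau> * q powi (1 - c) * ?h (int x + c - int (j - k)) * (q\<^sup>2) ^ (j - k)))
        = (\<Sum>k\<le>j. (\<tau> * q powi (1 - c)) * ((norm (\<alpha> k) * q ^ k) * (q\<^sup>2) ^ (j - k)) * (\<Sum>x<B. ?h (int x + c - int (j - k))))"
        unfolding sum.swap[of _ "{..j}" "{..<B}"]
        by (rule sum.cong[OF refl]) (simp only: sum_distrib_left mult_ac)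
    qed
    also have "\<dots> \<le> (\<Sum>j<J. \<Sum>k\<le>j. (\<tau> * q powi (1 - c)) * ((norm (\<alpha> k) * q ^ k) * (q\<^sup>2) ^ (j - k)) * CA)"
      using q \<tau>0 by (intro sum_mono mult_left_mono inner) auto
    also have "\<dots> = (\<tau> * q powi (1 - c)) * CA * (\<Sum>j<J. \<Sum>k\<le>j. (norm (\<alpha> k) * q ^ k) * (q\<^sup>2) ^ (j - k))"
      by (simp only: sum_distrib_left mult_ac)
    also have "\<dots> \<le> (\<tau> * q powi (1 - c)) * CA * (CI * (1 / (1 - q\<^sup>2)))"
      using q \<tau>0 CA0 q2
      by (intro mult_left_mono sum_convolution_le al u0 geometric_sum_le) auto
    finally show ?thesis by simp
  qed simp
  have "(\<Sum>l\<in>F. norm (detn N (\<lambda>i j. M (part_pt l i) j)) * q ^ sum_list l)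
     \<le> exp (CA * CI / (1 - q / Q)^2 + \<tau> * q powi (1 - c) * CA * CI / (1 - q^2))"
  proof (rule det_weight_sum_le[OF q(1) neg _ F])
    fix J B
    have "(\<Sum>j<J. \<Sum>x<B. norm (M (int x) j) * q powi (int x + 1 + int j)) \<le>
      (\<Sum>j<J. \<Sum>x<B. (\<Sum>k\<le>j. (norm (\<alpha> k) * q ^ k) * (CA * (q / Q) ^ x * (q / Q) ^ (j - k))) +
      (\<Sum>k\<le>j. (norm (\<alpha> k) * q ^ k) * (\<tau> * q powi (1 - c) * (norm (cf A (int x + c - int (j - k))) * q powi (int x + c - int (j - k))) * (q\<^sup>2) ^ (j - k))))"
      by (intro sum_mono entry)
    also have "\<dots> \<le> CA * CI / (1 - q / Q)^2 + \<tau> * q powi (1 - c) * CA * CI / (1 - q^2)"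
      unfolding sum.distrib by (rule add_mono[OF part1 part2])
    finally show "(\<Sum>j<J. \<Sum>x<B. norm (M (int x) j) * q powi (int x + 1 + int j)) \<le>
      CA * CI / (1 - q / Q)^2 + \<tau> * q powi (1 - c) * CA * CI / (1 - q^2)" .
  qed
  then show ?thesis by (simp add: det_eq)
qed

section \<open>The correlation kernel\<close>

text \<open>The Laurent coefficients of A(z) E(z) E(1/z). For A = H(rho+) and E = 1/H(rho-) this is
  F, and inverting both arguments gives 1/F.\<close>

definition ff :: "complex fps \<Rightarrow> complex fps \<Rightarrow> int \<Rightarrow> complex" where
  "ff A E = conv (cf A) (conv (cf E) (rev_seq (cf E)))"

text \<open>The case \<open>c = 1\<close> is the symplectic and \<open>c = -1\<close> the orthogonal one.\<close>
definition tau :: "int \<Rightarrow> nat \<Rightarrow> complex" where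
  "tau c j = (if c = 1 \<and> j = 0 then 0 else of_int c)"

text \<open>With \<open>u j z = z powi (-j) + tau c j * z powi (j + 1 - c)\<close>, these are the coefficients of the
  Laurent series \<open>\<Sum>j. g (-y-1-j) * u j z\<close>, which is (anti)invariant under \<open>z powi m \<mapsto> z powi (1-c-m)\<close>.\<close>
definition uu :: "int \<Rightarrow> (int \<Rightarrow> complex) \<Rightarrow> int \<Rightarrow> int \<Rightarrow> complex" where
  "uu c g y m = (if m \<le> 0 then g (m - y - 1) else if m \<ge> 1 - c then of_int c * g (- y - m - c) else 0)"

text \<open>The coefficient of z^(x+1) in F(z) times the series with coefficients \<open>uu\<close>:
  what remains of the double contour integral once both residues are taken.\<close>

definition corr_kernel :: "int \<Rightarrow> complex fps \<Rightarrow> complex fps \<Rightarrow> int \<Rightarrow> int \<Rightarrow> complex" where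
  "corr_kernel c A E x y = conv (uu c (ff (inverse A) (inverse E)) y) (ff A E) (x + 1)"

lemma wl_shift_summable:
  assumes "q > 0" "wl q f" "wl q (rev_seq h)"
  shows "(\<lambda>x. f (x + s) * h (x + t)) summable_on UNIV"
proof -
  have "(\<lambda>x. f (x + s) * h (x + t)) summable_on UNIV \<longleftrightarrow> (\<lambda>k. f k * rev_seq h (s - t - k)) summable_on UNIV"
    by (rule summable_on_reindex_bij_witness[where i = "\<lambda>k. k - s" and j = "\<lambda>x. x + s"])
       (auto simp: rev_seq_def algebra_simps)
  then show ?thesis using conv_summable[OF assms] by blast
qed

text \<open>For m <= 0 one has q^m <= q1^m; for m > 0 one has q^m <= q1^(-m), and the reflected
  argument of \<open>g\<close> turns this back into a weight at radius \<open>q1\<close>. So control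
  of \<open>g\<close> on a single circle gives convergence on the whole annulus from q1 to
  1/q1.\<close>

lemma uu_bound:
  assumes q: "0 < q1" "q1 \<le> q" "q \<le> 1 / q1" and c: "c = 1 \<or> c = -1" and g: "wl q1 g"
  shows "wl q (uu c g y)" "nl q (uu c g y) \<le> (q1 powi (y + 1) + q1 powi (y + c)) * nl q1 g"
proof -
  have qp: "q > 0" using q by simp
  let ?h = "\<lambda>n. norm (g n) * q1 powi n"
  have hs: "?h summable_on UNIV" using g q wl_iff by blast
  have hi: "infsum ?h UNIV = nl q1 g" using q nl_eq by simp
  have hh: "(?h has_sum nl q1 g) UNIV" using has_sum_infsum[OF hs] hi by simp
  have "((\<lambda>m. ?h (m - y - 1)) has_sum nl q1 g) UNIV \<longleftrightarrow> (?h has_sum nl q1 g) UNIV"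
    by (rule has_sum_reindex_bij_witness[where i = "\<lambda>n. n + y + 1" and j = "\<lambda>m. m - y - 1"]) auto
  then have 1: "((\<lambda>m. ?h (m - y - 1)) has_sum nl q1 g) UNIV" using hh by blast
  have "((\<lambda>m. ?h (- y - m - c)) has_sum nl q1 g) UNIV \<longleftrightarrow> (?h has_sum nl q1 g) UNIV"
    by (rule has_sum_reindex_bij_witness[where i = "\<lambda>n. - y - n - c" and j = "\<lambda>m. - y - m - c"]) auto
  then have 2: "((\<lambda>m. ?h (- y - m - c)) has_sum nl q1 g) UNIV" using hh by blast
  let ?b = "\<lambda>m. q1 powi (y + 1) * ?h (m - y - 1) + q1 powi (y + c) * ?h (- y - m - c)"
  have b: "(?b has_sum (q1 powi (y + 1) + q1 powi (y + c)) * nl q1 g) UNIV"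
    using has_sum_add[OF has_sum_cmult_right[OF 1] has_sum_cmult_right[OF 2]] by (simp only: distrib_right)
  have le: "norm (uu c g y m) * q powi m \<le> ?b m" for m
  proof -
    have n0: "q1 \<noteq> 0" using q by simp
    have h0: "?h n \<ge> 0" "q1 powi n \<ge> 0" for n using q by auto
    have P: "q1 powi (y + 1) * ?h (m - y - 1) = norm (g (m - y - 1)) * q1 powi m"
    proof -
      have "q1 powi (y + 1) * q1 powi (m - y - 1) = q1 powi ((y + 1) + (m - y - 1))"
        by (rule power_int_add[symmetric]) (use n0 in simp)
      then show ?thesis by (simp add: mult_ac)
    qed
    have R: "q1 powi (y + c) * ?h (- y - m - c) = norm (g (- y - m - c)) * q1 powi (- m)"
    proof -
      have "q1 powi (y + c) * q1 powi (- y - m - c) = q1 powi ((y + c) + (- y - m - c))"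
        by (rule power_int_add[symmetric]) (use n0 in simp)
      then show ?thesis by (simp add: mult_ac)
    qed
    consider "m \<le> 0" | "m > 0" "m \<ge> 1 - c" | "m > 0" "m < 1 - c" by linarith
    then show ?thesis
    proof cases
      case 1
      have "q powi m = inverse (q ^ nat (- m))" "q1 powi m = inverse (q1 ^ nat (- m))"
        using 1 by (simp_all add: power_int_def power_inverse)
      moreover have "inverse (q ^ nat (- m)) \<le> inverse (q1 ^ nat (- m))"
        using q by (intro le_imp_inverse_le power_mono) auto
      ultimately have "norm (uu c g y m) * q powi m \<le> norm (g (m - y - 1)) * q1 powi m"
        using 1 by (simp add: uu_def mult_left_mono)
      also have "\<dots> \<le> ?b m" unfolding P using h0 by simp
      finally show ?thesis .
    next
      case 2
      have "q powi m = q ^ nat m" using 2 by (simp add: power_int_def)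
      also have "\<dots> \<le> (1 / q1) ^ nat m" using q qp by (intro power_mono) auto
      also have "\<dots> = q1 powi (- m)" using 2 by (simp add: power_int_def power_one_over inverse_eq_divide)
      finally have "norm (uu c g y m) * q powi m \<le> norm (g (- y - m - c)) * q1 powi (- m)"
        using 2 c by (auto simp: uu_def mult_left_mono)
      also have "\<dots> \<le> ?b m" unfolding R using h0 by simp
      finally show ?thesis .
    next
      case 3
      then have "uu c g y m = 0" by (simp add: uu_def)
      then show ?thesis using h0 by simp
    qed
  qed
  have s: "(\<lambda>m. norm (uu c g y m) * q powi m) summable_on UNIV"
    by (rule summable_on_comparison_test[OF has_sum_imp_summable[OF b]]) (use le qp in auto)
  show "wl q (uu c g y)" using s qp wl_iff by blast
  have "(\<Sum>\<^sub>\<infinity>m. norm (uu c g y m) * q powi m) \<le> infsum ?b UNIV"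
    by (rule infsum_mono[OF s has_sum_imp_summable[OF b]]) (rule le)
  then show "nl q (uu c g y) \<le> (q1 powi (y + 1) + q1 powi (y + c)) * nl q1 g"
    using infsumI[OF b] nl_eq[OF qp] by simp
qed

text \<open>At the fixed exponent: for c = 1 it is 0 and both branches agree there; for c = -1 it is
  1, which lies in the gap between the branches, where the value is 0.\<close>

lemma uu_reflect:
  assumes "c = 1 \<or> c = -1"
  shows "uu c g y (1 - c - m) = of_int c * uu c g y m"
proof -
  have "m = 1 \<or> m \<le> 0 \<or> m \<ge> 2" by linarith
  then show ?thesis using assms by (auto simp: uu_def intro!: arg_cong[where f = g])
qed

lemma uu_diff: "uu c g y m - uu c g' y m = uu c (\<lambda>k. g k - g' k) y m"
  by (simp add: uu_def algebra_simps)

text \<open>\<open>A\<close> and its inverse converge up to q2, \<open>E\<close> and its inverse up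
  to 1/q1, so that F and 1/F both converge for q1 <= |z| <= q2. The assumptions are symmetric under
  inverting both series.\<close>

locale series_pair =
  fixes q1 q2 :: real and A E :: "complex fps"
  assumes q: "0 < q1" "q1 < q2" "q2 < 1"
    and A0: "fps_nth A 0 = 1" and E0: "fps_nth E 0 = 1"
    and wlA: "wl q2 (cf A)" "wl q2 (cf (inverse A))"
    and wlE: "wl (1 / q1) (cf E)" "wl (1 / q1) (cf (inverse E))"
begin

lemma q_pos: "0 < q2" using q by simp

lemma q_inv: "1 / q2 < 1 / q1" "q2 < 1 / q1" "q1 < 1 / q1" "1 < 1 / q2"
proof -
  show "1 / q2 < 1 / q1" using q by (intro divide_strict_left_mono) auto
  show "1 < 1 / q2" using q by simp
  then show "q2 < 1 / q1" "q1 < 1 / q1" using q \<open>1 / q2 < 1 / q1\<close> by linarith+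
qed

lemma swap: "series_pair q1 q2 (inverse A) (inverse E)"
  by unfold_locales (use q A0 E0 wlA wlE fps_inverse_idempotent[of A] fps_inverse_idempotent[of E] in auto)

lemma AE_inverse: "conv (cf A) (cf (inverse A)) = delta" "conv (cf E) (cf (inverse E)) = delta"
  using inverse_mult_eq_1[of A] inverse_mult_eq_1[of E] A0 E0
  by (simp_all add: conv_cf cf_1 mult.commute)

lemma wl_at:
  assumes "q1 \<le> r" "r \<le> q2"
  shows "wl r (cf A)" "wl r (cf (inverse A))" "wl r (cf E)" "wl r (cf (inverse E))"
    "wl r (rev_seq (cf E))" "wl r (rev_seq (cf (inverse E)))"
proof -
  have r: "0 < r" "r \<le> 1 / q1" "0 < 1 / r" "1 / r \<le> 1 / q1"
    using assms q order.trans[OF assms(2) less_imp_le[OF q_inv(2)]] by (auto intro!: divide_left_mono)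
  show "wl r (cf A)" "wl r (cf (inverse A))" "wl r (cf E)" "wl r (cf (inverse E))"
    using wl_cf_mono(1) wlA wlE r assms by blast+
  show "wl r (rev_seq (cf E))" "wl r (rev_seq (cf (inverse E)))"
    using wl_cf_mono(1)[OF wlE(1) r(3,4)] wl_cf_mono(1)[OF wlE(2) r(3,4)] r by (simp_all add: wl_rev)
qed

lemmas wl2 = wl_at[of q2, OF less_imp_le[OF q(2)] order.refl]

abbreviation "eps \<equiv> conv (cf E) (rev_seq (cf E))"
abbreviation "gg \<equiv> ff (inverse A) (inverse E)"

lemma wl_ff: "q1 \<le> r \<Longrightarrow> r \<le> q2 \<Longrightarrow> wl r (ff A E)"
  unfolding ff_def using wl_at[of r] q by (intro wl_conv) auto

lemma wl_gg: "q1 \<le> r \<Longrightarrow> r \<le> q2 \<Longrightarrow> wl r gg"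
  using series_pair.wl_ff[OF swap] by simp

lemma wl_eps: "wl q2 eps"
  using wl2 q_pos by (intro wl_conv) auto

lemma wl_U: "c = 1 \<or> c = -1 \<Longrightarrow> wl q2 (uu c gg y)"
  by (rule uu_bound(1)[of q1]) (use q wl_gg in \<open>auto intro: less_imp_le[OF q_inv(2)]\<close>)

lemma rev_E_inverse: "conv (rev_seq (cf E)) (rev_seq (cf (inverse E))) = delta"
  by (simp add: conv_rev AE_inverse rev_delta)

text \<open>This and the next two identities are cancellations in A(z) E(z) E(1/z). What matters is
  that the results are one-sided: this one lets only the nonpositive exponents of \<open>uu\<close>
  contribute, and \<open>gg_mult_eps\<close> makes the coefficients \<open>V\<close> vanish far
  out.\<close>

lemma ff_mult_rev: "conv (ff A E) (rev_seq (cf (inverse E))) = conv (cf A) (cf E)"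
proof -
  let ?a = "cf A" and ?e = "cf E" and ?re = "rev_seq (cf E)" and ?rb = "rev_seq (cf (inverse E))"
  note w = wl2 q_pos
  have "conv (ff A E) ?rb = conv ?a (conv (conv ?e ?re) ?rb)"
    unfolding ff_def by (rule conv_assoc[of q2]) (auto intro!: wl_conv w)
  also have "conv (conv ?e ?re) ?rb = conv ?e (conv ?re ?rb)"
    by (rule conv_assoc[of q2]) (auto intro!: wl_conv w)
  also have "\<dots> = ?e" by (simp add: rev_E_inverse conv_delta_right)
  finally show ?thesis .
qed

lemma gg_mult: "conv gg (conv (cf A) (cf E)) = rev_seq (cf (inverse E))"
proof -
  let ?a = "cf A" and ?e = "cf E" and ?a' = "cf (inverse A)" and ?b = "cf (inverse E)" and ?rb = "rev_seq (cf (inverse E))"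
  note w = wl2 q_pos
  have "conv gg (conv ?a ?e) = conv (conv (conv ?rb ?b) ?a') (conv ?a ?e)"
    unfolding ff_def by (simp only: conv_commute[of ?a'] conv_commute[of ?b])
  also have "\<dots> = conv (conv ?rb ?b) (conv ?a' (conv ?a ?e))"
    by (rule conv_assoc[of q2]) (auto intro!: wl_conv w)
  also have "conv ?a' (conv ?a ?e) = conv (conv ?a' ?a) ?e"
    by (rule conv_assoc[of q2, symmetric]) (auto intro!: wl_conv w)
  also have "conv ?a' ?a = delta" using AE_inverse by (simp add: conv_commute)
  also have "conv (conv ?rb ?b) (conv delta ?e) = conv ?rb (conv ?b ?e)"
    unfolding conv_delta by (rule conv_assoc[of q2]) (auto intro!: wl_conv w)
  also have "conv ?b ?e = delta" using AE_inverse by (simp add: conv_commute)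
  finally show ?thesis by (simp add: conv_delta_right)
qed

lemma gg_mult_eps: "conv gg eps = cf (inverse A)"
proof -
  let ?e = "cf E" and ?re = "rev_seq (cf E)" and ?a' = "cf (inverse A)" and ?b = "cf (inverse E)" and ?rb = "rev_seq (cf (inverse E))"
  note w = wl2 q_pos
  have "conv gg eps = conv ?a' (conv (conv ?b ?rb) eps)"
    unfolding ff_def by (rule conv_assoc[of q2]) (auto intro!: wl_conv w)
  also have "conv (conv ?b ?rb) eps = conv (conv ?rb ?b) (conv ?e ?re)"
    by (simp only: conv_commute[of ?b])
  also have "\<dots> = conv ?rb (conv ?b (conv ?e ?re))"
    by (rule conv_assoc[of q2]) (auto intro!: wl_conv w)
  also have "conv ?b (conv ?e ?re) = conv (conv ?b ?e) ?re"
    by (rule conv_assoc[of q2, symmetric]) (auto intro!: wl_conv w)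
  also have "conv ?b ?e = delta" using AE_inverse by (simp add: conv_commute)
  also have "conv ?rb (conv delta ?re) = delta"
    unfolding conv_delta using rev_E_inverse by (simp add: conv_commute)
  finally show ?thesis by (simp add: conv_delta_right)
qed

text \<open>The two-sided sum collapses to a one-sided one because \<open>conv (cf A) (cf E)\<close> is one-sided, so that only
  the part of \<open>uu\<close> with nonpositive index matters.\<close>
lemma kernel_reproducing:
  assumes c: "c = 1 \<or> c = -1"
  shows "((\<lambda>x. cf (inverse E) (x + 1 + int l) * corr_kernel c A E x y) has_sum cf (inverse E) (y + 1 + int l)) UNIV"
proof -
  let ?b = "cf (inverse E)" and ?rb = "rev_seq (cf (inverse E))" and ?U = "uu c gg y"
  note w = wl2 q_pos wl_U[OF c] wl_ff[of q2]
  have wff: "wl q2 (ff A E)" using wl_ff q by simp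
  have wUf: "wl q2 (conv ?U (ff A E))" by (intro wl_conv w wff)
  have "conv ?rb (conv ?U (ff A E)) (- int l) = conv (conv ?U (ff A E)) ?rb (- int l)"
    by (simp only: conv_commute)
  also have "\<dots> = conv ?U (conv (ff A E) ?rb) (- int l)"
    by (rule fun_cong, rule conv_assoc[of q2]) (intro w wff)+
  also have "\<dots> = conv ?U (cf (A * E)) (- int l)"
    by (simp only: ff_mult_rev conv_cf)
  also have "\<dots> = conv gg (cf (A * E)) (- y - 1 - int l)"
    unfolding conv_def
    by (rule infsum_reindex_bij_witness[where i = "\<lambda>k. k + y + 1" and j = "\<lambda>m. m - y - 1"])
       (auto simp: uu_def algebra_simps)
  also have "\<dots> = ?rb (- y - 1 - int l)"
    by (simp only: gg_mult conv_cf[symmetric])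
  finally have val: "conv ?rb (conv ?U (ff A E)) (- int l) = ?b (y + 1 + int l)"
    by (simp add: rev_seq_def algebra_simps)
  have "(\<lambda>k. ?rb k * conv ?U (ff A E) (- int l - k)) summable_on UNIV"
    by (rule conv_summable[OF _ _ wUf]) (use w in auto)
  then have "((\<lambda>k. ?rb k * conv ?U (ff A E) (- int l - k)) has_sum ?b (y + 1 + int l)) UNIV"
    using val by (simp add: conv_def[of ?rb] has_sum_iff)
  moreover have "((\<lambda>x. ?b (x + 1 + int l) * corr_kernel c A E x y) has_sum ?b (y + 1 + int l)) UNIV \<longleftrightarrow>
    ((\<lambda>k. ?rb k * conv ?U (ff A E) (- int l - k)) has_sum ?b (y + 1 + int l)) UNIV"
    by (rule has_sum_reindex_bij_witness[where i = "\<lambda>k. - k - 1 - int l" and j = "\<lambda>x. - (x + 1 + int l)"])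
       (auto simp: corr_kernel_def rev_seq_def algebra_simps)
  ultimately show ?thesis by blast
qed

end

section \<open>The kernel of finite rank for a polynomial 1/H\<close>

locale polynomial_pair = series_pair +
  fixes N :: nat and c :: int
  assumes deg: "\<And>k. k > N \<Longrightarrow> fps_nth E k = 0"
    and c: "c = 1 \<or> c = -1"
begin

text \<open>The coefficients in z of \<open>uu\<close> times E(z) E(1/z). Those at the exponents 0,
  -1, ..., 1 - N turn out to be dual to \<open>phi\<close>.\<close>

definition "V y = conv (uu c gg y) eps"

lemma eps_sym: "eps (- m) = eps m"
proof -
  have "rev_seq (conv (cf E) (rev_seq (cf E))) = conv (rev_seq (cf E)) (rev_seq (rev_seq (cf E)))"
    by (simp only: conv_rev)
  also have "rev_seq (rev_seq (cf E)) = cf E" by (auto simp: rev_seq_def)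
  finally have "rev_seq eps = eps" by (simp only: conv_commute)
  then show ?thesis by (metis rev_seq_def)
qed

lemma eps_zero: "\<bar>m\<bar> > int N \<Longrightarrow> eps m = 0"
proof -
  have *: "eps m = 0" if "m > int N" for m
  proof -
    have "cf E k * rev_seq (cf E) (m - k) = 0" for k
    proof (cases "k - m < 0")
      case False
      then have "nat k > N" "k \<ge> 0" using that by auto
      then have "cf E k = 0" using deg by (simp add: cf_def)
      then show ?thesis by simp
    qed (simp add: rev_seq_def)
    then have "(\<lambda>k. cf E k * rev_seq (cf E) (m - k)) = (\<lambda>k. 0)" by blast
    then show ?thesis by (simp add: conv_def)
  qed
  assume "\<bar>m\<bar> > int N"
  then have "m > int N \<or> - m > int N" by linarith
  then show ?thesis using *[of m] *[of "- m"] eps_sym[of m] by auto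
qed

lemma V_reflect: "V y (1 - c - m) = of_int c * V y m"
proof -
  have "V y (1 - c - m) = (\<Sum>\<^sub>\<infinity>k. uu c gg y (1 - c - k) * eps (1 - c - m - (1 - c - k)))"
    unfolding V_def conv_def[of "uu c gg y"]
    by (rule infsum_reindex_bij_witness[where i = "\<lambda>k. 1 - c - k" and j = "\<lambda>k. 1 - c - k"]) auto
  also have "\<dots> = (\<Sum>\<^sub>\<infinity>k. of_int c * (uu c gg y k * eps (m - k)))"
  proof (rule infsum_cong)
    fix k
    have "eps (1 - c - m - (1 - c - k)) = eps (m - k)"
      using eps_sym[of "m - k"] by (simp add: algebra_simps)
    then show "uu c gg y (1 - c - k) * eps (1 - c - m - (1 - c - k)) = of_int c * (uu c gg y k * eps (m - k))"
      by (simp only: uu_reflect[OF c] mult.assoc)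
  qed
  also have "\<dots> = of_int c * V y m"
    by (simp add: infsum_cmult_right' V_def conv_def[of "uu c gg y"])
  finally show ?thesis .
qed

text \<open>At an exponent <= -N the positive exponents of \<open>uu\<close> are out of reach of
  \<open>eps\<close>, which has degree N. The reflected half drops out, and a coefficient of 1/A at
  a negative index is left.\<close>

lemma V_zero:
  assumes "j \<ge> int N" "y \<ge> - int N"
  shows "V y (- j) = 0"
proof -
  have "V y (- j) = conv gg eps (- y - 1 - j)"
    unfolding V_def conv_def[of "uu c gg y"] conv_def[of gg]
  proof (rule infsum_reindex_bij_witness[where i = "\<lambda>k. k + y + 1" and j = "\<lambda>m. m - y - 1"])
    fix m :: int
    show "gg (m - y - 1) * eps (- y - 1 - j - (m - y - 1)) = uu c gg y m * eps (- j - m)"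
    proof (cases "m \<le> 0")
      case False
      then have "eps (- j - m) = 0" using assms by (intro eps_zero) auto
      then show ?thesis by (simp add: algebra_simps)
    qed (simp add: uu_def algebra_simps)
  qed auto
  also have "\<dots> = 0"
    using assms by (simp add: gg_mult_eps)
  finally show ?thesis .
qed

lemma V_support:
  assumes "y \<ge> - int N" "V y m \<noteq> 0"
  shows "m > - int N" "m \<le> int N - c"
proof -
  show "m > - int N" using V_zero[of "- m" y] assms by fastforce
  have "V y (1 - c - m) \<noteq> 0" using assms(2) c by (auto simp: V_reflect)
  then show "m \<le> int N - c" using V_zero[of "- (1 - c - m)" y] assms(1) by fastforce
qed

text \<open>\<open>V\<close> has finite support and is (anti)symmetric, so the exponents m and 1 - c
  - m can be paired; each pair of coefficients of A is one \<open>jt_fun\<close>.\<close>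

lemma kernel_expansion:
  assumes y: "y \<ge> - int N"
  shows "corr_kernel c A E x y = (\<Sum>j<N. jt_fun (cf A) (tau c) c j x * V y (- int j))"
proof -
  have f: "ff A E = conv eps (cf A)" by (simp add: ff_def conv_commute)
  have "corr_kernel c A E x y = conv (V y) (cf A) (x + 1)"
    unfolding corr_kernel_def f V_def
    by (rule fun_cong, rule conv_assoc[of q2, symmetric]) (use wl2 wl_eps wl_U[OF c] q_pos in auto)
  also have "\<dots> = (\<Sum>\<^sub>\<infinity>m\<in>{1 - int N..int N - c}. V y m * cf A (x + 1 - m))"
    unfolding conv_def[of "V y"]
  proof (rule infsum_cong_neutral)
    fix m assume m: "m \<in> UNIV - {1 - int N..int N - c}"
    have "V y m = 0"
    proof (rule ccontr)
      assume "V y m \<noteq> 0"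
      from V_support[OF y this] m show False by auto
    qed
    then show "V y m * cf A (x + 1 - m) = 0" by simp
  qed auto
  also have "\<dots> = (\<Sum>m\<in>{1 - int N..int N - c}. V y m * cf A (x + 1 - m))"
    by simp
  also have "\<dots> = (\<Sum>j<N. jt_fun (cf A) (tau c) c j x * V y (- int j))"
  proof -
    let ?t = "\<lambda>m. V y m * cf A (x + 1 - m)"
    have neg: "(\<Sum>m\<in>{1 - int N..0}. ?t m) = (\<Sum>j<N. ?t (- int j))"
      by (rule sum.reindex_bij_witness[where i = "\<lambda>j. - int j" and j = "\<lambda>m. nat (- m)"]) auto
    have pos: "(\<Sum>m\<in>{1 - c..int N - c}. ?t m) = (\<Sum>j<N. ?t (1 - c + int j))"
      by (rule sum.reindex_bij_witness[where i = "\<lambda>j. 1 - c + int j" and j = "\<lambda>m. nat (m - 1 + c)"]) auto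
    have refl: "?t (1 - c + int j) = of_int c * V y (- int j) * cf A (x + c - int j)" for j
      using V_reflect[of y "- int j"] by (simp add: algebra_simps)
    have "(\<Sum>m\<in>{1 - int N..int N - c}. ?t m) = (\<Sum>j<N. ?t (- int j)) + (\<Sum>j<N. tau c j * V y (- int j) * cf A (x + c - int j))"
    proof (cases "c = 1")
      \<comment> \<open>The fixed exponent 0 must be counted only once, which is the reason for
        \<open>tau 1 0 = 0\<close>.\<close>
      case True
      show ?thesis
      proof (cases N)
        case (Suc n)
        have "{1 - int N..int N - c} = {1 - int N..0} \<union> {1..int N - 1}" using True Suc by auto
        then have "(\<Sum>m\<in>{1 - int N..int N - c}. ?t m) = (\<Sum>m\<in>{1 - int N..0}. ?t m) + (\<Sum>m\<in>{1..int N - 1}. ?t m)"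
          by (simp add: sum.union_disjoint)
        also have "(\<Sum>m\<in>{1..int N - 1}. ?t m) = (\<Sum>j\<in>{1..<N}. ?t (1 - c + int j))"
          by (rule sum.reindex_bij_witness[where i = "\<lambda>j. int j" and j = "\<lambda>m. nat m"]) (auto simp: True)
        also have "\<dots> = (\<Sum>j\<in>{1..<N}. tau c j * V y (- int j) * cf A (x + c - int j))"
        proof (rule sum.cong[OF HOL.refl])
          fix j assume "j \<in> {1..<N}"
          then have t: "tau c j = of_int c" by (simp add: tau_def)
          show "?t (1 - c + int j) = tau c j * V y (- int j) * cf A (x + c - int j)"
            unfolding t by (rule refl)
        qed
        also have "\<dots> = (\<Sum>j<N. tau c j * V y (- int j) * cf A (x + c - int j))"
          by (rule sum.mono_neutral_left) (auto simp: tau_def True not_le)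
        finally show ?thesis using neg by simp
      qed (simp add: True)
    next
      case False
      then have cm: "c = -1" using c by simp
      have "{1 - int N..int N - c} = {1 - int N..0} \<union> ({1} \<union> {1 - c..int N - c})" using cm by auto
      \<comment> \<open>The unpaired exponent 1 is fixed by the reflection, and antisymmetry kills
        its coefficient.\<close>
      moreover have "V y 1 = 0" using V_reflect[of y 1] cm by simp
      ultimately have "(\<Sum>m\<in>{1 - int N..int N - c}. ?t m) = (\<Sum>m\<in>{1 - int N..0}. ?t m) + (\<Sum>m\<in>{1 - c..int N - c}. ?t m)"
        using cm by (simp add: sum.union_disjoint)
      then show ?thesis unfolding neg pos refl by (simp add: tau_def cm)
    qed
    then show ?thesis
      by (simp add: jt_fun_def sum.distrib[symmetric] distrib_right distrib_left mult_ac algebra_simps)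
  qed
  finally show ?thesis .
qed

abbreviation "phi j x \<equiv> jt_fun (cf A) (tau c) c j x"
abbreviation "psi l x \<equiv> cf (inverse E) (x + 1 + int l)"

definition "gram j l = (\<Sum>\<^sub>\<infinity>x. phi j x * psi l x)"

lemma phi_psi_has_sum: "((\<lambda>x. phi j x * psi l x) has_sum gram j l) UNIV"
proof -
  note S = wl_shift_summable[of q2 "cf A" "cf (inverse E)", OF q_pos wl2(1) wl2(6)]
  have "(\<lambda>x. cf A (x + (1 + int j)) * cf (inverse E) (x + (1 + int l)) +
      tau c j * (cf A (x + (c - int j)) * cf (inverse E) (x + (1 + int l)))) summable_on UNIV"
    by (intro summable_on_add summable_on_cmult_right S)
  moreover have "phi j x * psi l x = cf A (x + (1 + int j)) * cf (inverse E) (x + (1 + int l)) +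
      tau c j * (cf A (x + (c - int j)) * cf (inverse E) (x + (1 + int l)))" for x
  proof -
    have "x + (1 + int j) = x + 1 + int j" "x + (1 + int l) = x + 1 + int l" "x + (c - int j) = x + c - int j"
      by simp_all
    then show ?thesis by (simp only: jt_fun_def distrib_right mult.assoc)
  qed
  ultimately show ?thesis unfolding gram_def by (simp only: has_sum_infsum)
qed

text \<open>Insert the finite expansion of the kernel into its reproducing property for
  \<open>psi\<close>.\<close>

lemma psi_expansion:
  assumes "y \<ge> - int N"
  shows "psi l y = (\<Sum>j<N. V y (- int j) * gram j l)"
proof -
  have "((\<lambda>x. \<Sum>j<N. V y (- int j) * (phi j x * psi l x)) has_sum (\<Sum>j<N. V y (- int j) * gram j l)) UNIV"
    by (intro has_sum_sum has_sum_cmult_right phi_psi_has_sum)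
  moreover have "(\<lambda>x. \<Sum>j<N. V y (- int j) * (phi j x * psi l x)) = (\<lambda>x. psi l x * corr_kernel c A E x y)"
    unfolding kernel_expansion[OF assms] sum_distrib_left by (intro ext sum.cong) (simp_all only: mult_ac)
  ultimately have "((\<lambda>x. psi l x * corr_kernel c A E x y) has_sum (\<Sum>j<N. V y (- int j) * gram j l)) UNIV"
    by (simp only:)
  then show ?thesis by (rule has_sum_unique[OF kernel_reproducing[OF c]])
qed

text \<open>On the points -1, ..., -N of the empty partition the matrix of \<open>psi\<close> is
  unitriangular, and \<open>psi_expansion\<close> factors it through the Gram matrix.\<close>

lemma detn_gram_nonzero: "detn N gram \<noteq> 0"
proof -
  have "detn N (\<lambda>i l. psi l (- 1 - int i)) = 1"
    by (rule detn_unitriangular) (auto simp: cf_def E0)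
  moreover have "detn N (\<lambda>i l. psi l (- 1 - int i)) = detn N (\<lambda>i l. \<Sum>j<N. V (- 1 - int i) (- int j) * gram j l)"
    by (rule detn_cong) (rule psi_expansion, simp)
  ultimately show ?thesis using detn_mult[of N "\<lambda>i j. V (- 1 - int i) (- int j)" gram] by auto
qed

text \<open>On the half-line \<open>V\<close> is \<open>psi\<close> times the inverse Gram matrix,
  so pairing it with \<open>phi\<close> gives the identity matrix.\<close>

lemma biorthogonality:
  assumes "i < N" "j < N"
  shows "((\<lambda>x. phi i x * V x (- int j)) has_sum (if i = j then 1 else 0)) {- int N..}"
proof -
  obtain H where H: "\<And>i j. i < N \<Longrightarrow> j < N \<Longrightarrow> (\<Sum>l<N. gram i l * H l j) = (if i = j then 1 else 0)"
    using right_inverse_exists[OF detn_gram_nonzero] by blast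
  have V: "V y (- int j) = (\<Sum>l<N. psi l y * H l j)" if "y \<ge> - int N" for y
  proof -
    have "(\<Sum>l<N. psi l y * H l j) = (\<Sum>l<N. \<Sum>i<N. V y (- int i) * (gram i l * H l j))"
      unfolding psi_expansion[OF that] sum_distrib_right by (simp only: mult.assoc)
    also have "\<dots> = (\<Sum>i<N. V y (- int i) * (\<Sum>l<N. gram i l * H l j))"
      unfolding sum_distrib_left by (rule sum.swap)
    also have "\<dots> = (\<Sum>i<N. V y (- int i) * (if i = j then 1 else 0))"
      by (rule sum.cong) (use H assms in auto)
    also have "\<dots> = V y (- int j)" using assms by (simp add: if_distrib cong: if_cong)
    finally show ?thesis ..
  qed
  \<comment> \<open>Below -N every \<open>psi l\<close> with l < N vanishes, so the half-line
    carries the full sum.\<close>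
  have Y: "((\<lambda>x. phi i x * psi l x) has_sum gram i l) {- int N..}" if "l < N" for l
    by (rule has_sum_cong_neutral[THEN iffD1, OF _ _ _ phi_psi_has_sum]) (use that in auto)
  have "((\<lambda>x. \<Sum>l<N. (phi i x * psi l x) * H l j) has_sum (\<Sum>l<N. gram i l * H l j)) {- int N..}"
    by (intro has_sum_sum has_sum_cmult_left Y) auto
  moreover have "phi i x * V x (- int j) = (\<Sum>l<N. (phi i x * psi l x) * H l j)" if "x \<in> {- int N..}" for x
    using V[of x] that by (simp add: sum_distrib_left mult.assoc)
  ultimately have "((\<lambda>x. phi i x * V x (- int j)) has_sum (\<Sum>l<N. gram i l * H l j)) {- int N..}"
    by (subst has_sum_cong) auto
  then show ?thesis using H assms by simp
qed

lemma finite_correlation: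
  assumes "(\<lambda>l. detn N (\<lambda>i j. phi j (part_pt l i)) * detn N (\<lambda>i j. psi j (part_pt l i))) summable_on parts_le N"
    and "n \<le> N" and "inj_on k {..<n}" and "\<And>i. i < n \<Longrightarrow> k i \<ge> - int N"
  shows "((\<lambda>l. detn N (\<lambda>i j. phi j (part_pt l i)) * detn N (\<lambda>i j. psi j (part_pt l i)))
     has_sum detn N gram * detn n (\<lambda>i j. corr_kernel c A E (k i) (k j)))
     {l \<in> parts_le N. k ` {..<n} \<subseteq> pts N l}"
proof -
  have "detn n (\<lambda>i j. corr_kernel c A E (k i) (k j)) = detn n (\<lambda>i j. \<Sum>m<N. phi m (k i) * V (k j) (- int m))"
    by (rule detn_cong) (rule kernel_expansion, use assms(4) in blast)
  then show ?thesis
    using ensemble_correlation[of N "\<lambda>l y. psi l y" "\<lambda>j y. V y (- int j)" gram "\<lambda>j x. phi j x"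
        "\<lambda>l. detn N (\<lambda>i j. phi j (part_pt l i)) * detn N (\<lambda>i j. psi j (part_pt l i))" n k]
      psi_expansion biorthogonality assms by simp
qed

end

lemma jt_fun_zero: "jt_fun a (\<lambda>_. 0) c j x = a (x + 1 + int j)"
  by (simp add: jt_fun_def)

lemma norm_tau_le: "c = 1 \<or> c = -1 \<Longrightarrow> norm (tau c j) \<le> 1"
  by (auto simp: tau_def)

lemma tau_boundary: "c = 1 \<or> c = -1 \<Longrightarrow> x < 0 \<Longrightarrow> tau c i * cf A (x + c - int i) = 0"
  by (cases "i = 0") (auto simp: tau_def)

definition jt_det :: "(int \<Rightarrow> complex) \<Rightarrow> (nat \<Rightarrow> complex) \<Rightarrow> int \<Rightarrow> nat list \<Rightarrow> complex" where
  "jt_det a t c l = detn (length l) (\<lambda>i j. jt_fun a t c j (part_pt l i))"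

text \<open>A zero part in position N has the point -N - 1; by \<open>t0\<close> its row consists of
  the coefficients with index j - N, so the new last row is a unit vector.\<close>

lemma jt_det_stable:
  assumes "length l \<le> N" and A0: "fps_nth A 0 = 1"
    and t0: "\<And>i x. x < 0 \<Longrightarrow> t i * cf A (x + c - int i) = 0"
  shows "detn N (\<lambda>i j. jt_fun (cf A) t c j (part_pt l i)) = jt_det (cf A) t c l"
  using assms(1)
proof (induction N rule: dec_induct)
  case base
  show ?case by (simp add: jt_det_def)
next
  case (step N)
  have p: "part_pt l N = - int N - 1" using step by (simp add: part_pt_def parts_Suc)
  have last: "jt_fun (cf A) t c j (part_pt l N) = cf A (int j - int N)" for j
    unfolding jt_fun_def p using t0[of "- int N - 1" j] by simp
  have "detn (Suc N) (\<lambda>i j. jt_fun (cf A) t c j (part_pt l i)) = detn N (\<lambda>i j. jt_fun (cf A) t c j (part_pt l i))"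
    by (rule detn_Suc_last_row) (simp_all add: last, simp add: cf_def A0)
  then show ?case using step(3) by simp
qed

section \<open>Passage from polynomial to analytic specializations\<close>

text \<open>By the Weierstrass test the finite partial sums converge uniformly in \<open>N\<close>,
  which permits exchanging the two limits.\<close>

lemma infsum_dominated_convergence:
  fixes a :: "'a \<Rightarrow> nat \<Rightarrow> complex"
  assumes le: "\<And>x N. x \<in> X \<Longrightarrow> norm (a x N) \<le> M x" and M: "M summable_on X"
    and lim: "\<And>x. x \<in> X \<Longrightarrow> (\<lambda>N. a x N) \<longlonglongrightarrow> b x"
  shows "(\<lambda>N. \<Sum>\<^sub>\<infinity>x\<in>X. a x N) \<longlonglongrightarrow> (\<Sum>\<^sub>\<infinity>x\<in>X. b x)"
proof (rule swap_uniform_limit'[where F = "finite_subsets_at_top X" and S = UNIV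
      and f = "\<lambda>Y N. \<Sum>x\<in>Y. a x N" and g = "\<lambda>Y. \<Sum>x\<in>Y. b x"])
  show "\<forall>\<^sub>F Y in finite_subsets_at_top X. (\<lambda>N. \<Sum>x\<in>Y. a x N) \<longlonglongrightarrow> (\<Sum>x\<in>Y. b x)"
    by (rule eventually_finite_subsets_at_top_weakI) (auto intro!: tendsto_sum lim)
  have "norm (b x) \<le> M x" if "x \<in> X" for x
    using tendsto_upperbound[OF tendsto_norm[OF lim[OF that]] always_eventually] le[OF that] by auto
  then have "b summable_on X" by (rule csum_comparison[OF M])
  then show "((\<lambda>Y. \<Sum>x\<in>Y. b x) \<longlongrightarrow> (\<Sum>\<^sub>\<infinity>x\<in>X. b x)) (finite_subsets_at_top X)"
    by (rule infsum_tendsto)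
  show "uniform_limit UNIV (\<lambda>Y N. \<Sum>x\<in>Y. a x N) (\<lambda>N. \<Sum>\<^sub>\<infinity>x\<in>X. a x N) (finite_subsets_at_top X)"
    by (rule Weierstrass_m_test_general[OF le M])
qed auto

lemma tendsto_detn:
  assumes "\<And>i j. (\<lambda>N. F N i j) \<longlonglongrightarrow> A i j"
  shows "(\<lambda>N. detn n (F N)) \<longlonglongrightarrow> detn n A"
  unfolding detn_def by (intro tendsto_sum tendsto_mult tendsto_const tendsto_prod assms)

lemma cf_diff: "cf F k - cf G k = cf (F - G) k"
  by (simp add: cf_def)

section \<open>Weighted norms of power series, their truncations and inverses\<close>

lemma wl_cf_iff: "q > 0 \<Longrightarrow> wl q (cf A) \<longleftrightarrow> summable (\<lambda>k. norm (fps_nth A k) * q ^ k)"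
proof -
  assume q: "q > 0"
  have "wl q (cf A) \<longleftrightarrow> (\<lambda>k. norm (cf A k) * q powi k) summable_on range int"
    unfolding wl_iff[OF q]
  proof (rule summable_on_cong_neutral)
    fix x assume "x \<in> UNIV - range int"
    then have "x < 0" using zero_le_imp_eq_int[of x] by (cases "x < 0") auto
    then show "norm (cf A x) * q powi x = 0" by simp
  qed auto
  also have "\<dots> \<longleftrightarrow> (\<lambda>k. norm (fps_nth A k) * q ^ k) summable_on UNIV"
    by (subst summable_on_reindex) (simp_all add: o_def)
  also have "\<dots> \<longleftrightarrow> summable (\<lambda>k. norm (fps_nth A k) * q ^ k)"
    using q by (intro summable_on_UNIV_nonneg_real_iff) auto
  finally show ?thesis .
qed

lemma nl_cf_eq:
  assumes q: "q > 0" and w: "wl q (cf A)"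
  shows "nl q (cf A) = (\<Sum>k. norm (fps_nth A k) * q ^ k)"
proof -
  have "nl q (cf A) = (\<Sum>\<^sub>\<infinity>k. norm (cf A (int k)) * q powi int k)"
    unfolding nl_eq[OF q] by (rule infsum_int_ge0) simp
  also have "\<dots> = (\<Sum>\<^sub>\<infinity>k. norm (fps_nth A k) * q ^ k)" by simp
  also have "\<dots> = (\<Sum>k. norm (fps_nth A k) * q ^ k)"
  proof -
    have "(\<lambda>k. norm (fps_nth A k) * q ^ k) summable_on UNIV"
      using w q wl_cf_iff by (subst summable_on_UNIV_nonneg_real_iff) auto
    then show ?thesis using has_sum_imp_sums[OF has_sum_infsum] sums_unique by blast
  qed
  finally show ?thesis .
qed

lemma wl_cf_bounded_partial_sums:
  assumes q: "q > 0" and b: "\<And>M. (\<Sum>k<M. norm (fps_nth A k) * q ^ k) \<le> C"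
  shows "wl q (cf A)" "nl q (cf A) \<le> C"
proof -
  have s: "summable (\<lambda>k. norm (fps_nth A k) * q ^ k)"
    by (rule bounded_imp_summable[where B = C])
       (use q b in \<open>auto simp: lessThan_Suc_atMost[symmetric] simp del: sum.lessThan_Suc\<close>)
  then show w: "wl q (cf A)" using wl_cf_iff q by blast
  show "nl q (cf A) \<le> C"
    unfolding nl_cf_eq[OF q w] by (rule suminf_le_const[OF s b])
qed

lemma nl_cf_cutoff_tendsto:
  assumes q: "q > 0" and w: "wl q (cf E)"
  shows "wl q (cf (E - fps_cutoff (Suc N) E))" "(\<lambda>N. nl q (cf (E - fps_cutoff (Suc N) E))) \<longlonglongrightarrow> 0"
proof -
  let ?f = "\<lambda>k. norm (fps_nth E k) * q ^ k"
  let ?g = "\<lambda>N k. norm (fps_nth (E - fps_cutoff (Suc N) E) k) * q ^ k"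
  have s: "summable ?f" using w wl_cf_iff[OF q] by blast
  have sg: "summable (?g N)" for N
    by (rule summable_comparison_test'[OF s]) (use q in auto)
  show wd: "wl q (cf (E - fps_cutoff (Suc N) E))" for N
    using sg wl_cf_iff[OF q] by blast
  have "nl q (cf (E - fps_cutoff (Suc N) E)) = suminf ?f - (\<Sum>k<Suc N. ?f k)" for N
  proof -
    have "nl q (cf (E - fps_cutoff (Suc N) E)) = (\<Sum>k. ?g N (k + Suc N)) + (\<Sum>k<Suc N. ?g N k)"
      unfolding nl_cf_eq[OF q wd] by (rule suminf_split_initial_segment[OF sg])
    also have "(\<Sum>k<Suc N. ?g N k) = 0" by (rule sum.neutral) auto
    also have "(\<Sum>k. ?g N (k + Suc N)) = (\<Sum>k. ?f (k + Suc N))" by simp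
    also have "\<dots> = suminf ?f - (\<Sum>k<Suc N. ?f k)" by (rule suminf_minus_initial_segment[OF s])
    finally show ?thesis by simp
  qed
  moreover have "(\<lambda>N. suminf ?f - (\<Sum>k<Suc N. ?f k)) \<longlonglongrightarrow> suminf ?f - suminf ?f"
    by (intro tendsto_diff tendsto_const LIMSEQ_Suc[OF summable_LIMSEQ[OF s]])
  ultimately show "(\<lambda>N. nl q (cf (E - fps_cutoff (Suc N) E))) \<longlonglongrightarrow> 0" by simp
qed

text \<open>1/F - 1/E = C/F with C = (E - F)/E of norm at most 1/2. The norm of 1/F is not yet known
  to be finite, so the estimate S <= nl(1/E) + S/2 is made for partial sums, where S/2 can be
  absorbed.\<close>

lemma inverse_perturbation:
  fixes E F :: "complex fps"
  assumes q: "q > 0" and E0: "fps_nth E 0 = 1" and F0: "fps_nth F 0 = 1"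
    and wB: "wl q (cf (inverse E))" and wD: "wl q (cf (E - F))"
    and small: "nl q (cf (inverse E)) * nl q (cf (E - F)) \<le> 1 / 2"
  shows "wl q (cf (inverse F))" "nl q (cf (inverse F)) \<le> 2 * nl q (cf (inverse E))"
    "nl q (\<lambda>k. cf (inverse F) k - cf (inverse E) k) \<le> 2 * nl q (cf (inverse E)) ^ 2 * nl q (cf (E - F))"
proof -
  define C where "C = inverse E * (E - F)"
  let ?B = "inverse E" and ?G = "inverse F"
  have id: "?G - ?B = C * ?G"
  proof -
    have "C * ?G = (?B * E) * ?G - ?B * (?G * F)" by (simp add: C_def algebra_simps)
    also have "?B * E = 1" by (rule inverse_mult_eq_1) (simp add: E0)
    also have "?G * F = 1" by (rule inverse_mult_eq_1) (simp add: F0)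
    finally show ?thesis by simp
  qed
  have wC: "wl q (cf C)" unfolding C_def conv_cf[symmetric] by (rule wl_conv[OF q wB wD])
  have nC: "nl q (cf C) \<le> nl q (cf ?B) * nl q (cf (E - F))"
    unfolding C_def conv_cf[symmetric] by (rule nl_conv[OF q wB wD])
  define S where "S M = (\<Sum>k<M. norm (fps_nth ?G k) * q ^ k)" for M
  have S0: "S M \<ge> 0" for M unfolding S_def using q by (intro sum_nonneg) auto
  have bound: "S M \<le> 2 * nl q (cf ?B)" for M
  proof -
    \<comment> \<open>A coefficient of \<open>C * inverse F\<close> below \<open>M\<close> involves
      only coefficients of \<open>inverse F\<close> below \<open>M\<close>, so truncating there
      loses nothing.\<close>
    define v where "v k = (if k < M then norm (fps_nth ?G k) * q ^ k else 0)" for k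
    have v0: "v k \<ge> 0" for k using q by (simp add: v_def)
    have vS: "(\<Sum>k<J. v k) \<le> S M" for J
    proof -
      have "(\<Sum>k<J. v k) = (\<Sum>k\<in>{..<J} \<inter> {..<M}. v k)"
        by (rule sum.mono_neutral_right) (auto simp: v_def)
      also have "\<dots> \<le> (\<Sum>k<M. v k)" by (rule sum_mono2) (auto simp: v0)
      also have "\<dots> = S M" by (simp add: S_def v_def)
      finally show ?thesis .
    qed
    have G: "fps_nth ?G k = fps_nth ?B k + fps_nth (C * ?G) k" for k
      using arg_cong[OF id, of "\<lambda>f. fps_nth f k"] by (simp add: diff_eq_eq add.commute)
    have CG: "norm (fps_nth (C * ?G) k) * q ^ k \<le> (\<Sum>i\<le>k. (norm (fps_nth C i) * q ^ i) * v (k - i))" if "k < M" for k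
    proof -
      have "norm (fps_nth (C * ?G) k) * q ^ k \<le> (\<Sum>i\<le>k. norm (fps_nth C i * fps_nth ?G (k - i))) * q ^ k"
        unfolding fps_mult_nth atLeast0AtMost using q by (intro mult_right_mono norm_sum) auto
      also have "\<dots> = (\<Sum>i\<le>k. (norm (fps_nth C i) * q ^ i) * v (k - i))"
        unfolding sum_distrib_right
      proof (rule sum.cong[OF refl])
        fix i assume "i \<in> {..k}"
        then have e: "q ^ k = q ^ i * q ^ (k - i)" and v: "v (k - i) = norm (fps_nth ?G (k - i)) * q ^ (k - i)"
          using that by (auto simp: v_def simp flip: power_add)
        show "norm (fps_nth C i * fps_nth ?G (k - i)) * q ^ k = (norm (fps_nth C i) * q ^ i) * v (k - i)"
          unfolding e v norm_mult by (simp only: mult_ac)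
      qed
      finally show ?thesis .
    qed
    have "S M \<le> (\<Sum>k<M. norm (fps_nth ?B k) * q ^ k + (\<Sum>i\<le>k. (norm (fps_nth C i) * q ^ i) * v (k - i)))"
      unfolding S_def
    proof (rule sum_mono)
      fix k assume k: "k \<in> {..<M}"
      have "norm (fps_nth ?G k) * q ^ k \<le> (norm (fps_nth ?B k) + norm (fps_nth (C * ?G) k)) * q ^ k"
        unfolding G using q by (intro mult_right_mono norm_triangle_ineq) auto
      then show "norm (fps_nth ?G k) * q ^ k \<le> norm (fps_nth ?B k) * q ^ k + (\<Sum>i\<le>k. (norm (fps_nth C i) * q ^ i) * v (k - i))"
        using CG[of k] k by (simp add: distrib_right)
    qed
    also have "\<dots> \<le> nl q (cf ?B) + nl q (cf C) * S M"
      unfolding sum.distrib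
      by (intro add_mono nl_cf_sum_le q wB wC sum_convolution_le vS v0) (use q in auto)
    also have "nl q (cf C) * S M \<le> 1 / 2 * S M"
      using nC small S0 by (intro mult_right_mono) auto
    finally show ?thesis by simp
  qed
  show wG: "wl q (cf ?G)" and nG: "nl q (cf ?G) \<le> 2 * nl q (cf ?B)"
    using wl_cf_bounded_partial_sums[OF q] bound unfolding S_def by blast+
  have "nl q (\<lambda>k. cf ?G k - cf ?B k) = nl q (conv (cf C) (cf ?G))"
    by (simp only: cf_diff id conv_cf)
  also have "\<dots> \<le> nl q (cf C) * nl q (cf ?G)" by (rule nl_conv[OF q wC wG])
  also have "\<dots> \<le> (nl q (cf ?B) * nl q (cf (E - F))) * (2 * nl q (cf ?B))"
    by (intro mult_mono nC nG nl_nonneg mult_nonneg_nonneg)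
  finally show "nl q (\<lambda>k. cf ?G k - cf ?B k) \<le> 2 * nl q (cf ?B) ^ 2 * nl q (cf (E - F))"
    by (simp add: power2_eq_square mult_ac)
qed

lemma wtends_cf_mono:
  assumes "wtends Q (\<lambda>N. cf (F N)) (cf G)" "0 < q" "q \<le> Q"
  shows "wtends q (\<lambda>N. cf (F N)) (cf G)"
proof -
  have w: "wl Q (cf (F N))" "wl Q (cf G)" for N using assms by (auto simp: wtends_def)
  have d: "wl Q (cf (F N - G))" for N
    using wl_diff[OF w] by (simp add: cf_diff)
  have lim: "(\<lambda>N. nl Q (cf (F N - G))) \<longlonglongrightarrow> 0" using assms(1) by (simp add: wtends_def cf_diff)
  have "(\<lambda>N. nl q (cf (F N - G))) \<longlonglongrightarrow> 0"
    by (rule tendsto_sandwich[OF always_eventually always_eventually tendsto_const lim])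
       (use nl_nonneg wl_cf_mono(2)[OF d assms(2,3)] in blast)+
  then show ?thesis unfolding wtends_def cf_diff using wl_cf_mono(1) w assms(2,3) by blast
qed

text \<open>The unnormalized weight. \<open>E\<close> plays the role of 1/H(rho-), hence the Schur
  factor is built from \<open>inverse E\<close>.\<close>

definition jt_weight :: "int \<Rightarrow> complex fps \<Rightarrow> complex fps \<Rightarrow> nat list \<Rightarrow> complex" where
  "jt_weight c A E l = jt_det (cf A) (tau c) c l * jt_det (cf (inverse E)) (\<lambda>_. 0) c l"

lemma finite_partitions_subset:
  assumes "finite F" "F \<subseteq> partitions"
  shows "\<exists>N. F \<subseteq> parts_le N"
proof -
  have "F \<subseteq> parts_le (\<Sum>l\<in>F. length l)"
    using assms by (auto simp: parts_le_def intro: member_le_sum)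
  then show ?thesis by blast
qed

section \<open>Absolute summability of the weights over all partitions\<close>

context series_pair
begin

text \<open>The bound of \<open>jt_det_sum_le\<close> is uniform in the number of rows, so it covers
  every finite set of partitions.\<close>

lemma jt_phi_summable:
  assumes r: "0 < r" "r < q2" and c: "c = 1 \<or> c = -1"
  shows "(\<lambda>l. norm (jt_det (cf A) (tau c) c l) * r ^ sum_list l) summable_on partitions"
proof (rule nonneg_bdd_above_summable_on)
  let ?f = "\<lambda>l. norm (jt_det (cf A) (tau c) c l) * r ^ sum_list l"
  let ?C = "exp (nl q2 (cf A) * nl q2 (cf (inverse A)) / (1 - r / q2)^2 +
      1 * r powi (1 - c) * nl q2 (cf A) * nl q2 (cf (inverse A)) / (1 - r^2))"
  have "sum ?f F \<le> ?C" if F: "finite F" "F \<subseteq> partitions" for F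
  proof -
    obtain N where N: "F \<subseteq> parts_le N" using finite_partitions_subset[OF F] by blast
    have "sum ?f F = (\<Sum>l\<in>F. norm (detn N (\<lambda>i j. jt_fun (cf A) (tau c) c j (part_pt l i))) * r ^ sum_list l)"
    proof (rule sum.cong[OF refl])
      fix l assume "l \<in> F"
      then have "length l \<le> N" using N by (auto simp: parts_le_def)
      then show "?f l = norm (detn N (\<lambda>i j. jt_fun (cf A) (tau c) c j (part_pt l i))) * r ^ sum_list l"
        using jt_det_stable[of l N A "tau c" c] A0 tau_boundary[OF c] by simp
    qed
    also have "\<dots> \<le> ?C"
      by (rule jt_det_sum_le)
         (use r q wlA A0 norm_tau_le[OF c] tau_boundary[OF c] F N in auto)
    finally show ?thesis .
  qed
  then show "bdd_above (sum ?f ` {F. F \<subseteq> partitions \<and> finite F})"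
    by (intro bdd_aboveI2) auto
qed (use r in auto)

text \<open>\<open>jt_det_sum_le\<close> for a single partition at the radii 1/r < 1/q1. They may
  exceed 1, which is admissible since \<tau> = 0 for Schur functions.\<close>

lemma jt_psi_bound:
  assumes r: "q1 < r" and l: "l \<in> partitions"
    and CE: "nl (1 / q1) (cf E) \<le> CE" and CB: "nl (1 / q1) (cf (inverse E)) \<le> CB"
  shows "norm (jt_det (cf (inverse E)) (\<lambda>_. 0) c l) \<le> exp (CB * CE / (1 - q1 / r)^2) * r ^ sum_list l"
proof -
  have r0: "r > 0" using r q by simp
  have inv: "inverse (inverse E) = E" using E0 by (intro fps_inverse_idempotent) simp
  have "(\<Sum>l'\<in>{l}. norm (detn (length l) (\<lambda>i j. jt_fun (cf (inverse E)) (\<lambda>_. 0) c j (part_pt l' i))) * (1 / r) ^ sum_list l')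
    \<le> exp (CB * CE / (1 - (1 / r) / (1 / q1))^2 + 0 * (1 / r) powi (1 - c) * CB * CE / (1 - (1 / r)^2))"
  proof (rule jt_det_sum_le[where A = "inverse E" and q = "1 / r" and Q = "1 / q1" and CA = CB and CI = CE
        and \<tau> = 0 and t = "\<lambda>_. 0" and c = c and F = "{l}" and N = "length l"])
    show "1 / r < 1 / q1" using r q by (intro divide_strict_left_mono) auto
  qed (use r0 l CE CB wlE inv E0 in \<open>auto simp: parts_le_def\<close>)
  then have "norm (jt_det (cf (inverse E)) (\<lambda>_. 0) c l) * (1 / r) ^ sum_list l \<le> exp (CB * CE / (1 - q1 / r)^2)"
    by (simp add: jt_det_def)
  then show ?thesis using r0 by (simp add: power_one_over field_simps)
qed

lemma jt_weight_bound:
  assumes r: "q1 < r" and l: "l \<in> partitions"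
  shows "norm (jt_weight c A E l) \<le> exp (nl (1 / q1) (cf (inverse E)) * nl (1 / q1) (cf E) / (1 - q1 / r)^2) *
    (norm (jt_det (cf A) (tau c) c l) * r ^ sum_list l)"
  unfolding jt_weight_def norm_mult
  using mult_left_mono[OF jt_psi_bound[OF r l order.refl order.refl, of c] norm_ge_zero[of "jt_det (cf A) (tau c) c l"]]
  by (simp only: mult_ac)

lemma jt_weight_summable:
  assumes c: "c = 1 \<or> c = -1"
  shows "jt_weight c A E summable_on partitions"
proof -
  \<comment> \<open>Between q1 and q2 both estimates meet: the Schur factor is at most a constant
    times r^|\<lambda>|, and the other factor is summable against r^|\<lambda>|.\<close>
  define r where "r = (q1 + q2) / 2"
  have r: "q1 < r" "r < q2" "0 < r" using q by (auto simp: r_def)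
  show ?thesis
    by (rule csum_comparison[OF summable_on_cmult_right[OF jt_phi_summable[OF r(3,2) c]] jt_weight_bound[OF r(1)]])
qed

end

context polynomial_pair
begin

text \<open>\<open>W\<close> is the Gram determinant. That it is the same for all \<open>n\<close>
  and \<open>k\<close> lets the case n = 0 identify it as the total mass.\<close>

lemma jt_weight_correlation:
  "\<exists>W. \<forall>n k. n \<le> N \<longrightarrow> inj_on k {..<n} \<longrightarrow> (\<forall>i<n. k i \<ge> - int N) \<longrightarrow>
     (jt_weight c A E has_sum W * detn n (\<lambda>i j. corr_kernel c A E (k i) (k j)))
     {l \<in> parts_le N. k ` {..<n} \<subseteq> shifted_set l}"
proof (intro exI[of _ "detn N gram"] allI impI)
  fix n and k :: "nat \<Rightarrow> int"
  assume n: "n \<le> N" and k: "inj_on k {..<n}" "\<forall>i<n. k i \<ge> - int N"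
  let ?w = "\<lambda>l. detn N (\<lambda>i j. phi j (part_pt l i)) * detn N (\<lambda>i j. psi j (part_pt l i))"
  have w: "?w l = jt_weight c A E l" if "l \<in> parts_le N" for l
  proof -
    have len: "length l \<le> N" using that by (simp add: parts_le_def)
    have "detn N (\<lambda>i j. psi j (part_pt l i)) = jt_det (cf (inverse E)) (\<lambda>_. 0) c l"
      using jt_det_stable[OF len, of "inverse E" "\<lambda>_. 0" c] E0 by (simp add: jt_fun_zero)
    moreover have "detn N (\<lambda>i j. phi j (part_pt l i)) = jt_det (cf A) (tau c) c l"
      by (rule jt_det_stable[OF len A0 tau_boundary[OF c]])
    ultimately show ?thesis by (simp add: jt_weight_def)
  qed
  have "jt_weight c A E summable_on parts_le N"
    by (rule summable_on_subset_banach[OF jt_weight_summable[OF c]]) (auto simp: parts_le_def)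
  then have "?w summable_on parts_le N"
    by (rule summable_on_cong[THEN iffD1, rotated]) (simp add: w)
  from finite_correlation[OF this n k(1)] k(2)
  have "(?w has_sum detn N gram * detn n (\<lambda>i j. corr_kernel c A E (k i) (k j))) {l \<in> parts_le N. k ` {..<n} \<subseteq> pts N l}"
    by blast
  moreover have "{l \<in> parts_le N. k ` {..<n} \<subseteq> pts N l} = {l \<in> parts_le N. k ` {..<n} \<subseteq> shifted_set l}"
    using pts_iff_shifted k(2) by blast
  ultimately have h: "(?w has_sum detn N gram * detn n (\<lambda>i j. corr_kernel c A E (k i) (k j))) {l \<in> parts_le N. k ` {..<n} \<subseteq> shifted_set l}"
    by (simp only:)
  show "(jt_weight c A E has_sum detn N gram * detn n (\<lambda>i j. corr_kernel c A E (k i) (k j))) {l \<in> parts_le N. k ` {..<n} \<subseteq> shifted_set l}"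
    by (rule has_sum_cong[THEN iffD1, OF _ h]) (simp add: w)
qed

end

lemma wtends_ff:
  assumes r: "0 < r" and A: "wl r (cf A)"
    and E: "wtends r (\<lambda>N. cf (F N)) (cf E)" "wtends (1 / r) (\<lambda>N. cf (F N)) (cf E)"
  shows "wtends r (\<lambda>N. ff A (F N)) (ff A E)"
  unfolding ff_def by (intro wtends_conv[OF r] wtends_const A E wtends_rev[OF r])

context series_pair
begin

text \<open>\<open>N0\<close> makes the truncation error small enough for
  \<open>inverse_perturbation\<close> from the start; the norm bounds, uniform in N, will provide
  the dominating series.\<close>

lemma cutoff_approximation:
  obtains F :: "nat \<Rightarrow> complex fps" and N0 where
    "\<And>N. series_pair q1 q2 A (F N)" "\<And>N k. k > N0 + N \<Longrightarrow> fps_nth (F N) k = 0"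
    "\<And>N. nl (1 / q1) (cf (F N)) \<le> nl (1 / q1) (cf E)"
    "\<And>N. nl (1 / q1) (cf (inverse (F N))) \<le> 2 * nl (1 / q1) (cf (inverse E))"
    "wtends (1 / q1) (\<lambda>N. cf (F N)) (cf E)"
    "wtends (1 / q1) (\<lambda>N. cf (inverse (F N))) (cf (inverse E))"
proof -
  let ?Q = "1 / q1"
  have Q: "?Q > 0" using q by simp
  define T where "T N = fps_cutoff (Suc N) E" for N
  let ?B = "nl ?Q (cf (inverse E))"
  have wD: "wl ?Q (cf (E - T N))" for N unfolding T_def by (rule nl_cf_cutoff_tendsto(1)[OF Q wlE(1)])
  have lim: "(\<lambda>N. nl ?Q (cf (E - T N))) \<longlonglongrightarrow> 0" unfolding T_def by (rule nl_cf_cutoff_tendsto(2)[OF Q wlE(1)])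
  have "(\<lambda>N. ?B * nl ?Q (cf (E - T N))) \<longlonglongrightarrow> 0" using tendsto_mult_left[OF lim, of ?B] by simp
  then have "\<forall>\<^sub>F N in sequentially. ?B * nl ?Q (cf (E - T N)) < 1 / 2"
    by (rule order_tendstoD) simp
  then obtain N0 where N0: "\<And>N. N \<ge> N0 \<Longrightarrow> ?B * nl ?Q (cf (E - T N)) < 1 / 2"
    by (auto simp: eventually_sequentially)
  define F where "F N = T (N0 + N)" for N
  have F0: "fps_nth (F N) 0 = 1" for N by (simp add: F_def T_def E0)
  have fin: "wl ?Q (cf (F N))" for N
  proof (rule wl_finite, rule finite_subset)
    show "{k. cf (F N) k \<noteq> 0} \<subseteq> {0..int (N0 + N)}"
      by (auto simp: cf_def F_def T_def split: if_splits)
  qed simp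
  have wDF: "wl ?Q (cf (E - F N))" for N unfolding F_def by (rule wD)
  have small: "?B * nl ?Q (cf (E - F N)) \<le> 1 / 2" for N
    unfolding F_def using N0[of "N0 + N"] by simp
  have limF: "(\<lambda>N. nl ?Q (cf (E - F N))) \<longlonglongrightarrow> 0"
    using LIMSEQ_ignore_initial_segment[OF lim, of N0] by (simp add: F_def add.commute)
  note P = inverse_perturbation[OF Q E0 F0 wlE(2) wDF small]
  show thesis
  proof (rule that[of F N0])
    show "series_pair q1 q2 A (F N)" for N
      by unfold_locales (use q A0 F0 wlA fin P(1) in auto)
    show "fps_nth (F N) k = 0" if "k > N0 + N" for N k using that by (simp add: F_def T_def)
    show "nl ?Q (cf (F N)) \<le> nl ?Q (cf E)" for N
      unfolding nl_cf_eq[OF Q fin] nl_cf_eq[OF Q wlE(1)]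
      by (rule suminf_le) (use q wl_cf_iff[OF Q] fin wlE in \<open>auto simp: F_def T_def\<close>)
    show "nl ?Q (cf (inverse (F N))) \<le> 2 * nl ?Q (cf (inverse E))" for N by (rule P(2))
    have "nl ?Q (\<lambda>k. cf (F N) k - cf E k) = nl ?Q (cf (E - F N))" for N
      by (simp add: nl_eq[OF Q] norm_minus_commute flip: cf_diff)
    then show "wtends ?Q (\<lambda>N. cf (F N)) (cf E)"
      using fin wlE limF by (simp add: wtends_def)
    have l2: "(\<lambda>N. 2 * ?B ^ 2 * nl ?Q (cf (E - F N))) \<longlonglongrightarrow> 0"
      using tendsto_mult_left[OF limF, of "2 * ?B ^ 2"] by simp
    have "(\<lambda>N. nl ?Q (\<lambda>k. cf (inverse (F N)) k - cf (inverse E) k)) \<longlonglongrightarrow> 0"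
      by (rule tendsto_sandwich[OF always_eventually always_eventually tendsto_const l2])
         (use nl_nonneg P(3) in blast)+
    then show "wtends ?Q (\<lambda>N. cf (inverse (F N))) (cf (inverse E))"
      using P(1) wlE by (simp add: wtends_def)
  qed
qed

theorem jt_weight_correlation_limit:
  assumes c: "c = 1 \<or> c = -1" and inj: "inj_on k {..<n}"
  shows "(jt_weight c A E has_sum
      infsum (jt_weight c A E) partitions * detn n (\<lambda>i j. corr_kernel c A E (k i) (k j)))
     {l \<in> partitions. k ` {..<n} \<subseteq> shifted_set l}"
proof -
  obtain F N0 where F: "\<And>N. series_pair q1 q2 A (F N)" "\<And>N k. k > N0 + N \<Longrightarrow> fps_nth (F N) k = 0"
    "\<And>N. nl (1 / q1) (cf (F N)) \<le> nl (1 / q1) (cf E)"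
    "\<And>N. nl (1 / q1) (cf (inverse (F N))) \<le> 2 * nl (1 / q1) (cf (inverse E))"
    "wtends (1 / q1) (\<lambda>N. cf (F N)) (cf E)"
    "wtends (1 / q1) (\<lambda>N. cf (inverse (F N))) (cf (inverse E))"
    by (rule cutoff_approximation) blast
  have at: "wtends s (\<lambda>N. cf (F N)) (cf E)" "wtends s (\<lambda>N. cf (inverse (F N))) (cf (inverse E))"
    if "0 < s" "s \<le> 1 / q1" for s
    using wtends_cf_mono[OF F(5)] wtends_cf_mono[OF F(6)] that by blast+
  have ffl: "wtends s (\<lambda>N. ff A (F N)) (ff A E)"
    "wtends s (\<lambda>N. ff (inverse A) (inverse (F N))) (ff (inverse A) (inverse E))"
    if s: "q1 \<le> s" "s \<le> q2" for s
  proof -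
    have s': "0 < s" "s \<le> 1 / q1" "0 < 1 / s" "1 / s \<le> 1 / q1"
      using s q order.trans[OF s(2) less_imp_le[OF q_inv(2)]] by (auto intro!: divide_left_mono)
    show "wtends s (\<lambda>N. ff A (F N)) (ff A E)"
      "wtends s (\<lambda>N. ff (inverse A) (inverse (F N))) (ff (inverse A) (inverse E))"
      by (intro wtends_ff at s' wl_at s)+
  qed
  have kernel_lim: "(\<lambda>N. corr_kernel c A (F N) x y) \<longlonglongrightarrow> corr_kernel c A E x y" for x y
  proof -
    let ?g = "\<lambda>N. ff (inverse A) (inverse (F N))"
    \<comment> \<open>Convergence of 1/F on the circle q1 controls \<open>uu\<close> on the circle
      q2, where it is multiplied by F.\<close>
    have g: "wtends q1 ?g gg" using ffl(2)[of q1] q by simp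
    let ?K = "q1 powi (y + 1) + q1 powi (y + c)"
    have lim: "(\<lambda>N. nl q1 (\<lambda>k. ?g N k - gg k)) \<longlonglongrightarrow> 0" using g by (simp add: wtends_def)
    have wg: "wl q1 (?g N)" "wl q1 gg" for N using g by (auto simp: wtends_def)
    have b: "nl q2 (\<lambda>m. uu c (?g N) y m - uu c gg y m) \<le> ?K * nl q1 (\<lambda>k. ?g N k - gg k)" for N
      unfolding uu_diff by (rule uu_bound(2)) (use q c wl_diff[OF wg] in \<open>auto intro: less_imp_le[OF q_inv(2)]\<close>)
    have l2: "(\<lambda>N. ?K * nl q1 (\<lambda>k. ?g N k - gg k)) \<longlonglongrightarrow> 0"
      using tendsto_mult_left[OF lim, of ?K] by simp
    have "(\<lambda>N. nl q2 (\<lambda>m. uu c (?g N) y m - uu c gg y m)) \<longlonglongrightarrow> 0"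
      by (rule tendsto_sandwich[OF always_eventually always_eventually tendsto_const l2])
         (use nl_nonneg b in blast)+
    moreover have "wl q2 (uu c (?g N) y)" "wl q2 (uu c gg y)" for N
      by (rule uu_bound(1)[of q1]; use q c wg in \<open>auto intro: less_imp_le[OF q_inv(2)]\<close>)+
    ultimately have "wtends q2 (\<lambda>N. uu c (?g N) y) (uu c gg y)" by (simp add: wtends_def)
    then have "wtends q2 (\<lambda>N. conv (uu c (?g N) y) (ff A (F N))) (conv (uu c gg y) (ff A E))"
      using ffl(1)[of q2] q by (intro wtends_conv) auto
    from wtends_pointwise[OF q_pos this] show ?thesis by (simp add: corr_kernel_def)
  qed
  define r where "r = (q1 + q2) / 2"
  have r: "q1 < r" "r < q2" "0 < r" using q by (auto simp: r_def)
  define M where "M l = exp (2 * nl (1 / q1) (cf (inverse E)) * nl (1 / q1) (cf E) / (1 - q1 / r)^2) *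
     (norm (jt_det (cf A) (tau c) c l) * r ^ sum_list l)" for l
  have M: "M summable_on partitions"
    unfolding M_def by (rule summable_on_cmult_right[OF jt_phi_summable[OF r(3,2) c]])
  have M_le: "norm (jt_weight c A (F N) l) \<le> M l" if "l \<in> partitions" for N l
    unfolding jt_weight_def norm_mult M_def
    using mult_left_mono[OF series_pair.jt_psi_bound[OF F(1) r(1) that F(3) F(4), of N c]
        norm_ge_zero[of "jt_det (cf A) (tau c) c l"]]
    by (simp only: mult_ac)
  have M0: "M l \<ge> 0" for l using r by (simp add: M_def)
  \<comment> \<open>The finite ensemble covers only lengths up to N0 + N. Longer partitions get the
    weight 0, which does not affect the limit at a fixed partition.\<close>
  define a where "a l N = (if length l \<le> N0 + N then jt_weight c A (F N) l else 0)" for l N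
  have a_lim: "(\<lambda>N. a l N) \<longlonglongrightarrow> jt_weight c A E l" for l
  proof -
    have Qp: "1 / q1 > 0" using q by simp
    have "(\<lambda>N. jt_weight c A (F N) l) \<longlonglongrightarrow> jt_weight c A E l"
      unfolding jt_weight_def jt_det_def[of _ "\<lambda>_. 0"] jt_fun_zero
      by (intro tendsto_mult tendsto_const tendsto_detn wtends_pointwise[OF Qp F(6)])
    moreover have "\<forall>\<^sub>F N in sequentially. jt_weight c A (F N) l = a l N"
      using eventually_ge_at_top[of "length l"] by eventually_elim (simp add: a_def)
    ultimately show ?thesis by (rule Lim_transform_eventually)
  qed
  have dct: "(\<lambda>N. \<Sum>\<^sub>\<infinity>l\<in>S. a l N) \<longlonglongrightarrow> infsum (jt_weight c A E) S" if "S \<subseteq> partitions" for S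
    by (rule infsum_dominated_convergence[OF _ summable_on_subset_banach[OF M that] a_lim])
       (use that M_le M0 in \<open>auto simp: a_def\<close>)
  have PP: "polynomial_pair q1 q2 A (F N) (N0 + N) c" for N
    unfolding polynomial_pair_def polynomial_pair_axioms_def using F(1,2) c by blast
  have "\<forall>N. \<exists>W. \<forall>n k. n \<le> N0 + N \<longrightarrow> inj_on k {..<n} \<longrightarrow> (\<forall>i<n. k i \<ge> - int (N0 + N)) \<longrightarrow>
     (jt_weight c A (F N) has_sum W * detn n (\<lambda>i j. corr_kernel c A (F N) (k i) (k j)))
     {l \<in> parts_le (N0 + N). k ` {..<n} \<subseteq> shifted_set l}"
    using polynomial_pair.jt_weight_correlation[OF PP] by blast
  from choice[OF this] obtain W where W: "\<forall>N n k. n \<le> N0 + N \<longrightarrow> inj_on k {..<n} \<longrightarrow> (\<forall>i<n. k i \<ge> - int (N0 + N)) \<longrightarrow>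
     (jt_weight c A (F N) has_sum W N * detn n (\<lambda>i j. corr_kernel c A (F N) (k i) (k j)))
     {l \<in> parts_le (N0 + N). k ` {..<n} \<subseteq> shifted_set l}"
    by blast
  have a_sum: "(\<Sum>\<^sub>\<infinity>l\<in>{l \<in> partitions. k ` {..<n} \<subseteq> shifted_set l}. a l N) =
      W N * detn n (\<lambda>i j. corr_kernel c A (F N) (k i) (k j))"
    if "n \<le> N0 + N" "inj_on k {..<n}" "\<forall>i<n. k i \<ge> - int (N0 + N)" for n k N
  proof -
    have "(\<Sum>\<^sub>\<infinity>l\<in>{l \<in> partitions. k ` {..<n} \<subseteq> shifted_set l}. a l N) =
       infsum (jt_weight c A (F N)) {l \<in> parts_le (N0 + N). k ` {..<n} \<subseteq> shifted_set l}"
      by (rule infsum_cong_neutral) (auto simp: parts_le_def a_def)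
    then show ?thesis using infsumI[OF W[rule_format, OF that(1,2)]] that(3) by simp
  qed
  have "(\<Sum>\<^sub>\<infinity>l\<in>partitions. a l N) = W N" for N
    using a_sum[of 0 N "\<lambda>_. 0"] by simp
  \<comment> \<open>The case n = 0 has shown that \<open>W N\<close> is the sum of all truncated
    weights, so dominated convergence applies to it as well.\<close>
  then have W_lim: "W \<longlonglongrightarrow> infsum (jt_weight c A E) partitions"
    using dct[of partitions] by simp
  let ?S = "{l \<in> partitions. k ` {..<n} \<subseteq> shifted_set l}"
  \<comment> \<open>From \<open>m\<close> on, \<open>n\<close> is at most the rank N0 + N and every
    k i is at least -(N0 + N).\<close>
  define m where "m = n + nat (\<Sum>i<n. \<bar>k i\<bar>)"
  have m: "n \<le> N0 + N" "\<forall>i<n. k i \<ge> - int (N0 + N)" if "N \<ge> m" for N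
  proof -
    show "n \<le> N0 + N" using that by (simp add: m_def)
    have "\<bar>k i\<bar> \<le> (\<Sum>i<n. \<bar>k i\<bar>)" if "i < n" for i
      by (rule member_le_sum) (use that in auto)
    then show "\<forall>i<n. k i \<ge> - int (N0 + N)" using that unfolding m_def by fastforce
  qed
  have "\<forall>\<^sub>F N in sequentially. W N * detn n (\<lambda>i j. corr_kernel c A (F N) (k i) (k j)) = (\<Sum>\<^sub>\<infinity>l\<in>?S. a l N)"
    using eventually_ge_at_top[of m] by eventually_elim (use a_sum m inj in simp)
  moreover have "(\<lambda>N. W N * detn n (\<lambda>i j. corr_kernel c A (F N) (k i) (k j))) \<longlonglongrightarrow>
     infsum (jt_weight c A E) partitions * detn n (\<lambda>i j. corr_kernel c A E (k i) (k j))"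
    by (intro tendsto_mult W_lim tendsto_detn kernel_lim)
  ultimately have "(\<lambda>N. \<Sum>\<^sub>\<infinity>l\<in>?S. a l N) \<longlonglongrightarrow>
     infsum (jt_weight c A E) partitions * detn n (\<lambda>i j. corr_kernel c A E (k i) (k j))"
    by (rule Lim_transform_eventually[rotated])
  then have "infsum (jt_weight c A E) ?S =
     infsum (jt_weight c A E) partitions * detn n (\<lambda>i j. corr_kernel c A E (k i) (k j))"
    using dct[of ?S] LIMSEQ_unique by blast
  moreover have "jt_weight c A E summable_on ?S"
    by (rule summable_on_subset_banach[OF jt_weight_summable[OF c]]) auto
  ultimately show ?thesis by (simp add: has_sum_iff)
qed

end

section \<open>The mean size of the random partition\<close>

text \<open>Particles at x >= 0 and holes at x < 0, relative to the empty partition, whose points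
  are all the negative integers.\<close>

definition flipped :: "nat list \<Rightarrow> int set" where
  "flipped l = {x. (x \<in> shifted_set l) \<noteq> (x < 0)}"

text \<open>The size is the sum of x + 1/2 over the first N points minus the same sum over -1, ...,
  -N. Common points cancel, and x + 1/2 is positive on particles and negative on holes.\<close>

lemma sum_list_eq_sum_flipped:
  assumes "l \<in> partitions"
  shows "finite (flipped l)" "(\<Sum>x\<in>flipped l. \<bar>real_of_int x + 1/2\<bar>) = real (sum_list l)"
proof -
  define N where "N = length l"
  have lN: "l \<in> parts_le N" using assms by (simp add: parts_le_def N_def)
  let ?P = "pts N l" and ?M = "{- int N..<0}"
  have low: "x \<in> shifted_set l" if "x < - int N" for x
  proof -
    have "part_pt l (nat (- x - 1)) = x" using that by (simp add: part_pt_def parts_Suc N_def)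
    then show ?thesis unfolding shifted_set_eq by (metis rangeI)
  qed
  have fl: "flipped l = (?P - ?M) \<union> (?M - ?P)"
  proof (rule Set.set_eqI)
    fix x
    show "x \<in> flipped l \<longleftrightarrow> x \<in> (?P - ?M) \<union> (?M - ?P)"
    proof (cases "x < - int N")
      case True
      then show ?thesis using low[of x] pts_ge[of x N l] by (auto simp: flipped_def)
    next
      case False
      then show ?thesis using pts_iff_shifted[OF lN, of x] by (auto simp: flipped_def)
    qed
  qed
  show "finite (flipped l)" unfolding fl using finite_pts by auto
  let ?h = "\<lambda>x. real_of_int x + 1/2"
  have ge0: "x \<ge> 0" if "x \<in> ?P - ?M" for x using that pts_ge[of x N l] by auto
  have "(\<Sum>x\<in>flipped l. \<bar>?h x\<bar>) = (\<Sum>x\<in>?P - ?M. \<bar>?h x\<bar>) + (\<Sum>x\<in>?M - ?P. \<bar>?h x\<bar>)"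
    unfolding fl by (rule sum.union_disjoint) (auto simp: finite_pts)
  also have "(\<Sum>x\<in>?P - ?M. \<bar>?h x\<bar>) = (\<Sum>x\<in>?P - ?M. ?h x)"
  proof (rule sum.cong[OF refl])
    fix x assume "x \<in> ?P - ?M"
    from ge0[OF this] show "\<bar>?h x\<bar> = ?h x" by simp
  qed
  also have "(\<Sum>x\<in>?M - ?P. \<bar>?h x\<bar>) = (\<Sum>x\<in>?M - ?P. - ?h x)"
    by (rule sum.cong) auto
  also have "(\<Sum>x\<in>?P - ?M. ?h x) + (\<Sum>x\<in>?M - ?P. - ?h x) = (\<Sum>x\<in>?P. ?h x) - (\<Sum>x\<in>?M. ?h x)"
  proof -
    have "(\<Sum>x\<in>?P. ?h x) = (\<Sum>x\<in>?P - ?M. ?h x) + (\<Sum>x\<in>?P \<inter> ?M. ?h x)"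
      by (subst sum.union_disjoint[symmetric]) (auto simp: finite_pts Diff_Int_distrib intro!: sum.cong)
    moreover have "(\<Sum>x\<in>?M. ?h x) = (\<Sum>x\<in>?M - ?P. ?h x) + (\<Sum>x\<in>?P \<inter> ?M. ?h x)"
      by (subst sum.union_disjoint[symmetric]) (auto intro!: sum.cong)
    ultimately show ?thesis unfolding sum_negf by linarith
  qed
  also have "(\<Sum>x\<in>?P. ?h x) = (\<Sum>i<N. ?h (part_pt l i))"
    unfolding pts_def by (simp add: sum.reindex part_pt_inj[OF assms])
  also have "(\<Sum>x\<in>?M. ?h x) = (\<Sum>i<N. ?h (- int i - 1))"
    by (rule sum.reindex_bij_witness[where i = "\<lambda>i. - int i - 1" and j = "\<lambda>x. nat (- x - 1)"]) auto
  also have "(\<Sum>i<N. ?h (part_pt l i)) - (\<Sum>i<N. ?h (- int i - 1)) = real_of_int (\<Sum>i<N. part_pt l i + 1 + int i)"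
    unfolding sum_subtractf[symmetric] of_int_sum by (rule sum.cong) auto
  also have "\<dots> = real (sum_list l)" using sum_part_pt[OF lN] by simp
  finally show "(\<Sum>x\<in>flipped l. \<bar>?h x\<bar>) = real (sum_list l)" .
qed

section \<open>The operator z d/dz and logarithmic derivatives of Laurent series\<close>

definition euler :: "(int \<Rightarrow> complex) \<Rightarrow> int \<Rightarrow> complex" where
  "euler f k = of_int k * f k"

lemma euler_cf: "euler (cf A) = cf (fps_X * fps_deriv A)"
proof
  fix k :: int
  show "euler (cf A) k = cf (fps_X * fps_deriv A) k"
  proof (cases "k \<le> 0")
    case True
    then show ?thesis by (cases "k = 0") (auto simp: euler_def cf_def)
  next
    case False
    then obtain m where "k = int (Suc m)" by (metis not_le zero_less_imp_eq_int gr0_implies_Suc)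
    then show ?thesis by (simp only: euler_def cf_of_nat) simp
  qed
qed

lemma euler_conv:
  assumes q: "q > 0" and w: "wl q f" "wl q g" "wl q (euler f)" "wl q (euler g)"
  shows "euler (conv f g) n = conv (euler f) g n + conv f (euler g) n"
proof -
  have "euler (conv f g) n = (\<Sum>\<^sub>\<infinity>k. of_int n * (f k * g (n - k)))"
    by (simp add: euler_def conv_def infsum_cmult_right')
  also have "\<dots> = (\<Sum>\<^sub>\<infinity>k. euler f k * g (n - k) + f k * euler g (n - k))"
    by (rule infsum_cong) (simp add: euler_def algebra_simps)
  also have "\<dots> = conv (euler f) g n + conv f (euler g) n"
    unfolding conv_def by (intro infsum_add conv_summable[OF q] w)
  finally show ?thesis .
qed

lemma euler_rev: "euler (rev_seq f) k = - rev_seq (euler f) k"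
  by (simp add: euler_def rev_seq_def)

lemma wl_minus: "wl q f \<Longrightarrow> wl q (\<lambda>k. - f k)"
  using wl_cmult[of q f "-1"] by simp

lemma conv_minus_left: "conv (\<lambda>k. - f k) g n = - conv f g n"
  using conv_cmult_left[of "-1" f g n] by simp

lemma conv_minus_right: "conv f (\<lambda>k. - g k) n = - conv f g n"
  using conv_minus_left[of g f n] by (simp only: conv_commute[of f])

lemma fps_log_deriv_inverse:
  fixes F G :: "complex fps"
  assumes "fps_X * fps_deriv F = G * F" "fps_nth F 0 = 1"
  shows "fps_X * fps_deriv (inverse F) = - G * inverse F"
proof -
  have i: "inverse F * F = 1" by (rule inverse_mult_eq_1) (simp add: assms)
  have "fps_X * fps_deriv (inverse F) = - (fps_X * fps_deriv F) * (inverse F * inverse F)"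
    using assms(2) by (simp add: fps_inverse_deriv power2_eq_square)
  also have "\<dots> = - G * ((inverse F * F) * inverse F)"
    unfolding assms(1) by (simp add: mult_ac)
  finally show ?thesis by (simp add: i)
qed

text \<open>\<open>PA\<close> and \<open>PE\<close> are z A'/A and z E'/E. For the specializations
  their k-th coefficients are p_k(rho+) and -p_k(rho-).\<close>

locale log_series_pair = series_pair +
  fixes PA PE :: "complex fps"
  assumes wlP: "wl q2 (cf PA)" "wl (1 / q1) (cf PE)"
    and dA: "fps_X * fps_deriv A = PA * A" and dE: "fps_X * fps_deriv E = PE * E"
begin

text \<open>The logarithmic derivative z F'/F; the minus sign comes from differentiating
  E(1/z).\<close>

definition P :: "int \<Rightarrow> complex" where
  "P k = cf PA k + cf PE k - rev_seq (cf PE) k"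

lemma wl_logs: "wl q2 (cf PA)" "wl q2 (cf PE)" "wl q2 (rev_seq (cf PE))"
proof -
  show "wl q2 (cf PA)" by (rule wlP)
  show "wl q2 (cf PE)" by (rule wl_cf_mono(1)[OF wlP(2)]) (use q_inv q_pos in auto)
  show "wl q2 (rev_seq (cf PE))"
    unfolding wl_rev[OF q_pos] by (rule wl_cf_mono(1)[OF wlP(2)]) (use q_inv q_pos in auto)
qed

lemma wl_P: "wl q2 P"
  unfolding P_def by (intro wl_diff wl_add wl_logs)

lemma ff_at: "wl q2 (ff A E)" "wl q2 gg"
  using wl_ff wl_gg q by auto

lemma euler_ff: "euler (ff A E) = conv P (ff A E)"
proof
  fix n
  let ?a = "cf A" and ?e = "cf E" and ?re = "rev_seq (cf E)" and ?rP = "rev_seq (cf PE)"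
  note w = wl2 q_pos wl_logs
  have ea: "euler ?a = conv (cf PA) ?a" by (simp only: euler_cf dA conv_cf)
  have ee: "euler ?e = conv (cf PE) ?e" by (simp only: euler_cf dE conv_cf)
  have er: "euler ?re = (\<lambda>k. - conv ?rP ?re k)"
    by (rule ext) (simp only: euler_rev ee conv_rev)
  have wea: "wl q2 (euler ?a)" "wl q2 (euler ?e)" "wl q2 (euler ?re)"
    unfolding ea ee er by (intro wl_minus wl_conv w)+
  have eeps: "euler eps = (\<lambda>k. conv (cf PE) eps k - conv ?rP eps k)"
  proof
    fix k
    have "euler eps k = conv (euler ?e) ?re k + conv ?e (euler ?re) k"
      by (rule euler_conv[OF q_pos]) (intro w wea)+
    also have "conv (euler ?e) ?re = conv (cf PE) eps"
      unfolding ee by (rule conv_assoc[of q2]) (intro w)+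
    also have "conv ?e (euler ?re) k = - conv (conv ?rP ?re) ?e k"
      unfolding er conv_minus_right by (simp only: conv_commute)
    also have "conv (conv ?rP ?re) ?e = conv ?rP (conv ?re ?e)"
      by (rule conv_assoc[of q2]) (intro w)+
    also have "conv ?re ?e = eps" by (rule conv_commute)
    finally show "euler eps k = conv (cf PE) eps k - conv ?rP eps k" by simp
  qed
  have weps: "wl q2 (euler eps)"
    unfolding eeps by (intro wl_diff wl_conv w wl_eps)
  have as: "conv ?a (conv R eps) = conv R (ff A E)" if R: "wl q2 R" for R
  proof -
    have "conv ?a (conv R eps) = conv (conv ?a R) eps"
      by (rule conv_assoc[of q2, symmetric]) (intro w R wl_eps)+
    also have "\<dots> = conv (conv R ?a) eps" by (simp only: conv_commute)
    also have "\<dots> = conv R (conv ?a eps)"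
      by (rule conv_assoc[of q2]) (intro w R wl_eps)+
    finally show ?thesis by (simp only: ff_def)
  qed
  have "euler (ff A E) n = conv (euler ?a) eps n + conv ?a (euler eps) n"
    unfolding ff_def by (rule euler_conv[OF q_pos]) (intro w wea weps wl_eps)+
  also have "conv (euler ?a) eps = conv (cf PA) (ff A E)"
    unfolding ea ff_def by (rule conv_assoc[of q2]) (intro w wl_eps)+
  also have "conv ?a (euler eps) n = conv (cf PE) (ff A E) n - conv ?rP (ff A E) n"
    unfolding eeps conv_diff_right[OF q_pos wl_conv[OF q_pos w(9) wl_eps] wl_conv[OF q_pos w(10) wl_eps] w(1)]
    by (simp only: as wl_logs)
  finally show "euler (ff A E) n = conv P (ff A E) n"
    unfolding P_def
    by (simp add: conv_diff_left[OF q_pos wl_add[OF wl_logs(1,2)] wl_logs(3) ff_at(1)]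
        conv_add_left[OF q_pos wl_logs(1,2) ff_at(1)])
qed

lemma log_swap: "log_series_pair q1 q2 (inverse A) (inverse E) (- PA) (- PE)"
proof -
  interpret I: series_pair q1 q2 "inverse A" "inverse E" by (rule swap)
  have "wl Q (cf (- F))" if "wl Q (cf F)" for F Q
  proof -
    have "cf (- F) = (\<lambda>k. - cf F k)" by (auto simp: cf_def)
    then show ?thesis using wl_minus[OF that] by simp
  qed
  then show ?thesis
  proof unfold_locales
    show "fps_X * fps_deriv (inverse A) = - PA * inverse A" by (rule fps_log_deriv_inverse[OF dA A0])
    show "fps_X * fps_deriv (inverse E) = - PE * inverse E" by (rule fps_log_deriv_inverse[OF dE E0])
  qed (use wlP in auto)
qed

lemma euler_gg: "euler gg = (\<lambda>k. - conv P gg k)"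
proof -
  interpret I: log_series_pair q1 q2 "inverse A" "inverse E" "- PA" "- PE" by (rule log_swap)
  have "I.P = (\<lambda>k. - P k)" by (auto simp: I.P_def P_def rev_seq_def cf_def)
  then show ?thesis using I.euler_ff by (auto simp: conv_minus_left)
qed

lemma ff_gg: "conv (ff A E) gg = delta"
proof -
  let ?a = "cf A" and ?e = "cf E" and ?re = "rev_seq (cf E)"
  note w = wl2 q_pos ff_at
  have "ff A E = conv (conv ?a ?e) ?re"
    unfolding ff_def by (rule conv_assoc[of q2, symmetric]) (intro w)+
  then have "conv (ff A E) gg = conv gg (conv (conv ?a ?e) ?re)" by (simp only: conv_commute)
  also have "\<dots> = conv (conv gg (conv ?a ?e)) ?re"
    by (rule conv_assoc[of q2, symmetric]) (intro w wl_conv)+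
  also have "\<dots> = delta"
    by (simp only: gg_mult conv_commute[of "rev_seq (cf (inverse E))" ?re] rev_E_inverse)
  finally show ?thesis .
qed

text \<open>With G = 1/F, z F' = P F and z G' = -P G, and F G = 1 reduces each product to a
  polynomial in P.\<close>

lemma euler_conv_ff_gg: "conv (euler (ff A E)) gg = P" "conv (ff A E) (euler gg) = (\<lambda>k. - P k)"
  "conv (euler (ff A E)) (euler gg) = (\<lambda>k. - conv P P k)"
proof -
  note w = wl2 q_pos ff_at wl_P
  show 1: "conv (euler (ff A E)) gg = P"
    unfolding euler_ff using conv_assoc[OF q_pos wl_P ff_at] by (simp only: ff_gg conv_delta_right)
  have 2: "conv (ff A E) (conv P gg) = P"
  proof -
    have "conv (ff A E) (conv P gg) = conv (ff A E) (conv gg P)" by (simp only: conv_commute[of P])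
    also have "\<dots> = conv (conv (ff A E) gg) P" by (rule conv_assoc[of q2, symmetric]) (intro w)+
    finally show ?thesis by (simp only: ff_gg conv_delta)
  qed
  show "conv (ff A E) (euler gg) = (\<lambda>k. - P k)"
    unfolding euler_gg by (rule ext) (simp only: conv_minus_right 2)
  have "conv (conv P (ff A E)) (conv P gg) = conv P P"
    using conv_assoc[OF q_pos wl_P ff_at(1) wl_conv[OF q_pos wl_P ff_at(2)]] by (simp only: 2)
  then show "conv (euler (ff A E)) (euler gg) = (\<lambda>k. - conv P P k)"
    unfolding euler_gg euler_ff by (auto simp: conv_minus_right)
qed

lemma wl_euler: "wl q2 (euler (ff A E))" "wl q2 (euler gg)"
  unfolding euler_ff euler_gg by (intro wl_minus wl_conv q_pos wl_P ff_at)+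

section \<open>The diagonal of the kernel summed against |x + 1/2|\<close>

definition diag_points :: "int \<Rightarrow> int set" where
  "diag_points n = {x. (0 \<le> x \<and> x < n) \<or> (n \<le> x \<and> x < 0)}"

text \<open>Over these points |x + 1/2| runs through the first |n| of the numbers 1/2, 3/2, ...,
  whose sum is n^2/2.\<close>

lemma diag_points_sum: "finite (diag_points n)" "(\<Sum>x\<in>diag_points n. \<bar>real_of_int x + 1/2\<bar>) = (real_of_int n)^2 / 2"
proof -
  have arith: "(\<Sum>i<k. real i + 1/2) = (real k)^2 / 2" for k
    by (induction k) (auto simp: power2_eq_square algebra_simps)
  show "finite (diag_points n)"
    by (rule finite_subset[of _ "{- \<bar>n\<bar>..\<bar>n\<bar>}"]) (auto simp: diag_points_def)
  show "(\<Sum>x\<in>diag_points n. \<bar>real_of_int x + 1/2\<bar>) = (real_of_int n)^2 / 2"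
  proof (cases "n \<ge> 0")
    case True
    then have "(\<Sum>x\<in>diag_points n. \<bar>real_of_int x + 1/2\<bar>) = (\<Sum>i<nat n. real i + 1/2)"
      by (intro sum.reindex_bij_witness[where i = int and j = nat]) (auto simp: diag_points_def)
    then show ?thesis using arith[of "nat n"] True by simp
  next
    case False
    then have "(\<Sum>x\<in>diag_points n. \<bar>real_of_int x + 1/2\<bar>) = (\<Sum>i<nat (- n). real i + 1/2)"
      by (intro sum.reindex_bij_witness[where i = "\<lambda>i. - int i - 1" and j = "\<lambda>x. nat (- x - 1)"])
         (auto simp: diag_points_def)
    then show ?thesis using arith[of "nat (- n)"] False by simp
  qed
qed

definition hg :: "int \<Rightarrow> complex" where "hg n = ff A E n * gg (- n)"

lemma hg_has_sum: "(hg has_sum 1) UNIV"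
proof -
  have "(\<lambda>k. ff A E k * gg (0 - k)) summable_on UNIV" by (rule conv_summable[OF q_pos ff_at])
  moreover have "conv (ff A E) gg 0 = 1" by (simp add: ff_gg delta_def)
  ultimately show ?thesis by (simp add: has_sum_iff conv_def hg_def[abs_def])
qed

text \<open>n^2 f(n) g(-n) is minus the product of n f(n) and -n g(-n), so the sum of these terms is
  minus the constant term of z F' times z (1/F)', that is, the constant term of P^2.\<close>

lemma hg_square_has_sum: "((\<lambda>n. (of_int n)^2 / 2 * hg n) has_sum conv P P 0 / 2) UNIV"
proof -
  have "(\<lambda>k. euler (ff A E) k * euler gg (0 - k)) summable_on UNIV"
    by (rule conv_summable[OF q_pos wl_euler])
  then have "((\<lambda>k. euler (ff A E) k * euler gg (0 - k)) has_sum - conv P P 0) UNIV"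
    using fun_cong[OF euler_conv_ff_gg(3), of 0] by (simp add: has_sum_iff conv_def[of "euler _"])
  from has_sum_cmult_right[OF this, of "-1/2"] show ?thesis
    by (simp add: euler_def hg_def power2_eq_square mult_ac)
qed

text \<open>The contribution of the nonpositive exponents of \<open>uu\<close> to the particle
  density for x >= 0 and to the hole density for x < 0; the two tails of \<open>hg\<close> add up to
  1.\<close>

definition kap :: "int \<Rightarrow> complex" where
  "kap x = (if x \<ge> 0 then infsum hg {x + 1..} else infsum hg {..x})"

lemma kap_has_sum:
  "((\<lambda>x. of_real \<bar>real_of_int x + 1/2\<bar> * kap x) has_sum conv P P 0 / 2) UNIV"
proof -
  let ?T = "\<lambda>x n. of_real \<bar>real_of_int x + 1/2\<bar> * hg n :: complex"
  have inner: "((\<lambda>x. ?T x n) has_sum (of_int n)^2 / 2 * hg n) (diag_points n)" for n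
  proof (rule has_sum_finiteI)
    have "(\<Sum>x\<in>diag_points n. ?T x n) = of_real (\<Sum>x\<in>diag_points n. \<bar>real_of_int x + 1/2\<bar>) * hg n"
      by (simp only: sum_distrib_right of_real_sum)
    then show "(of_int n)^2 / 2 * hg n = (\<Sum>x\<in>diag_points n. ?T x n)"
      by (simp add: diag_points_sum)
  qed (rule diag_points_sum)
  have "(\<lambda>(n, x). ?T x n) summable_on Sigma UNIV diag_points"
  proof (rule csum_normD, rule summable_on_SigmaI)
    show "((\<lambda>x. norm (case (n, x) of (n, x) \<Rightarrow> ?T x n)) has_sum norm ((of_int n)^2 / 2 * hg n)) (diag_points n)" for n
    proof (rule has_sum_finiteI)
      have "(\<Sum>x\<in>diag_points n. norm (?T x n)) = (\<Sum>x\<in>diag_points n. \<bar>real_of_int x + 1/2\<bar>) * norm (hg n)"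
        unfolding sum_distrib_right by (simp add: norm_mult)
      then show "norm ((of_int n)^2 / 2 * hg n) = (\<Sum>x\<in>diag_points n. norm (case (n, x) of (n, x) \<Rightarrow> ?T x n))"
        by (simp add: diag_points_sum norm_mult norm_divide norm_power)
    qed (rule diag_points_sum)
    show "(\<lambda>n. norm ((of_int n)^2 / 2 * hg n)) summable_on UNIV"
      by (intro csum_norm has_sum_imp_summable[OF hg_square_has_sum])
  qed auto
  then have S1: "((\<lambda>(n, x). ?T x n) has_sum conv P P 0 / 2) (Sigma UNIV diag_points)"
    by (intro has_sum_SigmaI[OF _ hg_square_has_sum]) (use inner in auto)
  let ?B = "\<lambda>x. if x \<ge> 0 then {x + 1..} else {..x :: int}"
  have "((\<lambda>(x, n). ?T x n) has_sum conv P P 0 / 2) (Sigma UNIV ?B) \<longleftrightarrow>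
     ((\<lambda>(n, x). ?T x n) has_sum conv P P 0 / 2) (Sigma UNIV diag_points)"
    by (rule has_sum_reindex_bij_witness[where i = prod.swap and j = prod.swap])
       (auto simp: diag_points_def split: if_splits)
  with S1 have S2: "((\<lambda>(x, n). ?T x n) has_sum conv P P 0 / 2) (Sigma UNIV ?B)" by blast
  show ?thesis
  proof (rule has_sum_SigmaD[OF S2])
    fix x :: int
    have "(hg has_sum infsum hg (?B x)) (?B x)"
      by (rule has_sum_infsum, rule summable_on_subset_banach[OF has_sum_imp_summable[OF hg_has_sum]]) auto
    then have "(hg has_sum kap x) (?B x)" by (simp add: kap_def split: if_splits)
    then show "((\<lambda>n. case (x, n) of (x, n) \<Rightarrow> ?T x n) has_sum of_real \<bar>real_of_int x + 1/2\<bar> * kap x) (?B x)"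
      using has_sum_cmult_right by fastforce
  qed
qed

text \<open>The two arguments add up to 1 - 2m - c <= 0. At such a total index the weight is at
  least 1, so the weighted double series of the convolution dominates.\<close>

lemma negative_diagonal_summable:
  assumes w: "wl q2 f" "wl q2 g" and c: "c = 1 \<or> c = -1"
  shows "(\<lambda>(m, x). f (x + 1 - m) * g (- x - m - c)) summable_on {m. m \<ge> 1 \<and> m \<ge> 1 - c} \<times> UNIV"
proof -
  have "(\<lambda>(n, k). tw q2 f k * tw q2 g (n - k)) summable_on UNIV \<times> UNIV"
    using w conv_pair_summable' unfolding wl_def by blast
  then have S: "(\<lambda>(n, k). tw q2 f k * tw q2 g (n - k)) summable_on {..0} \<times> UNIV"
    by (rule summable_on_subset_banach) auto
  have S': "(\<lambda>(n, k). f k * g (n - k)) summable_on {..0} \<times> UNIV"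
  proof (rule csum_comparison[OF csum_norm[OF S]], clarify)
    fix n k :: int assume n: "n \<le> 0"
    have "norm (tw q2 f k * tw q2 g (n - k)) = norm (f k * g (n - k)) * (q2 powi k * q2 powi (n - k))"
      by (simp add: norm_mult norm_tw q_pos mult_ac)
    also have "q2 powi k * q2 powi (n - k) = q2 powi n"
      using q_pos by (simp flip: power_int_add)
    finally have e: "norm (tw q2 f k * tw q2 g (n - k)) = norm (f k * g (n - k)) * q2 powi n" .
    have "q2 powi n \<ge> 1"
      using n q_pos q by (auto simp: power_int_def intro!: one_le_power simp: one_le_inverse)
    then show "norm (f k * g (n - k)) \<le> norm (tw q2 f k * tw q2 g (n - k))"
      unfolding e using mult_left_mono[of 1 "q2 powi n" "norm (f k * g (n - k))"] by simp
  qed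
  let ?\<phi> = "\<lambda>(m, x). (1 - 2 * m - c, x + 1 - m)"
  let ?X = "{m. m \<ge> 1 \<and> m \<ge> 1 - c} \<times> (UNIV :: int set)"
  have "(\<lambda>(n, k). f k * g (n - k)) summable_on ?\<phi> ` ?X"
    by (rule summable_on_subset_banach[OF S']) (use c in auto)
  then have "(\<lambda>(n, k). f k * g (n - k)) \<circ> ?\<phi> summable_on ?X"
    by (subst (asm) summable_on_reindex) (auto simp: inj_on_def)
  moreover have "1 - 2 * m - c - (x + 1 - m) = - x - m - c" for m x :: int by simp
  then have "(\<lambda>(n, k). f k * g (n - k)) \<circ> ?\<phi> = (\<lambda>(m, x). f (x + 1 - m) * g (- x - m - c))"
    by (simp only: fun_eq_iff o_def split_def fst_conv snd_conv) blast
  ultimately show ?thesis by (simp only:)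
qed

text \<open>The contribution of the reflected half of \<open>uu\<close> to the diagonal.\<close>

definition rho :: "int \<Rightarrow> int \<Rightarrow> complex" where
  "rho c x = (\<Sum>\<^sub>\<infinity>m\<in>{m. m \<ge> 1 \<and> m \<ge> 1 - c}. of_int c * (ff A E (x + 1 - m) * gg (- x - m - c)))"

text \<open>With k = x + 1 - m and k' = -x - m - c one has x + 1/2 = (k - k' - c)/2, which turns the
  weight into \<open>euler\<close> on either factor. For fixed m the sum over x is then a
  combination of convolutions at 1 - 2m - c.\<close>

lemma rho_has_sum:
  assumes c: "c = 1 \<or> c = -1"
  shows "((\<lambda>x. (of_int x + 1/2) * rho c x) has_sum
     (\<Sum>\<^sub>\<infinity>m\<in>{m. m \<ge> 1 \<and> m \<ge> 1 - c}. of_int c * P (1 - 2 * m - c))) UNIV"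
proof -
  let ?M = "{m::int. m \<ge> 1 \<and> m \<ge> 1 - c}"
  let ?f = "ff A E"
  let ?T = "\<lambda>m x. (of_int x + 1/2) * (of_int c * (?f (x + 1 - m) * gg (- x - m - c)))"
  let ?T' = "\<lambda>m x. of_int c / 2 * (euler ?f (x + 1 - m) * gg (- x - m - c) - ?f (x + 1 - m) * euler gg (- x - m - c)
      - of_int c * (?f (x + 1 - m) * gg (- x - m - c)))"
  have eq: "?T m x = ?T' m x" for m x
    by (simp add: euler_def field_simps)
  have "(\<lambda>(m, x). euler ?f (x + 1 - m) * gg (- x - m - c) + (-1) * (?f (x + 1 - m) * euler gg (- x - m - c))
      + (- of_int c) * (?f (x + 1 - m) * gg (- x - m - c))) summable_on ?M \<times> UNIV"
    unfolding case_prod_unfold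
    by (intro summable_on_add summable_on_cmult_right negative_diagonal_summable[unfolded case_prod_unfold] c ff_at wl_euler)
  from summable_on_cmult_right[OF this, of "of_int c / 2"]
  have S: "(\<lambda>(m, x). ?T m x) summable_on ?M \<times> UNIV"
    unfolding eq by (simp add: case_prod_unfold algebra_simps)
  have inner: "((\<lambda>x. ?T m x) has_sum of_int c * P (1 - 2 * m - c)) UNIV" if m: "m \<in> ?M" for m
  proof -
    let ?s = "1 - 2 * m - c"
    \<comment> \<open>At a nonzero index F times 1/F contributes 0, and the two derivative terms are
      equal.\<close>
    have s: "?s \<noteq> 0" using m c by auto
    have cs: "((\<lambda>k. u k * v (?s - k)) has_sum conv u v ?s) UNIV" if "wl q2 u" "wl q2 v" for u v
      using conv_summable[OF q_pos that] by (simp add: has_sum_iff conv_def)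
    have h1: "((\<lambda>k. of_int c / 2 * (euler ?f k * gg (?s - k) - ?f k * euler gg (?s - k) - of_int c * (?f k * gg (?s - k)))) has_sum
        of_int c / 2 * (conv (euler ?f) gg ?s - conv ?f (euler gg) ?s - of_int c * conv ?f gg ?s)) UNIV"
      by (intro has_sum_cmult_right csum_diff cs ff_at wl_euler)
    have h2: "of_int c / 2 * (conv (euler ?f) gg ?s - conv ?f (euler gg) ?s - of_int c * conv ?f gg ?s) = of_int c * P ?s"
      using s by (simp add: euler_conv_ff_gg ff_gg delta_def)
    note h = h1[unfolded h2]
    have "((\<lambda>x. ?T' m x) has_sum of_int c * P ?s) UNIV \<longleftrightarrow>
      ((\<lambda>k. of_int c / 2 * (euler ?f k * gg (?s - k) - ?f k * euler gg (?s - k) - of_int c * (?f k * gg (?s - k)))) has_sum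
        of_int c * P ?s) UNIV"
      by (rule has_sum_reindex_bij_witness[where i = "\<lambda>k. k + m - 1" and j = "\<lambda>x. x + 1 - m"])
         (auto simp: algebra_simps)
    with h show ?thesis unfolding eq by blast
  qed
  have hS: "((\<lambda>(m, x). ?T m x) has_sum infsum (\<lambda>(m, x). ?T m x) (?M \<times> UNIV)) (?M \<times> UNIV)"
    using S by (rule has_sum_infsum)
  have "((\<lambda>m. of_int c * P (1 - 2 * m - c)) has_sum infsum (\<lambda>(m, x). ?T m x) (?M \<times> UNIV)) ?M"
    by (rule has_sum_SigmaD[OF hS]) (use inner in simp)
  then have val: "infsum (\<lambda>(m, x). ?T m x) (?M \<times> UNIV) = (\<Sum>\<^sub>\<infinity>m\<in>?M. of_int c * P (1 - 2 * m - c))"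
    by (rule infsumI[symmetric])
  have S2: "((\<lambda>(x, m). ?T m x) has_sum infsum (\<lambda>(m, x). ?T m x) (?M \<times> UNIV)) (UNIV \<times> ?M)"
    using hS has_sum_swap[of "\<lambda>(m, x). ?T m x"] by simp
  have "((\<lambda>x. (of_int x + 1/2) * rho c x) has_sum infsum (\<lambda>(m, x). ?T m x) (?M \<times> UNIV)) UNIV"
  proof (rule has_sum_SigmaD[OF S2])
    fix x :: int
    have "(\<lambda>m. of_int c * (?f (x + 1 - m) * gg (- x - m - c))) summable_on ?M"
    proof (rule summable_on_cmult_right)
      have "(\<lambda>(x, m). ?f (x + 1 - m) * gg (- x - m - c)) summable_on UNIV \<times> ?M"
        using negative_diagonal_summable[OF ff_at c] summable_on_swap[of "\<lambda>(m, x). ?f (x + 1 - m) * gg (- x - m - c)" ?M UNIV]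
        by simp
      from summable_on_SigmaD1[OF this, of x]
      show "(\<lambda>m. ?f (x + 1 - m) * gg (- x - m - c)) summable_on ?M" by simp
    qed
    then have "((\<lambda>m. of_int c * (?f (x + 1 - m) * gg (- x - m - c))) has_sum rho c x) ?M"
      unfolding rho_def by (rule has_sum_infsum)
    from has_sum_cmult_right[OF this, of "of_int x + 1/2"]
    show "((\<lambda>m. case (x, m) of (x, m) \<Rightarrow> ?T m x) has_sum (of_int x + 1/2) * rho c x) ?M" by simp
  qed
  then show ?thesis by (simp only: val)
qed

lemma corr_kernel_diagonal:
  assumes c: "c = 1 \<or> c = -1"
  shows "corr_kernel c A E x x = infsum hg {x + 1..} + rho c x"
proof -
  let ?M = "{m::int. m \<ge> 1 \<and> m \<ge> 1 - c}"
  let ?t = "\<lambda>m. uu c gg x m * ff A E (x + 1 - m)"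
  have S: "?t summable_on UNIV" by (rule conv_summable[OF q_pos wl_U[OF c] ff_at(1)])
  have S1: "?t summable_on {..0}" "?t summable_on {1..}"
    by (rule summable_on_subset_banach[OF S], simp)+
  have "corr_kernel c A E x x = infsum ?t ({..0} \<union> {1..})"
  proof -
    have "({..0} \<union> {1..} :: int set) = UNIV" by auto
    then show ?thesis by (simp add: corr_kernel_def conv_def)
  qed
  also have "\<dots> = infsum ?t {..0} + infsum ?t {1..}"
    by (rule infsum_Un_disjoint[OF S1]) auto
  also have "infsum ?t {..0} = infsum hg {x + 1..}"
    by (rule infsum_reindex_bij_witness[where i = "\<lambda>n. x + 1 - n" and j = "\<lambda>m. x + 1 - m"])
       (auto simp: uu_def hg_def algebra_simps)
  also have "infsum ?t {1..} = rho c x"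
    unfolding rho_def by (rule infsum_cong_neutral) (auto simp: uu_def)
  finally show ?thesis .
qed

text \<open>The mean size per unit of total mass; along the scaling it becomes t d/dt of the
  logarithm of the normalization constant.\<close>

definition log_energy :: "int \<Rightarrow> complex" where
  "log_energy c = conv P P 0 / 2 + (\<Sum>\<^sub>\<infinity>m\<in>{m. m \<ge> 1 \<and> m \<ge> 1 - c}. of_int c * P (1 - 2 * m - c))"

text \<open>For x < 0 both the absolute value and the passage to holes flip the sign of
  \<open>rho\<close>, so its contribution is (x + 1/2) \<open>rho\<close> on both
  half-lines.\<close>

lemma diagonal_energy:
  assumes c: "c = 1 \<or> c = -1"
  shows "((\<lambda>x. of_real \<bar>real_of_int x + 1/2\<bar> * (if x \<ge> 0 then corr_kernel c A E x x else 1 - corr_kernel c A E x x))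
     has_sum log_energy c) UNIV"
proof -
  have e: "of_real \<bar>real_of_int x + 1/2\<bar> * (if x \<ge> 0 then corr_kernel c A E x x else 1 - corr_kernel c A E x x)
     = of_real \<bar>real_of_int x + 1/2\<bar> * kap x + (of_int x + 1/2) * rho c x" for x
  proof (cases "x \<ge> 0")
    case True
    then have "\<bar>real_of_int x + 1/2\<bar> = real_of_int x + 1/2" by simp
    then show ?thesis using True by (simp add: corr_kernel_diagonal[OF c] kap_def distrib_left)
  next
    case False
    have "{x + 1..} \<union> {..x} = UNIV" by auto
    moreover have "hg summable_on {x + 1..}" "hg summable_on {..x}"
      by (rule summable_on_subset_banach[OF has_sum_imp_summable[OF hg_has_sum]], simp)+
    moreover have "{x + 1..} \<inter> {..x} = {}" by auto
    ultimately have "1 = infsum hg {x + 1..} + infsum hg {..x}"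
      using infsum_Un_disjoint[of hg "{x + 1..}" "{..x}"] infsumI[OF hg_has_sum] by auto
    then have h: "1 - corr_kernel c A E x x = kap x - rho c x"
      using False by (simp add: corr_kernel_diagonal[OF c] kap_def algebra_simps)
    have a: "\<bar>real_of_int x + 1/2\<bar> = - (real_of_int x + 1/2)" using False by simp
    show ?thesis unfolding a if_not_P[OF False] h by (simp add: algebra_simps)
  qed
  show ?thesis
    unfolding e log_energy_def by (intro has_sum_add kap_has_sum rho_has_sum c)
qed

text \<open>The size of a partition is the sum of \<open>\<bar>x + 1/2\<bar>\<close> over the points in which its configuration differs from that
  of the empty partition, so its mean is determined by the one-point function.\<close>
lemma size_weight_has_sum:
  assumes c: "c = 1 \<or> c = -1"
    and S: "(\<lambda>l. of_nat (sum_list l) * jt_weight c A E l) summable_on partitions"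
  shows "((\<lambda>l. of_nat (sum_list l) * jt_weight c A E l) has_sum
     infsum (jt_weight c A E) partitions * log_energy c) partitions"
proof -
  let ?w = "jt_weight c A E" and ?W = "infsum (jt_weight c A E) partitions"
  let ?h = "\<lambda>x. \<bar>real_of_int x + 1/2\<bar>"
  let ?T = "\<lambda>l x. of_real (?h x) * ?w l"
  let ?tot = "\<Sum>\<^sub>\<infinity>l\<in>partitions. of_nat (sum_list l) * ?w l"
  have sw: "?w summable_on partitions" by (rule jt_weight_summable[OF c])
  have inner: "((\<lambda>x. ?T l x) has_sum of_nat (sum_list l) * ?w l) (flipped l)" if "l \<in> partitions" for l
  proof (rule has_sum_finiteI)
    have "(\<Sum>x\<in>flipped l. ?T l x) = of_real (\<Sum>x\<in>flipped l. ?h x) * ?w l"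
      by (simp only: sum_distrib_right of_real_sum)
    then show "of_nat (sum_list l) * ?w l = (\<Sum>x\<in>flipped l. ?T l x)"
      unfolding sum_list_eq_sum_flipped(2)[OF that] by simp
  qed (rule sum_list_eq_sum_flipped(1)[OF that])
  have "(\<lambda>(l, x). ?T l x) summable_on Sigma partitions flipped"
  proof (rule csum_normD, rule summable_on_SigmaI)
    show "((\<lambda>x. norm (case (l, x) of (l, x) \<Rightarrow> ?T l x)) has_sum norm (of_nat (sum_list l) * ?w l)) (flipped l)"
      if "l \<in> partitions" for l
    proof (rule has_sum_finiteI)
      have "(\<Sum>x\<in>flipped l. norm (?T l x)) = (\<Sum>x\<in>flipped l. ?h x) * norm (?w l)"
        unfolding sum_distrib_right by (simp add: norm_mult)
      then show "norm (of_nat (sum_list l) * ?w l) = (\<Sum>x\<in>flipped l. norm (case (l, x) of (l, x) \<Rightarrow> ?T l x))"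
        unfolding sum_list_eq_sum_flipped(2)[OF that] by (simp add: norm_mult)
    qed (rule sum_list_eq_sum_flipped(1)[OF that])
    show "(\<lambda>l. norm (of_nat (sum_list l) * ?w l)) summable_on partitions"
      by (rule csum_norm[OF S])
  qed auto
  then have S1: "((\<lambda>(l, x). ?T l x) has_sum ?tot) (Sigma partitions flipped)"
    by (intro has_sum_SigmaI[OF _ has_sum_infsum[OF S]]) (use inner in auto)
  let ?B = "\<lambda>x. {l \<in> partitions. (x \<in> shifted_set l) \<noteq> (x < 0)}"
  have "((\<lambda>(x, l). ?T l x) has_sum ?tot) (Sigma UNIV ?B) \<longleftrightarrow>
     ((\<lambda>(l, x). ?T l x) has_sum ?tot) (Sigma partitions flipped)"
    by (rule has_sum_reindex_bij_witness[where i = prod.swap and j = prod.swap]) (auto simp: flipped_def)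
  with S1 have S2: "((\<lambda>(x, l). ?T l x) has_sum ?tot) (Sigma UNIV ?B)" by blast
  have one: "detn (Suc 0) F = F 0 0" for F by (simp add: detn_Suc)
  have pt: "(?w has_sum ?W * corr_kernel c A E x x) {l \<in> partitions. x \<in> shifted_set l}" for x
    using jt_weight_correlation_limit[OF c, of "\<lambda>_. x" "Suc 0"] by (simp add: one lessThan_Suc)
  let ?K = "\<lambda>x. if x \<ge> 0 then corr_kernel c A E x x else 1 - corr_kernel c A E x x"
  have fib: "(?w has_sum ?W * ?K x) (?B x)" for x
  proof (cases "x \<ge> 0")
    case True
    then show ?thesis using pt[of x] by simp
  next
    case False
    let ?X = "{l \<in> partitions. x \<in> shifted_set l}"
    have B: "?B x = partitions - ?X" using False by auto
    have "?W = infsum ?w ?X + infsum ?w (partitions - ?X)"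
      using infsum_Un_disjoint[of ?w ?X "partitions - ?X"] summable_on_subset_banach[OF sw]
      by (simp add: Un_absorb1 Diff_subset Collect_subset Un_Diff_cancel)
    then have "infsum ?w (partitions - ?X) = ?W * ?K x"
      using infsumI[OF pt[of x]] False by (simp add: algebra_simps)
    moreover have "?w summable_on (partitions - ?X)"
      by (rule summable_on_subset_banach[OF sw]) auto
    ultimately show ?thesis unfolding B by (simp only: has_sum_iff)
  qed
  have "((\<lambda>x. of_real (?h x) * (?W * ?K x)) has_sum ?tot) UNIV"
    by (rule has_sum_SigmaD[OF S2]) (use has_sum_cmult_right[OF fib] in simp)
  moreover have "((\<lambda>x. ?W * (of_real (?h x) * ?K x)) has_sum ?W * log_energy c) UNIV"
    by (rule has_sum_cmult_right[OF diagonal_energy[OF c]])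
  then have "((\<lambda>x. of_real (?h x) * (?W * ?K x)) has_sum ?W * log_energy c) UNIV"
    by (simp only: mult_ac)
  ultimately have "?tot = ?W * log_energy c" by (rule has_sum_unique)
  then show ?thesis using S by (simp add: has_sum_iff)
qed

end

section \<open>The normalization constant\<close>

text \<open>The substitution z -> t z, which for a generating series H is p_k -> t^k p_k.\<close>

definition fps_scale :: "real \<Rightarrow> complex fps \<Rightarrow> complex fps" where
  "fps_scale t F = Abs_fps (\<lambda>n. of_real t ^ n * fps_nth F n)"

lemma fps_scale_nth [simp]: "fps_nth (fps_scale t F) n = of_real t ^ n * fps_nth F n"
  by (simp add: fps_scale_def)

lemma fps_scale_mult: "fps_scale t (F * G) = fps_scale t F * fps_scale t G"
proof (rule fps_ext)
  fix n
  have "of_real t ^ n * (fps_nth F i * fps_nth G (n - i)) =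
      (of_real t ^ i * fps_nth F i) * (of_real t ^ (n - i) * fps_nth G (n - i))" if "i \<in> {0..n}" for i
  proof -
    have "(of_real t :: complex) ^ n = of_real t ^ i * of_real t ^ (n - i)"
      using that by (simp flip: power_add)
    then show ?thesis by (simp only: mult_ac)
  qed
  then show "fps_nth (fps_scale t (F * G)) n = fps_nth (fps_scale t F * fps_scale t G) n"
    unfolding fps_scale_nth fps_mult_nth sum_distrib_left by (intro sum.cong refl) blast
qed

lemma fps_scale_inverse: "fps_nth F 0 = 1 \<Longrightarrow> inverse (fps_scale t F) = fps_scale t (inverse F)"
proof (rule fps_inverse_unique)
  assume F: "fps_nth F 0 = 1"
  have "fps_scale t 1 = 1" by (rule fps_ext) simp
  then show "fps_scale t F * fps_scale t (inverse F) = 1"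
    using inverse_mult_eq_1'[of F] F by (simp flip: fps_scale_mult)
qed

lemma fps_scale_euler: "fps_X * fps_deriv (fps_scale t F) = fps_scale t (fps_X * fps_deriv F)"
  by (rule fps_ext) (auto simp: mult_ac)

lemma wl_fps_scale:
  assumes "wl q (cf F)" "0 < q" "0 \<le> t" "t \<le> 1"
  shows "wl q (cf (fps_scale t F))"
proof -
  have s: "summable (\<lambda>k. norm (fps_nth F k) * q ^ k)" using assms wl_cf_iff by blast
  have "summable (\<lambda>k. norm (fps_nth (fps_scale t F) k) * q ^ k)"
  proof (rule summable_comparison_test'[OF s])
    fix n :: nat
    have "t ^ n * (norm (fps_nth F n) * q ^ n) \<le> 1 * (norm (fps_nth F n) * q ^ n)"
      using assms by (intro mult_right_mono power_le_one) auto
    then show "norm (norm (fps_nth (fps_scale t F) n) * q ^ n) \<le> norm (fps_nth F n) * q ^ n"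
      using assms by (simp add: norm_mult norm_power mult_ac)
  qed
  then show ?thesis using wl_cf_iff assms by blast
qed

text \<open>Every Leibniz term is homogeneous of degree |\<lambda>| under the scaling.\<close>

lemma jt_det_fps_scale:
  assumes t: "t > 0" and l: "l \<in> partitions"
  shows "jt_det (cf (fps_scale t B)) (\<lambda>_. 0) c l = of_real t ^ sum_list l * jt_det (cf B) (\<lambda>_. 0) c l"
proof -
  let ?n = "length l"
  have lN: "l \<in> parts_le ?n" using l by (simp add: parts_le_def)
  have e: "cf (fps_scale t B) k = of_real (t powi k) * cf B k" for k
    by (cases "k < 0") (auto simp: cf_def power_int_def)
  have pw: "(\<Prod>i<?n. t powi (part_pt l i + 1 + int (s i))) = t ^ sum_list l" if s: "s permutes {..<?n}" for s
  proof -
    have "(\<Prod>i<n. t powi (part_pt l i + 1 + int (s i))) = t powi (\<Sum>i<n. part_pt l i + 1 + int (s i))" for n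
      using t by (induction n) (simp_all add: power_int_add)
    moreover have "(\<Sum>i<?n. part_pt l i + 1 + int (s i)) = (\<Sum>i<?n. part_pt l i + 1) + (\<Sum>i<?n. int (s i))"
      by (rule sum.distrib)
    moreover have "(\<Sum>i<?n. int (s i)) = (\<Sum>i<?n. int i)"
      using sum.permute[OF s, of int] by (simp add: o_def)
    moreover have "(\<Sum>i<?n. part_pt l i + 1) + (\<Sum>i<?n. int i) = int (sum_list l)"
      unfolding sum.distrib[symmetric] using sum_part_pt[OF lN] by simp
    ultimately show ?thesis by simp
  qed
  show ?thesis
    unfolding jt_det_def jt_fun_zero detn_def sum_distrib_left
  proof (rule sum.cong[OF refl])
    fix s assume "s \<in> {s. s permutes {..<?n}}"
    then have s: "s permutes {..<?n}" by simp
    have "(\<Prod>i<?n. cf (fps_scale t B) (part_pt l i + 1 + int (s i))) =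
        of_real (t ^ sum_list l) * (\<Prod>i<?n. cf B (part_pt l i + 1 + int (s i)))"
      unfolding e prod.distrib of_real_prod[symmetric] pw[OF s] ..
    then show "of_int (sign s) * (\<Prod>i<?n. cf (fps_scale t B) (part_pt l i + 1 + int (s i))) =
        of_real t ^ sum_list l * (of_int (sign s) * (\<Prod>i<?n. cf B (part_pt l i + 1 + int (s i))))"
      by simp
  qed
qed

text \<open>Collecting the partitions of each size makes the total mass a power series in the
  scaling parameter.\<close>

lemma power_series_group:
  fixes w :: "nat list \<Rightarrow> complex"
  assumes K: "(\<lambda>l. norm (w l) * K ^ sum_list l) summable_on X" and z: "norm z \<le> K"
  shows "((\<lambda>l. z ^ sum_list l * w l) has_sum (\<Sum>n. infsum w {l \<in> X. sum_list l = n} * z ^ n)) X"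
    and "summable (\<lambda>n. infsum w {l \<in> X. sum_list l = n} * z ^ n)"
proof -
  let ?L = "\<lambda>n. {l \<in> X. sum_list l = n}"
  have S: "(\<lambda>l. z ^ sum_list l * w l) summable_on X"
    by (rule csum_comparison[OF K])
       (use z in \<open>auto simp: norm_mult norm_power mult.commute intro!: mult_left_mono power_mono\<close>)
  let ?F = "\<lambda>(n, l). z ^ sum_list l * w l"
  have "(?F has_sum infsum (\<lambda>l. z ^ sum_list l * w l) X) (Sigma UNIV ?L) \<longleftrightarrow>
    ((\<lambda>l. z ^ sum_list l * w l) has_sum infsum (\<lambda>l. z ^ sum_list l * w l) X) X"
    by (rule has_sum_reindex_bij_witness[where i = "\<lambda>l. (sum_list l, l)" and j = snd]) auto
  then have H: "(?F has_sum infsum (\<lambda>l. z ^ sum_list l * w l) X) (Sigma UNIV ?L)"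
    using has_sum_infsum[OF S] by blast
  have "((\<lambda>n. infsum w (?L n) * z ^ n) has_sum infsum (\<lambda>l. z ^ sum_list l * w l) X) UNIV"
  proof (rule has_sum_SigmaD[OF H])
    fix n
    have "(\<lambda>l. z ^ sum_list l * w l) summable_on ?L n" by (rule summable_on_subset_banach[OF S]) auto
    then have "((\<lambda>l. z ^ sum_list l * w l) has_sum infsum (\<lambda>l. z ^ sum_list l * w l) (?L n)) (?L n)"
      by (rule has_sum_infsum)
    moreover have "infsum (\<lambda>l. z ^ sum_list l * w l) (?L n) = infsum (\<lambda>l. z ^ n * w l) (?L n)"
      by (rule infsum_cong) auto
    then have "infsum (\<lambda>l. z ^ sum_list l * w l) (?L n) = infsum w (?L n) * z ^ n"
      by (simp only: infsum_cmult_left' mult.commute[of "z ^ n"])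
    ultimately show "((\<lambda>l. case (n, l) of (n, l) \<Rightarrow> z ^ sum_list l * w l) has_sum infsum w (?L n) * z ^ n) (?L n)"
      by (simp only: prod.case)
  qed
  from has_sum_imp_sums[OF this] have sums: "(\<lambda>n. infsum w (?L n) * z ^ n) sums infsum (\<lambda>l. z ^ sum_list l * w l) X" .
  then show "summable (\<lambda>n. infsum w (?L n) * z ^ n)" by (simp add: sums_iff)
  show "((\<lambda>l. z ^ sum_list l * w l) has_sum (\<Sum>n. infsum w (?L n) * z ^ n)) X"
    using has_sum_infsum[OF S] sums_unique[OF sums] by simp
qed

lemma power_series_deriv:
  fixes a :: "nat \<Rightarrow> complex"
  assumes K: "\<And>z. norm z \<le> K \<Longrightarrow> summable (\<lambda>n. a n * z ^ n)" and z: "norm z < K"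
  shows "\<exists>d. ((\<lambda>z. \<Sum>n. a n * z ^ n) has_field_derivative d) (at z) \<and> (\<lambda>n. of_nat n * a n * z ^ n) sums (z * d)"
proof -
  have K0: "K > 0" using z norm_ge_zero[of z] by linarith
  have nK: "norm (of_real K :: complex) = K" using K0 by simp
  have s: "summable (\<lambda>n. a n * of_real K ^ n)" using K[of "of_real K"] nK by simp
  have d: "((\<lambda>z. \<Sum>n. a n * z ^ n) has_field_derivative (\<Sum>n. diffs a n * z ^ n)) (at z)"
    by (rule termdiffs_strong[OF s]) (use z nK in simp)
  have "summable (\<lambda>n. diffs a n * z ^ n)"
    by (rule termdiff_converges[of z K]) (use z K in auto)
  from diffs_equiv[OF this] have "(\<lambda>n. of_nat n * a n * z ^ (n - Suc 0)) sums (\<Sum>n. diffs a n * z ^ n)" .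
  from sums_mult[OF this, of z] have "(\<lambda>n. of_nat n * a n * z ^ n) sums (z * (\<Sum>n. diffs a n * z ^ n))"
  proof (rule sums_cong[THEN iffD1, rotated])
    fix n
    show "z * (of_nat n * a n * z ^ (n - Suc 0)) = of_nat n * a n * z ^ n" by (cases n) auto
  qed
  with d show ?thesis by blast
qed

section \<open>The differential equation for the total mass\<close>

context log_series_pair
begin

lemma scaled_pair: "0 \<le> t \<Longrightarrow> t \<le> 1 \<Longrightarrow> log_series_pair q1 q2 A (fps_scale t E) PA (fps_scale t PE)"
proof unfold_locales
  assume t: "0 \<le> t" "t \<le> 1"
  show "wl (1 / q1) (cf (fps_scale t E))" "wl (1 / q1) (cf (inverse (fps_scale t E)))" "wl (1 / q1) (cf (fps_scale t PE))"
    unfolding fps_scale_inverse[OF E0] by (intro wl_fps_scale wlE wlP t; use q in simp)+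
  show "fps_X * fps_deriv (fps_scale t E) = fps_scale t PE * fps_scale t E"
    by (simp only: fps_scale_euler dE fps_scale_mult)
qed (use q A0 E0 wlA wlP dA in auto)

lemma PA_0: "fps_nth PA 0 = 0"
  using arg_cong[OF dA, of "\<lambda>F. fps_nth F 0"] A0 by simp

lemma P_eval: "P 0 = 0" "P (int (Suc n)) = fps_nth PA (Suc n) + fps_nth PE (Suc n)"
  "P (- int (Suc n)) = - fps_nth PE (Suc n)"
  unfolding P_def rev_seq_def minus_minus cf_of_nat using PA_0
  by (simp_all add: cf_def del: of_nat_Suc)

text \<open>The constant term of P^2 counts k and -k alike, which cancels the 1/2. The indices 1 -
  2m - c run through -2, -4, ... in both cases; \<open>?d\<close> is the first admissible m.\<close>

lemma log_energy_eq:
  assumes c: "c = 1 \<or> c = -1"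
  shows "log_energy c = (\<Sum>\<^sub>\<infinity>n. - (fps_nth PA (Suc n) + fps_nth PE (Suc n)) * fps_nth PE (Suc n))
     + (\<Sum>\<^sub>\<infinity>n. - of_int c * fps_nth PE (2 * Suc n))"
proof -
  let ?h = "\<lambda>k. P k * P (- k)"
  have S: "?h summable_on UNIV" using conv_summable[OF q_pos wl_P wl_P, of 0] by simp
  have S1: "?h summable_on {1..}" "?h summable_on {..0}" "?h summable_on {..-1}"
    by (rule summable_on_subset_banach[OF S], simp)+
  have "conv P P 0 = infsum ?h ({1..} \<union> {..0})"
  proof -
    have "({1..} \<union> {..0} :: int set) = UNIV" by auto
    then show ?thesis by (simp add: conv_def)
  qed
  also have "\<dots> = infsum ?h {1..} + infsum ?h {..0}"
    by (rule infsum_Un_disjoint[OF S1(1,2)]) auto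
  also have "infsum ?h {..0} = infsum ?h {..-1}"
  proof (rule infsum_cong_neutral)
    fix x :: int assume "x \<in> {..0} - {..-1}"
    then have "x = 0" by auto
    then show "?h x = 0" by (simp add: P_eval)
  qed auto
  also have "infsum ?h {..-1} = infsum ?h {1..}"
    by (rule infsum_reindex_bij_witness[where i = uminus and j = uminus]) (auto simp: mult.commute)
  also have "infsum ?h {1..} = (\<Sum>\<^sub>\<infinity>n. ?h (int (Suc n)))"
    by (rule infsum_reindex_bij_witness[where i = "\<lambda>n. int (Suc n)" and j = "\<lambda>k. nat k - 1"]) auto
  finally have cPP: "conv P P 0 = (\<Sum>\<^sub>\<infinity>n. ?h (int (Suc n))) + (\<Sum>\<^sub>\<infinity>n. ?h (int (Suc n)))" .
  have e: "?h (int (Suc n)) = - (fps_nth PA (Suc n) + fps_nth PE (Suc n)) * fps_nth PE (Suc n)" for n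
    unfolding P_eval by (simp add: algebra_simps)
  have 1: "conv P P 0 / 2 = (\<Sum>\<^sub>\<infinity>n. - (fps_nth PA (Suc n) + fps_nth PE (Suc n)) * fps_nth PE (Suc n))"
    unfolding cPP e by simp
  let ?M = "{m::int. m \<ge> 1 \<and> m \<ge> 1 - c}"
  let ?d = "if c = 1 then 1 else 2 :: int"
  have "(\<Sum>\<^sub>\<infinity>m\<in>?M. of_int c * P (1 - 2 * m - c)) = (\<Sum>\<^sub>\<infinity>n. of_int c * P (- int (Suc (2 * n + 1))))"
    by (rule infsum_reindex_bij_witness[where i = "\<lambda>n. int n + ?d" and j = "\<lambda>m. nat (m - ?d)"])
       (use c in \<open>auto intro!: arg_cong[where f = P]\<close>)
  also have "\<dots> = (\<Sum>\<^sub>\<infinity>n. - of_int c * fps_nth PE (2 * Suc n))"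
    unfolding P_eval by simp
  finally show ?thesis unfolding log_energy_def 1 by simp
qed

text \<open>For the specializations \<open>uc k\<close> is p_k(rho+) p_k(rho-), and
  \<open>vc c k\<close> below is c p_2k(rho-) - p_k(rho-)^2. They are kept apart because they scale
  like t^k and t^(2k).\<close>

definition uc :: "nat \<Rightarrow> complex" where "uc k = - fps_nth PA k * fps_nth PE k"

definition vc :: "int \<Rightarrow> nat \<Rightarrow> complex" where
  "vc c k = - ((fps_nth PE k)^2) - of_int c * fps_nth PE (2 * k)"

text \<open>\<open>uc\<close> decays like (q1/q2)^n and \<open>vc\<close> like q1^(2n), so
  \<open>K * q1 < q2\<close> leaves room for radii K above 1.\<close>

lemma uc_vc_summable:
  assumes K: "0 < K" "K * q1 < q2" and z: "norm z \<le> K" and c: "c = 1 \<or> c = -1"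
  shows "summable (\<lambda>n. norm (uc n * z ^ n))" "summable (\<lambda>n. norm ((fps_nth PE n)^2 * z ^ n))"
    "summable (\<lambda>n. norm (fps_nth PE (2 * n) * z ^ n))" "summable (\<lambda>n. norm (vc c n * z ^ n))"
proof -
  define C1 where "C1 = nl q2 (cf PA)"
  define C2 where "C2 = nl (1 / q1) (cf PE)"
  have C0: "C1 \<ge> 0" "C2 \<ge> 0" by (simp_all add: C1_def C2_def nl_nonneg)
  have PA: "norm (fps_nth PA n) * q2 ^ n \<le> C1" for n
    using norm_le_nl[OF wlP(1) q_pos, of "int n"] by (simp add: C1_def)
  have PE: "norm (fps_nth PE n) \<le> C2 * q1 ^ n" for n
    using norm_le_nl[OF wlP(2), of "int n"] q by (simp add: C2_def power_one_over field_simps)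
  have zK: "norm z ^ n \<le> K ^ n" for n using z by (intro power_mono) auto
  have Kq: "K * q1 ^ 2 < 1"
  proof -
    have "K * q1 ^ 2 = (K * q1) * q1" by (simp add: power2_eq_square)
    also have "\<dots> < q2 * q1" using K q by (intro mult_strict_right_mono) auto
    also have "\<dots> < 1 * 1" using q by (intro mult_strict_mono) auto
    finally show ?thesis by simp
  qed
  have g: "summable (\<lambda>n. C * r ^ n)" if "0 \<le> r" "r < 1" for C r :: real
    using that by (intro summable_mult summable_geometric) auto
  have r1: "0 \<le> K * q1 / q2" "K * q1 / q2 < 1" using K q by auto
  have r2: "0 \<le> K * q1 ^ 2" using K q by auto
  show "summable (\<lambda>n. norm (uc n * z ^ n))"
  proof (rule summable_comparison_test'[OF g[OF r1, of "C1 * C2"]])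
    fix n
    have "norm (fps_nth PA n) * q2 ^ n * (norm (fps_nth PE n) * norm z ^ n) \<le> C1 * (C2 * q1 ^ n * K ^ n)"
      using q K C0 by (intro mult_mono PA PE zK) auto
    then have "norm (fps_nth PA n) * (norm (fps_nth PE n) * norm z ^ n) \<le> C1 * (C2 * q1 ^ n * K ^ n) / q2 ^ n"
      using q by (simp add: pos_le_divide_eq mult_ac)
    then show "norm (norm (uc n * z ^ n)) \<le> C1 * C2 * (K * q1 / q2) ^ n"
      by (simp add: uc_def norm_mult norm_power power_divide power_mult_distrib mult_ac)
  qed
  show a: "summable (\<lambda>n. norm ((fps_nth PE n)^2 * z ^ n))"
  proof (rule summable_comparison_test'[OF g[OF r2 Kq, of "C2 ^ 2"]])
    fix n
    have "norm (fps_nth PE n) ^ 2 * norm z ^ n \<le> (C2 * q1 ^ n) ^ 2 * K ^ n"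
      using q K C0 by (intro mult_mono power_mono PE zK) auto
    then show "norm (norm ((fps_nth PE n)^2 * z ^ n)) \<le> C2 ^ 2 * (K * q1 ^ 2) ^ n"
      by (simp add: norm_mult norm_power power_mult_distrib mult_ac flip: power_mult)
  qed
  show b: "summable (\<lambda>n. norm (fps_nth PE (2 * n) * z ^ n))"
  proof (rule summable_comparison_test'[OF g[OF r2 Kq, of "C2"]])
    fix n
    have "norm (fps_nth PE (2 * n)) * norm z ^ n \<le> C2 * q1 ^ (2 * n) * K ^ n"
      using q K C0 by (intro mult_mono PE zK) auto
    then show "norm (norm (fps_nth PE (2 * n) * z ^ n)) \<le> C2 * (K * q1 ^ 2) ^ n"
      by (simp add: norm_mult norm_power power_mult_distrib mult_ac flip: power_mult)
  qed
  show "summable (\<lambda>n. norm (vc c n * z ^ n))"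
  proof (rule summable_comparison_test'[OF summable_add[OF a b]])
    fix n
    have "norm (vc c n * z ^ n) \<le> norm ((fps_nth PE n)^2 * z ^ n) + norm (of_int c * fps_nth PE (2 * n) * z ^ n)"
      unfolding vc_def using norm_triangle_ineq4[of "- ((fps_nth PE n)^2 * z ^ n)" "of_int c * fps_nth PE (2 * n) * z ^ n"]
      by (simp add: algebra_simps)
    then show "norm (norm (vc c n * z ^ n)) \<le> norm ((fps_nth PE n)^2 * z ^ n) + norm (fps_nth PE (2 * n) * z ^ n)"
      using c by (auto simp: norm_mult)
  qed
qed

lemma scaled_log_energy:
  assumes t: "0 \<le> t" "t \<le> 1" and c: "c = 1 \<or> c = -1"
  shows "log_series_pair.log_energy PA (fps_scale t PE) c =
    (\<Sum>n. uc (Suc n) * of_real t ^ Suc n) + (\<Sum>n. vc c (Suc n) * (of_real t ^ 2) ^ Suc n)"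
proof -
  interpret L: log_series_pair q1 q2 A "fps_scale t E" PA "fps_scale t PE" by (rule scaled_pair[OF t])
  let ?z = "complex_of_real t"
  have z: "norm ?z \<le> 1" "norm (?z ^ 2) \<le> 1" using t by (auto simp: norm_power power_le_one)
  have K: "0 < (1 :: real)" "1 * q1 < q2" using q by auto
  note S1 = uc_vc_summable[OF K z(1) c] and S2 = uc_vc_summable[OF K z(2) c]
  have su: "(\<lambda>n. f (Suc n)) summable_on UNIV" "infsum (\<lambda>n. f (Suc n)) UNIV = (\<Sum>n. f (Suc n))"
    if "summable (\<lambda>n. norm (f n))" for f :: "nat \<Rightarrow> complex"
  proof -
    have a: "summable (\<lambda>n. norm (f (Suc n)))" using that by (subst summable_Suc_iff)
    show "(\<lambda>n. f (Suc n)) summable_on UNIV" by (rule norm_summable_imp_summable_on[OF a])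
    then show "infsum (\<lambda>n. f (Suc n)) UNIV = (\<Sum>n. f (Suc n))"
      using has_sum_imp_sums[OF has_sum_infsum] sums_unique by blast
  qed
  note u = su[OF S1(1)] and a = su[OF S2(2)] and b = su[OF S2(3)] and v = su[OF S2(4)]
  have "- (fps_nth PA (Suc n) + fps_nth (fps_scale t PE) (Suc n)) * fps_nth (fps_scale t PE) (Suc n) =
      uc (Suc n) * ?z ^ Suc n - (fps_nth PE (Suc n))^2 * (?z ^ 2) ^ Suc n" for n
    by (simp add: uc_def power2_eq_square power_mult_distrib algebra_simps)
  then have "(\<Sum>\<^sub>\<infinity>n. - (fps_nth PA (Suc n) + fps_nth (fps_scale t PE) (Suc n)) * fps_nth (fps_scale t PE) (Suc n)) =
     infsum (\<lambda>n. uc (Suc n) * ?z ^ Suc n) UNIV - infsum (\<lambda>n. (fps_nth PE (Suc n))^2 * (?z ^ 2) ^ Suc n) UNIV"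
    using infsumI[OF csum_diff[OF has_sum_infsum[OF u(1)] has_sum_infsum[OF a(1)]]] by (simp only:)
  moreover have "- of_int c * fps_nth (fps_scale t PE) (2 * Suc n) = - of_int c * (fps_nth PE (2 * Suc n) * (?z ^ 2) ^ Suc n)" for n
  proof -
    have pm: "?z ^ (2 * Suc n) = (?z ^ 2) ^ Suc n" by (rule power_mult)
    show ?thesis unfolding fps_scale_nth pm by (simp only: mult_ac)
  qed
  then have "(\<Sum>\<^sub>\<infinity>n. - of_int c * fps_nth (fps_scale t PE) (2 * Suc n)) =
     - of_int c * infsum (\<lambda>n. fps_nth PE (2 * Suc n) * (?z ^ 2) ^ Suc n) UNIV"
    by (simp only: infsum_cmult_right')
  moreover have "infsum (\<lambda>n. vc c (Suc n) * (?z ^ 2) ^ Suc n) UNIV =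
     - infsum (\<lambda>n. (fps_nth PE (Suc n))^2 * (?z ^ 2) ^ Suc n) UNIV
     - of_int c * infsum (\<lambda>n. fps_nth PE (2 * Suc n) * (?z ^ 2) ^ Suc n) UNIV"
  proof -
    have e: "vc c (Suc n) * (?z ^ 2) ^ Suc n =
       (-1) * ((fps_nth PE (Suc n))^2 * (?z ^ 2) ^ Suc n) - of_int c * (fps_nth PE (2 * Suc n) * (?z ^ 2) ^ Suc n)" for n
      by (simp add: vc_def algebra_simps)
    show ?thesis
      unfolding e
      using infsumI[OF csum_diff[OF has_sum_cmult_right[OF has_sum_infsum[OF a(1)], of "-1"] has_sum_cmult_right[OF has_sum_infsum[OF b(1)], of "of_int c"]]]
      by simp
  qed
  ultimately show ?thesis
    unfolding L.log_energy_eq[OF c] u(2)[symmetric] v(2)[symmetric] by simp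
qed

text \<open>A radius above 1 makes the power series differentiable at t = 1 itself and dominates the
  weights multiplied by |\<lambda>|.\<close>

lemma jt_weight_geometric_summable:
  assumes c: "c = 1 \<or> c = -1"
  obtains K where "K > 1" "K * q1 < q2" "(\<lambda>l. norm (jt_weight c A E l) * K ^ sum_list l) summable_on partitions"
proof -
  define r where "r = (q1 + q2) / 2"
  define s where "s = (r + q2) / 2"
  have "q1 < r" "r < q2" using q by (auto simp: r_def)
  moreover from this have "r < s" "s < q2" by (auto simp: s_def)
  ultimately have r: "q1 < r" "r < s" "s < q2" "0 < r" "0 < s" using q by linarith+
  \<comment> \<open>Any K strictly between 1 and q2/r would do; r < s < q2 makes q2/s one.\<close>
  define K where "K = q2 / s"
  have K: "K > 1" using r by (simp add: K_def)
  have Kr: "K * r < q2" using r q_pos by (simp add: K_def field_simps)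
  have Kq: "K * q1 < q2" using r q_pos by (simp add: K_def field_simps)
  let ?C = "exp (nl (1 / q1) (cf (inverse E)) * nl (1 / q1) (cf E) / (1 - q1 / r)^2)"
  have "(\<lambda>l. ?C * (norm (jt_det (cf A) (tau c) c l) * (K * r) ^ sum_list l)) summable_on partitions"
    by (rule summable_on_cmult_right, rule jt_phi_summable) (use Kr K r c in auto)
  then have "(\<lambda>l. norm (jt_weight c A E l) * K ^ sum_list l) summable_on partitions"
  proof (rule summable_on_comparison_test)
    fix l assume l: "l \<in> partitions"
    show "norm (jt_weight c A E l) * K ^ sum_list l \<le> ?C * (norm (jt_det (cf A) (tau c) c l) * (K * r) ^ sum_list l)"
      using mult_right_mono[OF jt_weight_bound[OF r(1) l, of c], of "K ^ sum_list l"] K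
      by (simp add: power_mult_distrib mult_ac)
  qed (use K in auto)
  then show thesis using that[OF K Kq] by blast
qed

text \<open>Along the scaling \<open>p k \<mapsto> t ^ k * p k\<close> of the second specialization the total mass and the exponential
  satisfy the same first-order linear differential equation.\<close>
theorem total_weight:
  assumes c: "c = 1 \<or> c = -1"
  shows "infsum (jt_weight c A E) partitions =
    exp ((\<Sum>n. uc (Suc n) / of_nat (Suc n)) + (\<Sum>n. vc c (Suc n) / of_nat (Suc n)) / 2)"
proof -
  let ?w = "jt_weight c A E"
  obtain K where K: "K > 1" "K * q1 < q2" and SK: "(\<lambda>l. norm (?w l) * K ^ sum_list l) summable_on partitions"
    using jt_weight_geometric_summable[OF c] .
  define a where "a n = infsum ?w {l \<in> partitions. sum_list l = n}" for n
  define F where "F z = (\<Sum>n. a n * z ^ n)" for z :: complex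
  have F_sum: "((\<lambda>l. z ^ sum_list l * ?w l) has_sum F z) partitions" and a_s: "summable (\<lambda>n. a n * z ^ n)"
    if "norm z \<le> K" for z
    using power_series_group[OF SK that] by (simp_all add: F_def a_def)
  define cu where "cu n = (if n = 0 then 0 else uc n / of_nat n)" for n
  define cv where "cv n = (if n = 0 then 0 else vc c n / of_nat n)" for n
  have div: "norm (x / of_nat n) \<le> norm x" for x :: complex and n
  proof (cases "n = 0")
    case False
    then have "norm x / real n \<le> norm x / 1" by (intro divide_left_mono) auto
    then show ?thesis by (simp add: norm_divide)
  qed simp
  have cu_s: "summable (\<lambda>n. cu n * z ^ n)" if "norm z \<le> K" for z
  proof (rule summable_comparison_test'[OF uc_vc_summable(1)[OF _ K(2) that c]])
    show "norm (cu n * z ^ n) \<le> norm (uc n * z ^ n)" for n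
      using div[of "uc n" n] by (auto simp: cu_def norm_mult simp del: norm_divide intro!: mult_right_mono)
  qed (use K in auto)
  have cv_s: "summable (\<lambda>n. cv n * z ^ n)" if "norm z \<le> K" for z
  proof (rule summable_comparison_test'[OF uc_vc_summable(4)[OF _ K(2) that c]])
    show "norm (cv n * z ^ n) \<le> norm (vc c n * z ^ n)" for n
      using div[of "vc c n" n] by (auto simp: cv_def norm_mult simp del: norm_divide intro!: mult_right_mono)
  qed (use K in auto)
  define Gu where "Gu z = (\<Sum>n. cu n * z ^ n)" for z
  define Gv where "Gv z = (\<Sum>n. cv n * z ^ n)" for z
  \<comment> \<open>Total mass divided by the claimed constant, as functions of the scaling
    parameter. Terms of order t^(2k) integrate to t^(2k)/(2k), hence the argument z^2 and the factor
    1/2.\<close>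
  define H where "H z = F z * exp (- (Gu z + Gv (z ^ 2) / 2))" for z
  \<comment> \<open>The mean size yields t times the derivative, so vanishing is obtained for t > 0;
    at t = 0 continuity takes over.\<close>
  have H_deriv: "\<exists>d. (H has_field_derivative d) (at (of_real t)) \<and> (0 < t \<longrightarrow> d = 0)"
    if t: "0 \<le> t" "t \<le> 1" for t
  proof -
    let ?z = "complex_of_real t"
    have z: "norm ?z < K" "norm (?z ^ 2) < K"
      using t K by (auto simp: norm_power intro: order.strict_trans1[OF power_le_one])
    obtain dF where dF: "(F has_field_derivative dF) (at ?z)" "(\<lambda>n. of_nat n * a n * ?z ^ n) sums (?z * dF)"
      using power_series_deriv[OF a_s z(1)] unfolding F_def[abs_def] by blast
    obtain du where du: "(Gu has_field_derivative du) (at ?z)" "(\<lambda>n. of_nat n * cu n * ?z ^ n) sums (?z * du)"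
      using power_series_deriv[OF cu_s z(1)] unfolding Gu_def[abs_def] by blast
    obtain dv where dv: "(Gv has_field_derivative dv) (at (?z ^ 2))" "(\<lambda>n. of_nat n * cv n * (?z ^ 2) ^ n) sums (?z ^ 2 * dv)"
      using power_series_deriv[OF cv_s z(2)] unfolding Gv_def[abs_def] by blast
    have dv': "((\<lambda>z. Gv (z ^ 2)) has_field_derivative (dv * (2 * ?z))) (at ?z)"
      by (rule DERIV_chain2[where g = "\<lambda>z. z ^ 2", OF dv(1)]) (auto intro!: derivative_eq_intros)
    let ?e = "exp (- (Gu ?z + Gv (?z ^ 2) / 2))"
    have dH: "(H has_field_derivative (dF - F ?z * (du + dv * ?z)) * ?e) (at ?z)"
      unfolding H_def[abs_def]
      by (rule derivative_eq_intros dF du dv' refl | simp add: algebra_simps)+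
    have "dF - F ?z * (du + dv * ?z) = 0" if t0: "0 < t"
    proof -
      interpret L: log_series_pair q1 q2 A "fps_scale t E" PA "fps_scale t PE" by (rule scaled_pair[OF t])
      have wt: "jt_weight c A (fps_scale t E) l = ?z ^ sum_list l * ?w l" if "l \<in> partitions" for l
        unfolding jt_weight_def fps_scale_inverse[OF E0] jt_det_fps_scale[OF t0 that] by (simp only: mult_ac)
      have tot: "infsum (jt_weight c A (fps_scale t E)) partitions = F ?z"
        using infsumI[OF F_sum[of ?z]] z(1) infsum_cong[of partitions, OF wt] by simp
      have gr: "of_nat (sum_list l) * (?z ^ sum_list l * ?w l) = ?z ^ sum_list l * (of_nat (sum_list l) * ?w l)" for l
        by (simp only: mult_ac)
      have nK: "(\<lambda>l. norm (of_nat (sum_list l) * ?w l) * 1 ^ sum_list l) summable_on partitions"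
      proof (rule summable_on_comparison_test[OF summable_on_cmult_right[OF SK, of "1 / (K - 1)"]])
        fix l
        \<comment> \<open>The Bernoulli inequality bounds the size n by K^n/(K - 1), so the first
          moment is covered by the geometric weight.\<close>
        have "1 + real (sum_list l) * (K - 1) \<le> (1 + (K - 1)) ^ sum_list l"
          by (rule Bernoulli_inequality) (use K in auto)
        then have "real (sum_list l) * (K - 1) \<le> K ^ sum_list l" by simp
        then have "real (sum_list l) \<le> 1 / (K - 1) * K ^ sum_list l"
          using K by (simp add: pos_le_divide_eq)
        from mult_right_mono[OF this, of "norm (?w l)"]
        show "norm (of_nat (sum_list l) * ?w l) * 1 ^ sum_list l \<le> 1 / (K - 1) * (norm (?w l) * K ^ sum_list l)"
          by (simp add: norm_mult mult_ac)
      qed auto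
      have z1: "norm ?z \<le> 1" using t by simp
      have mom: "((\<lambda>l. ?z ^ sum_list l * (of_nat (sum_list l) * ?w l)) has_sum (?z * dF)) partitions"
      proof -
        have "infsum (\<lambda>l. of_nat (sum_list l) * ?w l) {l \<in> partitions. sum_list l = n} = of_nat n * a n" for n
        proof -
          have "infsum (\<lambda>l. of_nat (sum_list l) * ?w l) {l \<in> partitions. sum_list l = n} =
             infsum (\<lambda>l. of_nat n * ?w l) {l \<in> partitions. sum_list l = n}"
            by (rule infsum_cong) auto
          then show ?thesis by (simp only: infsum_cmult_right' a_def)
        qed
        then have "((\<lambda>l. ?z ^ sum_list l * (of_nat (sum_list l) * ?w l)) has_sum (\<Sum>n. of_nat n * a n * ?z ^ n)) partitions"
          using power_series_group(1)[OF nK z1] by (simp only:)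
        then show ?thesis using sums_unique[OF dF(2)] by simp
      qed
      have ms: "(\<lambda>l. of_nat (sum_list l) * jt_weight c A (fps_scale t E) l) summable_on partitions"
        using has_sum_imp_summable[OF mom]
        by (rule summable_on_cong[THEN iffD1, rotated]) (simp add: wt gr)
      have "((\<lambda>l. of_nat (sum_list l) * jt_weight c A (fps_scale t E) l) has_sum (?z * dF)) partitions"
        by (rule has_sum_cong[THEN iffD1, OF _ mom]) (simp add: wt gr)
      from has_sum_unique[OF this L.size_weight_has_sum[OF c ms]]
      have 1: "?z * dF = F ?z * ((\<Sum>n. uc (Suc n) * ?z ^ Suc n) + (\<Sum>n. vc c (Suc n) * (?z ^ 2) ^ Suc n))"
        unfolding tot scaled_log_energy[OF t c] .
      have shift: "(\<Sum>n. f (Suc n)) = s" if "f sums s" "f 0 = 0" for f :: "nat \<Rightarrow> complex" and s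
        using that sums_Suc_iff[of f s] by (simp add: sums_iff)
      have cuc: "of_nat (Suc n) * cu (Suc n) = uc (Suc n)" "of_nat (Suc n) * cv (Suc n) = vc c (Suc n)" for n
        by (simp_all add: cu_def cv_def del: of_nat_Suc)
      have 2: "(\<Sum>n. uc (Suc n) * ?z ^ Suc n) = ?z * du"
        using shift[OF du(2)] by (simp add: cuc del: of_nat_Suc)
      have 3: "(\<Sum>n. vc c (Suc n) * (?z ^ 2) ^ Suc n) = ?z ^ 2 * dv"
        using shift[OF dv(2)] by (simp add: cuc del: of_nat_Suc)
      have "?z * (dF - F ?z * (du + dv * ?z)) = ?z * dF - F ?z * (?z * du + ?z ^ 2 * dv)"
        by (simp add: algebra_simps power2_eq_square)
      also have "\<dots> = 0" unfolding 1 2 3 by simp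
      finally show ?thesis using t0 by simp
    qed
    with dH show ?thesis by fastforce
  qed
  have "H (of_real 1) = H (of_real 0)"
  proof (rule has_derivative_zero_unique_strong_interval[of "{0}" 0 1 "\<lambda>t. H (of_real t)" "H (of_real 0)" 1])
    show "continuous_on {0..1} (\<lambda>t. H (of_real t))"
    proof (rule continuous_at_imp_continuous_on, rule ballI)
      fix t :: real assume "t \<in> {0..1}"
      then obtain d where "(H has_field_derivative d) (at (of_real t))" using H_deriv[of t] by auto
      from has_vector_derivative_real_field[OF this, of UNIV]
      show "isCont (\<lambda>t. H (of_real t)) t"
        using has_vector_derivative_continuous by blast
    qed
    fix t :: real assume t: "t \<in> {0..1} - {0}"
    then have "(H has_field_derivative 0) (at (of_real t))" using H_deriv[of t] by auto
    from has_vector_derivative_real_field[OF this, of "{0..1}"]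
    show "((\<lambda>t. H (of_real t)) has_derivative (\<lambda>h. 0)) (at t within {0..1})"
      by (simp add: has_vector_derivative_def)
  qed auto
  then have H1: "H 1 = H 0" by simp
  have "a 0 = 1"
  proof -
    have "{l \<in> partitions. sum_list l = 0} = {[]}"
      by (auto simp: partitions_def) (metis list.set_intros(1) not_gr0 neq_Nil_conv)
    then show ?thesis by (simp add: a_def jt_weight_def jt_det_def)
  qed
  moreover have "F 0 = a 0" unfolding F_def by (simp add: powser_zero)
  moreover have "Gu 0 = 0" "Gv 0 = 0" unfolding Gu_def Gv_def by (simp_all add: powser_zero cu_def cv_def)
  ultimately have "H 0 = 1" by (simp add: H_def)
  with H1 have "F 1 * exp (- (Gu 1 + Gv 1 / 2)) = 1" by (simp add: H_def)
  then have "F 1 = exp (Gu 1 + Gv 1 / 2)" by (simp add: exp_minus field_simps)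
  moreover have "F 1 = infsum ?w partitions" using infsumI[OF F_sum[of 1]] K by simp
  moreover have "Gu 1 = (\<Sum>n. uc (Suc n) / of_nat (Suc n))"
    using suminf_split_head[OF cu_s[of 1]] K by (simp add: Gu_def cu_def)
  moreover have "Gv 1 = (\<Sum>n. vc c (Suc n) / of_nat (Suc n))"
    using suminf_split_head[OF cv_s[of 1]] K by (simp add: Gv_def cv_def)
  ultimately show ?thesis by simp
qed

end

section \<open>Laurent series and contour integrals\<close>

lemma conv_has_sum:
  fixes f g :: "int \<Rightarrow> complex"
  assumes "f summable_on UNIV" "g summable_on UNIV"
  shows "(conv f g has_sum (infsum f UNIV * infsum g UNIV)) UNIV"
proof -
  note S = conv_pair_summable'[OF assms]
  have "infsum (conv f g) UNIV = (\<Sum>\<^sub>\<infinity>n. \<Sum>\<^sub>\<infinity>k. f k * g (n - k))" by (simp add: conv_def[abs_def])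
  also have "\<dots> = (\<Sum>\<^sub>\<infinity>k. \<Sum>\<^sub>\<infinity>n. f k * g (n - k))" by (rule infsum_swap_banach[OF S])
  also have "\<dots> = (\<Sum>\<^sub>\<infinity>k. f k * infsum g UNIV)"
  proof (rule infsum_cong)
    fix k
    have "(\<Sum>\<^sub>\<infinity>n. g (n - k)) = infsum g UNIV"
      by (rule infsum_reindex_bij_witness[where i = "\<lambda>n. n + k" and j = "\<lambda>n. n - k"]) auto
    then show "(\<Sum>\<^sub>\<infinity>n. f k * g (n - k)) = f k * infsum g UNIV" by (simp add: infsum_cmult_right')
  qed
  also have "\<dots> = infsum f UNIV * infsum g UNIV" by (rule infsum_cmult_left')
  finally show ?thesis using conv_l1(2)[OF assms] by (simp add: has_sum_iff)
qed

lemma laurent_mult: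
  assumes z: "z \<noteq> 0" and f: "((\<lambda>n. f n * z powi n) has_sum a) UNIV" and g: "((\<lambda>n. g n * z powi n) has_sum b) UNIV"
  shows "((\<lambda>n. conv f g n * z powi n) has_sum (a * b)) UNIV"
proof -
  have e: "(f k * z powi k) * (g (n - k) * z powi (n - k)) = f k * g (n - k) * z powi n" for k n
  proof -
    have "z powi n = z powi k * z powi (n - k)"
      using power_int_add[of z k "n - k"] z by simp
    then show ?thesis by (simp only: mult_ac)
  qed
  have "conv (\<lambda>n. f n * z powi n) (\<lambda>n. g n * z powi n) = (\<lambda>n. conv f g n * z powi n)"
    by (rule ext) (simp only: conv_def e infsum_cmult_left')
  then show ?thesis
    using conv_has_sum[OF has_sum_imp_summable[OF f] has_sum_imp_summable[OF g]] infsumI[OF f] infsumI[OF g] by simp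
qed

lemma laurent_shift:
  fixes f :: "int \<Rightarrow> complex"
  assumes z: "z \<noteq> 0" and f: "((\<lambda>n. f n * z powi n) has_sum a) UNIV"
  shows "((\<lambda>n. f (n - s) * z powi n) has_sum (z powi s * a)) UNIV"
proof -
  have "((\<lambda>n. z powi s * (f n * z powi n)) has_sum (z powi s * a)) UNIV" by (rule has_sum_cmult_right[OF f])
  moreover have "((\<lambda>n. f (n - s) * z powi n) has_sum (z powi s * a)) UNIV \<longleftrightarrow>
      ((\<lambda>n. z powi s * (f n * z powi n)) has_sum (z powi s * a)) UNIV"
  proof (rule has_sum_reindex_bij_witness[where i = "\<lambda>n. n + s" and j = "\<lambda>n. n - s"])
    fix n
    have "z powi n = z powi s * z powi (n - s)" using power_int_add[of z s "n - s"] z by simp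
    then show "z powi s * (f (n - s) * z powi (n - s)) = f (n - s) * z powi n" by (simp only: mult_ac)
  qed auto
  ultimately show ?thesis by blast
qed

text \<open>Real radii arbitrarily close to \<open>s2\<close> suffice to bound the radius of
  convergence from below.\<close>

lemma fps_conv_radius_ge_of_summable:
  fixes F :: "complex fps"
  assumes "s1 < s2" and "\<And>r. s1 < r \<Longrightarrow> r < s2 \<Longrightarrow> 0 < r \<Longrightarrow> summable (\<lambda>n. fps_nth F n * of_real r ^ n)"
  shows "fps_conv_radius F \<ge> ereal s2"
proof (rule dense_le)
  fix x assume x: "x < ereal s2"
  show "x \<le> fps_conv_radius F"
  proof (cases "s2 \<le> 0")
    case True
    then have "ereal s2 \<le> 0" by simp
    then show ?thesis using x conv_radius_nonneg[of "fps_nth F"] unfolding fps_conv_radius_def by (meson order.trans less_imp_le)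
  next
    case False
    obtain y where y: "x < ereal y" "ereal y < ereal s2" using ereal_dense2[OF x] by blast
    define r where "r = max y (max (s1 / 2 + s2 / 2) (s2 / 2))"
    have r: "s1 < r" "r < s2" "0 < r" "y \<le> r" using y False assms(1) by (auto simp: r_def)
    have "conv_radius (fps_nth F) \<ge> norm (complex_of_real r)"
      by (rule conv_radius_geI[OF assms(2)[OF r(1-3)]])
    then show ?thesis using y r unfolding fps_conv_radius_def
      by (smt (verit) ereal_less_eq(3) less_imp_le norm_of_real order.trans)
  qed
qed

lemma radius_less: "x < y \<Longrightarrow> ereal y \<le> R \<Longrightarrow> ereal x < R"
  by (rule less_le_trans[of _ "ereal y"]) auto

text \<open>Only the residue term survives: the rest of the Laurent series has a primitive on the annulus. (The
  derivative of a \<open>valid_path\<close> may be unbounded, so that the series is not integrated term by term.)\<close>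
lemma laurent_contour_integral:
  fixes c :: "int \<Rightarrow> complex"
  assumes s: "0 < s1" "s1 < s2"
    and f: "\<And>z. s1 < norm z \<Longrightarrow> norm z < s2 \<Longrightarrow> ((\<lambda>n. c n * z powi n) has_sum f z) UNIV"
    and p: "valid_path g" "pathfinish g = pathstart g" "winding_number g 0 = 1"
    and im: "\<And>z. z \<in> path_image g \<Longrightarrow> s1 < norm z \<and> norm z < s2"
  shows "(f has_contour_integral (2 * of_real pi * \<i> * c (-1))) g"
proof -
  define A where "A = Abs_fps (\<lambda>n. c (int n))"
  \<comment> \<open>The offset 2 leaves out the residue term. With u = 1/z the remaining negative
    powers are B(u) u^2, which is the derivative of -M(1/z) for a primitive M of B.\<close>
  define B where "B = Abs_fps (\<lambda>n. c (- int n - 2))"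
  have sub: "(\<lambda>n. c n * z powi n) summable_on X" if "s1 < norm z" "norm z < s2" for z X
    by (rule summable_on_subset_banach[OF has_sum_imp_summable[OF f[OF that]]]) simp
  have sA: "((\<lambda>n. c (int n) * z ^ n) has_sum infsum (\<lambda>n. c n * z powi n) {0..}) UNIV" if "s1 < norm z" "norm z < s2" for z
  proof -
    have "((\<lambda>n. c (int n) * z ^ n) has_sum infsum (\<lambda>n. c n * z powi n) {0..}) UNIV \<longleftrightarrow>
        ((\<lambda>n. c n * z powi n) has_sum infsum (\<lambda>n. c n * z powi n) {0..}) {0..}"
      by (rule has_sum_reindex_bij_witness[where i = nat and j = int]) auto
    then show ?thesis using has_sum_infsum[OF sub[OF that]] by blast
  qed
  have sB: "((\<lambda>n. c (- int n - 2) * (1 / z) ^ n) has_sum (z ^ 2 * infsum (\<lambda>n. c n * z powi n) {..-2})) UNIV"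
    if z: "s1 < norm z" "norm z < s2" for z
  proof -
    have z0: "z \<noteq> 0" using z s by auto
    have "((\<lambda>n. z ^ 2 * (c n * z powi n)) has_sum (z ^ 2 * infsum (\<lambda>n. c n * z powi n) {..-2})) {..-2}"
      by (rule has_sum_cmult_right[OF has_sum_infsum[OF sub[OF z]]])
    moreover have "((\<lambda>n. c (- int n - 2) * (1 / z) ^ n) has_sum (z ^ 2 * infsum (\<lambda>n. c n * z powi n) {..-2})) UNIV \<longleftrightarrow>
        ((\<lambda>n. z ^ 2 * (c n * z powi n)) has_sum (z ^ 2 * infsum (\<lambda>n. c n * z powi n) {..-2})) {..-2}"
    proof (rule has_sum_reindex_bij_witness[where i = "\<lambda>k. nat (- k - 2)" and j = "\<lambda>n. - int n - 2"])
      fix n :: nat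
      have "z ^ 2 * z powi (- int n - 2) = z powi (2 + (- int n - 2))"
        using z0 by (subst power_int_add) (auto simp: power_int_def)
      also have "\<dots> = (1 / z) ^ n" using z0 by (simp add: power_int_minus power_one_over inverse_eq_divide)
      finally show "z ^ 2 * (c (- int n - 2) * z powi (- int n - 2)) = c (- int n - 2) * (1 / z) ^ n"
        by (simp only: mult.left_commute[of "z ^ 2"])
    qed auto
    ultimately show ?thesis by blast
  qed
  have rA: "fps_conv_radius A \<ge> ereal s2"
  proof (rule fps_conv_radius_ge_of_summable[OF s(2)])
    fix r assume "s1 < r" "r < s2" "0 < r"
    then show "summable (\<lambda>n. fps_nth A n * of_real r ^ n)"
      using has_sum_imp_sums[OF sA[of "of_real r"]] by (simp add: A_def sums_iff)
  qed
  have rB: "fps_conv_radius B \<ge> ereal (1 / s1)"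
  proof (rule fps_conv_radius_ge_of_summable)
    show "1 / s2 < 1 / s1" using s by (intro divide_strict_left_mono) auto
    fix r assume r: "1 / s2 < r" "r < 1 / s1" "0 < r"
    have "s1 < 1 / r" "1 / r < s2" using r s by (auto simp: field_simps)
    then show "summable (\<lambda>n. fps_nth B n * of_real r ^ n)"
      using has_sum_imp_sums[OF sB[of "of_real (1 / r)"]] r by (simp add: B_def sums_iff norm_divide)
  qed
  have evA: "eval_fps A z = infsum (\<lambda>n. c n * z powi n) {0..}" if "s1 < norm z" "norm z < s2" for z
    using sums_unique[OF has_sum_imp_sums[OF sA[OF that]]] by (simp add: eval_fps_def A_def)
  have evB: "eval_fps B (1 / z) = z ^ 2 * infsum (\<lambda>n. c n * z powi n) {..-2}" if "s1 < norm z" "norm z < s2" for z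
    using sums_unique[OF has_sum_imp_sums[OF sB[OF that]]] by (simp add: eval_fps_def B_def)
  have dec: "f z = eval_fps A z + eval_fps B (1 / z) / z ^ 2 + c (-1) * (1 / (z - 0))" if z: "s1 < norm z" "norm z < s2" for z
  proof -
    have z0: "z \<noteq> 0" using z s by auto
    have "f z = infsum (\<lambda>n. c n * z powi n) ({0..} \<union> ({..-2} \<union> {-1}))"
    proof -
      have "{0..} \<union> ({..-2} \<union> {-1}) = (UNIV :: int set)" by auto
      then show ?thesis using infsumI[OF f[OF z]] by simp
    qed
    also have "\<dots> = infsum (\<lambda>n. c n * z powi n) {0..} + infsum (\<lambda>n. c n * z powi n) ({..-2} \<union> {-1})"
      by (rule infsum_Un_disjoint) (use sub[OF z] in auto)
    also have "infsum (\<lambda>n. c n * z powi n) ({..-2} \<union> {-1}) = infsum (\<lambda>n. c n * z powi n) {..-2} + infsum (\<lambda>n. c n * z powi n) {-1}"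
      by (rule infsum_Un_disjoint) (use sub[OF z] in auto)
    finally show ?thesis using z0 by (simp add: evA[OF z] evB[OF z] power_int_minus field_simps)
  qed
  have g0: "0 \<notin> path_image g" using im[of 0] s by auto
  have iA: "(eval_fps A has_contour_integral 0) g"
  proof (rule Cauchy_theorem_convex_simple[where S = "ball 0 s2"])
    show "eval_fps A holomorphic_on ball 0 s2"
      by (rule holomorphic_on_eval_fps) (auto simp: in_eball_iff intro: radius_less[OF _ rA])
  qed (use im p in auto)
  have iB: "((\<lambda>z. eval_fps B (1 / z) / z ^ 2) has_contour_integral 0) g"
  proof -
    have "eval_fps B holomorphic_on ball 0 (1 / s1)"
      by (rule holomorphic_on_eval_fps) (auto simp: in_eball_iff intro: radius_less[OF _ rB])
    then obtain M where M: "\<And>u. u \<in> ball 0 (1 / s1) \<Longrightarrow> (M has_field_derivative eval_fps B u) (at u)"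
      using holomorphic_convex_primitive'[of "ball 0 (1 / s1)" "eval_fps B"]
      by (metis at_within_open convex_ball open_ball)
    show ?thesis
    proof (rule Cauchy_theorem_primitive[where S = "{z. s1 < norm z}" and f = "\<lambda>z. - M (1 / z)"])
      fix z :: complex assume "z \<in> {z. s1 < norm z}"
      then have z: "s1 < norm z" "z \<noteq> 0" using s by auto
      have "1 / z \<in> ball 0 (1 / s1)" using z s by (auto simp: norm_divide field_simps)
      note d = M[OF this]
      have i: "((\<lambda>z. 1 / z) has_field_derivative (- 1 / z ^ 2)) (at z within {z. s1 < norm z})"
        using z by (auto intro!: derivative_eq_intros simp: power2_eq_square)
      have "((\<lambda>z. M (1 / z)) has_field_derivative (eval_fps B (1 / z) * (- 1 / z ^ 2))) (at z within {z. s1 < norm z})"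
        by (rule DERIV_chain2[where g = "\<lambda>z. 1 / z", OF d i])
      from DERIV_minus[OF this]
      show "((\<lambda>z. - M (1 / z)) has_field_derivative eval_fps B (1 / z) / z ^ 2) (at z within {z. s1 < norm z})"
        by simp
    qed (use im p in auto)
  qed
  have iC: "((\<lambda>z. c (-1) * (1 / (z - 0))) has_contour_integral c (-1) * (2 * of_real pi * \<i> * winding_number g 0)) g"
    using has_contour_integral_lmul[OF has_contour_integral_winding_number[OF p(1) g0], of "c (-1)"] by simp
  from has_contour_integral_add[OF has_contour_integral_add[OF iA iB] iC]
  have "((\<lambda>z. eval_fps A z + eval_fps B (1 / z) / z ^ 2 + c (-1) * (1 / (z - 0))) has_contour_integral 2 * of_real pi * \<i> * c (-1)) g"
    by (simp add: p mult_ac)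
  then show ?thesis
    by (rule has_contour_integral_eq) (use dec im in auto)
qed

section \<open>The generating series of a specialization\<close>

definition log_fps :: "(nat \<Rightarrow> complex) \<Rightarrow> complex fps" where
  "log_fps p = Abs_fps (\<lambda>n. if n = 0 then 0 else p n / of_nat n)"

lemma H_fps_eq: "H_fps p = fps_compose (fps_exp 1) (log_fps p)"
  by (simp add: H_fps_def log_fps_def)

lemma H_fps_0: "fps_nth (H_fps p) 0 = 1"
  by (simp add: H_fps_eq)

lemma H_fps_euler: "fps_X * fps_deriv (H_fps p) = (fps_X * fps_deriv (log_fps p)) * H_fps p"
  by (simp add: H_fps_eq fps_compose_deriv log_fps_def mult_ac)

lemma log_fps_radius:
  assumes r: "r > 0" and O: "(\<lambda>j. p j / of_nat j) \<in> O(\<lambda>j. complex_of_real (r ^ j))"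
  shows "fps_conv_radius (log_fps p) \<ge> ereal (1 / r)"
proof (rule fps_conv_radius_ge_of_summable[of 0])
  show "0 < 1 / r" using r by simp
  fix s :: real assume s: "0 < s" "s < 1 / r"
  have rs: "r * s < 1" using s r by (simp add: field_simps)
  obtain C where C: "\<forall>\<^sub>F j in sequentially. norm (p j / of_nat j) \<le> C * norm (complex_of_real (r ^ j))"
    using O by (elim landau_o.bigE)
  show "summable (\<lambda>n. fps_nth (log_fps p) n * of_real s ^ n)"
  proof (rule summable_comparison_test_ev)
    show "summable (\<lambda>n. C * (r * s) ^ n)"
      using r s rs by (intro summable_mult summable_geometric) auto
    show "\<forall>\<^sub>F n in sequentially. norm (fps_nth (log_fps p) n * of_real s ^ n) \<le> C * (r * s) ^ n"
      using C eventually_gt_at_top[of 0]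
    proof eventually_elim
      case (elim n)
      have nth: "fps_nth (log_fps p) n = p n / of_nat n" using elim by (simp add: log_fps_def)
      have norms: "norm (complex_of_real s ^ n) = s ^ n" "norm (complex_of_real (r ^ n)) = r ^ n"
        using s r by (simp_all add: norm_power)
      have "norm (p n / of_nat n) * s ^ n \<le> C * norm (complex_of_real (r ^ n)) * s ^ n"
        using elim s by (intro mult_right_mono) auto
      then show ?case unfolding nth norm_mult norms power_mult_distrib by (simp only: mult.assoc)
    qed
  qed
qed

lemma eval_log_fps:
  assumes "ereal (norm z) < fps_conv_radius (log_fps p)"
  shows "Hf p z = exp (eval_fps (log_fps p) z)"
proof -
  have s: "summable (\<lambda>n. fps_nth (log_fps p) n * z ^ n)"
    using assms summable_fps by blast
  have "eval_fps (log_fps p) z = (\<Sum>n. fps_nth (log_fps p) (Suc n) * z ^ Suc n)"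
    unfolding eval_fps_def using suminf_split_head[OF s] by (simp add: log_fps_def)
  then show ?thesis by (simp add: Hf_def log_fps_def del: of_nat_Suc)
qed

text \<open>H is the exponential of a function holomorphic in the disc of radius 1/r, so it has no
  zeros there and its inverse is holomorphic in the same disc.\<close>

lemma H_fps_analytic:
  assumes r: "r > 0" and O: "(\<lambda>j. p j / of_nat j) \<in> O(\<lambda>j. complex_of_real (r ^ j))"
  shows "fps_conv_radius (H_fps p) \<ge> ereal (1 / r)"
    and "norm z < 1 / r \<Longrightarrow> eval_fps (H_fps p) z = Hf p z"
    and "fps_conv_radius (inverse (H_fps p)) \<ge> ereal (1 / r)"
    and "norm z < 1 / r \<Longrightarrow> eval_fps (inverse (H_fps p)) z = 1 / Hf p z"
proof -
  let ?L = "log_fps p" and ?R = "1 / r"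
  note rad = log_fps_radius[OF r O]
  have R: "ereal 0 < ereal ?R" using r by simp
  have posL: "fps_conv_radius ?L > 0" using less_le_trans[OF R rad] by (simp add: zero_ereal_def)
  have holL: "eval_fps ?L holomorphic_on ball 0 ?R"
    by (rule holomorphic_on_eval_fps) (auto simp: in_eball_iff intro: radius_less[OF _ rad])
  have "(exp \<circ> eval_fps ?L) has_fps_expansion H_fps p"
    unfolding H_fps_eq
    by (rule has_fps_expansion_compose[OF has_fps_expansion_exp1 eval_fps_has_fps_expansion[OF posL]])
       (simp add: log_fps_def)
  then have e1: "(\<lambda>z. exp (eval_fps ?L z)) has_fps_expansion H_fps p" by (simp add: o_def)
  have h1: "(\<lambda>z. exp (eval_fps ?L z)) holomorphic_on ball 0 ?R" by (intro holomorphic_intros holL)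
  have e2: "(\<lambda>z. inverse (exp (eval_fps ?L z))) has_fps_expansion inverse (H_fps p)"
    by (rule has_fps_expansion_inverse[OF e1]) (simp add: H_fps_0)
  have h2: "(\<lambda>z. inverse (exp (eval_fps ?L z))) holomorphic_on ball 0 ?R" by (intro holomorphic_intros holL) auto
  show "fps_conv_radius (H_fps p) \<ge> ereal ?R"
    by (rule holomorphic_on_imp_fps_conv_radius_ge[OF e1]) (use h1 in simp)
  show "fps_conv_radius (inverse (H_fps p)) \<ge> ereal ?R"
    by (rule holomorphic_on_imp_fps_conv_radius_ge[OF e2]) (use h2 in simp)
  assume z: "norm z < ?R"
  then have ez: "Hf p z = exp (eval_fps ?L z)"
    by (intro eval_log_fps radius_less[OF _ rad])
  show "eval_fps (H_fps p) z = Hf p z"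
    using has_fps_expansion_imp_eval_fps_eq[OF e1 z h1] ez by simp
  show "eval_fps (inverse (H_fps p)) z = 1 / Hf p z"
    using has_fps_expansion_imp_eval_fps_eq[OF e2 z h2] ez by (simp add: inverse_eq_divide)
qed

lemma wl_cf_of_radius: "0 < q \<Longrightarrow> ereal q < fps_conv_radius A \<Longrightarrow> wl q (cf A)"
  using abs_summable_in_conv_radius[of "complex_of_real q" "fps_nth A"]
  by (simp add: wl_cf_iff fps_conv_radius_def norm_mult norm_power)

lemma cf_has_sum:
  assumes "((\<lambda>n. fps_nth A n * z ^ n) has_sum s) UNIV"
  shows "((\<lambda>n. cf A n * z powi n) has_sum s) UNIV"
proof -
  have "((\<lambda>n. fps_nth A n * z ^ n) has_sum s) UNIV \<longleftrightarrow> ((\<lambda>n. cf A n * z powi n) has_sum s) {0..}"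
    by (rule has_sum_reindex_bij_witness[where i = nat and j = int]) auto
  moreover have "((\<lambda>n. cf A n * z powi n) has_sum s) {0..} \<longleftrightarrow> ((\<lambda>n. cf A n * z powi n) has_sum s) UNIV"
    by (rule has_sum_cong_neutral) auto
  ultimately show ?thesis using assms by blast
qed

lemma cf_eval_has_sum:
  assumes "ereal (norm z) < fps_conv_radius A"
  shows "((\<lambda>n. cf A n * z powi n) has_sum eval_fps A z) UNIV"
proof (rule cf_has_sum, rule norm_summable_imp_has_sum)
  show "summable (\<lambda>n. norm (fps_nth A n * z ^ n))"
    by (rule abs_summable_in_conv_radius) (use assms in \<open>simp add: fps_conv_radius_def\<close>)
  show "(\<lambda>n. fps_nth A n * z ^ n) sums eval_fps A z"
    using assms by (rule sums_eval_fps)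
qed

lemma rev_has_sum:
  assumes "z \<noteq> 0" "((\<lambda>n. f n * (1 / z) powi n) has_sum s) UNIV"
  shows "((\<lambda>n. rev_seq f n * z powi n) has_sum s) UNIV"
proof -
  have "((\<lambda>n. rev_seq f n * z powi n) has_sum s) UNIV \<longleftrightarrow> ((\<lambda>n. f n * (1 / z) powi n) has_sum s) UNIV"
  proof (rule has_sum_reindex_bij_witness[where i = uminus and j = uminus])
    fix n
    have "(1 / z) powi (- n) = z powi n"
      by (simp add: power_int_minus power_int_inverse inverse_eq_divide[symmetric])
    then show "f (- n) * (1 / z) powi (- n) = rev_seq f n * z powi n" by (simp add: rev_seq_def)
  qed auto
  then show ?thesis using assms(2) by blast
qed

lemma wl_ff_of_radius:
  assumes "0 < q" "ereal q < fps_conv_radius A" "ereal q < fps_conv_radius E" "ereal (1 / q) < fps_conv_radius E"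
  shows "wl q (ff A E)"
  unfolding ff_def using assms by (intro wl_conv wl_cf_of_radius) (auto simp: wl_rev intro!: wl_cf_of_radius)

lemma ff_has_sum:
  assumes z: "z \<noteq> 0" "ereal (norm z) < fps_conv_radius A" "ereal (norm z) < fps_conv_radius E"
    "ereal (norm (1 / z)) < fps_conv_radius E"
  shows "((\<lambda>n. ff A E n * z powi n) has_sum eval_fps A z * (eval_fps E z * eval_fps E (1 / z))) UNIV"
  unfolding ff_def
  by (intro laurent_mult z rev_has_sum cf_eval_has_sum)

lemma Ffun_laurent:
  assumes rp: "rp > 0" and rm: "rm > 0"
    and pp: "(\<lambda>j. pp j / of_nat j) \<in> O(\<lambda>j. complex_of_real (rp ^ j))"
    and pm: "(\<lambda>j. pm j / of_nat j) \<in> O(\<lambda>j. complex_of_real (rm ^ j))"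
    and z: "rm < norm z" "norm z < 1 / rp" "norm z < 1 / rm"
  shows "((\<lambda>n. ff (H_fps pp) (inverse (H_fps pm)) n * z powi n) has_sum Ffun pp pm z) UNIV"
    and "((\<lambda>n. ff (inverse (H_fps pp)) (H_fps pm) n * z powi n) has_sum 1 / Ffun pp pm z) UNIV"
proof -
  note P = H_fps_analytic[OF rp pp] and M = H_fps_analytic[OF rm pm]
  have z0: "z \<noteq> 0" using z rm by auto
  have iz: "norm (1 / z) < 1 / rm"
    unfolding norm_divide norm_one by (rule divide_strict_left_mono) (use z rm z0 in auto)
  have lt: "ereal (norm z) < ereal (1 / rp)" "ereal (norm z) < ereal (1 / rm)" "ereal (norm (1 / z)) < ereal (1 / rm)"
    using z iz by simp_all
  show "((\<lambda>n. ff (H_fps pp) (inverse (H_fps pm)) n * z powi n) has_sum Ffun pp pm z) UNIV"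
    using ff_has_sum[OF z0 less_le_trans[OF lt(1) P(1)] less_le_trans[OF lt(2) M(3)] less_le_trans[OF lt(3) M(3)]]
    by (simp add: P(2)[OF z(2)] M(4)[OF z(3)] M(4)[OF iz] Ffun_def)
  show "((\<lambda>n. ff (inverse (H_fps pp)) (H_fps pm) n * z powi n) has_sum 1 / Ffun pp pm z) UNIV"
    using ff_has_sum[OF z0 less_le_trans[OF lt(1) P(3)] less_le_trans[OF lt(2) M(1)] less_le_trans[OF lt(3) M(1)]]
    by (simp add: P(4)[OF z(2)] M(2)[OF z(3)] M(2)[OF iz] Ffun_def)
qed

text \<open>The coefficients in w of the rational factor of the integrand, for both choices of
  \<open>c\<close> at once.\<close>

definition rr :: "int \<Rightarrow> complex \<Rightarrow> complex fps" where
  "rr c z = Abs_fps (\<lambda>j. z powi (- int j) + tau c j * z powi (int j + 1 - c))"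

lemma geometric_has_sum: "norm x < 1 \<Longrightarrow> ((\<lambda>j. x ^ j) has_sum 1 / (1 - x)) UNIV" for x :: complex
  by (rule norm_summable_imp_has_sum) (auto simp: norm_power intro!: summable_geometric geometric_sums)

text \<open>The geometric series in w/z and wz are combined: for c = 1 their common constant term
  must be subtracted once, for c = -1 the second series carries the factor -z^2.\<close>

lemma rr_has_sum:
  assumes c: "c = 1 \<or> c = -1" and z: "z \<noteq> 0" "norm w < norm z" "norm (w * z) < 1"
  shows "((\<lambda>n. cf (rr c z) n * w powi n) has_sum
     (if c = 1 then 1 - w ^ 2 else 1 - z ^ 2) / ((1 - w * z) * (1 - w / z))) UNIV"
proof (rule cf_has_sum)
  have q: "norm (w / z) < 1" using z by (simp add: norm_divide)
  have ne: "1 - w / z \<noteq> 0" "1 - w * z \<noteq> 0" using q z(3) by auto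
  have wz: "w \<noteq> z" using ne z by auto
  note G1 = geometric_has_sum[OF q] and G2 = geometric_has_sum[OF z(3)]
  have p: "z powi (- int j) * w ^ j = (w / z) ^ j" for j
    by (simp add: power_int_minus power_divide field_simps)
  show "((\<lambda>n. fps_nth (rr c z) n * w ^ n) has_sum
     (if c = 1 then 1 - w ^ 2 else 1 - z ^ 2) / ((1 - w * z) * (1 - w / z))) UNIV"
  proof (cases "c = 1")
    case True
    have "((\<lambda>j. if j = 0 then 1 else 0 :: complex) has_sum 1) (UNIV :: nat set)"
      by (rule has_sum_finite_neutralI[of "{0}"]) auto
    from csum_diff[OF has_sum_add[OF G1 G2] this]
    have "((\<lambda>j. (w / z) ^ j + (w * z) ^ j - (if j = 0 then 1 else 0)) has_sum
        (1 / (1 - w / z) + 1 / (1 - w * z) - 1)) UNIV" .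
    moreover have "(\<lambda>j. (w / z) ^ j + (w * z) ^ j - (if j = 0 then 1 else 0)) = (\<lambda>n. fps_nth (rr c z) n * w ^ n)"
    proof
      fix j :: nat
      show "(w / z) ^ j + (w * z) ^ j - (if j = 0 then 1 else 0) = fps_nth (rr c z) j * w ^ j"
        by (cases "j = 0") (simp_all add: rr_def tau_def True distrib_right p power_mult_distrib)
    qed
    moreover have "1 / (1 - w / z) + 1 / (1 - w * z) - 1 = (1 - w ^ 2) / ((1 - w * z) * (1 - w / z))"
      using ne z wz by (simp add: divide_simps power2_eq_square) (simp add: algebra_simps)
    ultimately show ?thesis using True by simp
  next
    case False
    then have cm: "c = -1" using c by simp
    from csum_diff[OF G1 has_sum_cmult_right[OF G2, of "z ^ 2"]]
    have "((\<lambda>j. (w / z) ^ j - z ^ 2 * (w * z) ^ j) has_sum (1 / (1 - w / z) - z ^ 2 * (1 / (1 - w * z)))) UNIV" .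
    moreover have "(\<lambda>j. (w / z) ^ j - z ^ 2 * (w * z) ^ j) = (\<lambda>n. fps_nth (rr c z) n * w ^ n)"
    proof
      fix j :: nat
      have "z powi (int j + 1 - c) = z ^ (j + 2)"
      proof -
        have "int j + 1 - c = int (j + 2)" by (simp add: cm)
        then show ?thesis by (simp only: power_int_of_nat)
      qed
      then have "fps_nth (rr c z) j = z powi (- int j) - z ^ (j + 2)"
        by (simp add: rr_def tau_def cm)
      moreover have "z ^ 2 * (w * z) ^ j = z ^ (j + 2) * w ^ j"
        by (simp only: power_add power_mult_distrib mult_ac)
      ultimately show "(w / z) ^ j - z ^ 2 * (w * z) ^ j = fps_nth (rr c z) j * w ^ j"
        by (simp only: left_diff_distrib p)
    qed
    moreover have "1 / (1 - w / z) - z ^ 2 * (1 / (1 - w * z)) = (1 - z ^ 2) / ((1 - w * z) * (1 - w / z))"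
      using ne z wz by (simp add: divide_simps power2_eq_square) (simp add: algebra_simps)
    ultimately show ?thesis using False by simp
  qed
qed

text \<open>Regrouping by powers of z: the powers z^(-j) fill the exponents m <= 0, and z^(j+1-c)
  those with m >= 1 and m >= 1 - c.\<close>

lemma uu_has_sum:
  assumes c: "c = 1 \<or> c = -1" and W: "0 < W" "W < norm z" "norm z < 1 / W" and g: "wl W g"
  shows "((\<lambda>m. uu c g y m * z powi m) has_sum conv (cf (rr c z)) g (- 1 - y)) UNIV"
proof -
  have z0: "z \<noteq> 0" "norm z > 0" using W by auto
  have "wl (norm z) (uu c g y)" by (rule uu_bound(1)[OF _ _ _ c g]) (use W in auto)
  then have S: "(\<lambda>m. uu c g y m * z powi m) summable_on UNIV"
    unfolding wl_iff[OF z0(2)] by (intro csum_normD) (simp add: norm_mult norm_power_int)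
  let ?t = "\<lambda>m. uu c g y m * z powi m"
  let ?M = "{m::int. m \<ge> 1 \<and> m \<ge> 1 - c}"
  have SX: "?t summable_on X" for X by (rule summable_on_subset_banach[OF S]) simp
  let ?a = "\<lambda>j::nat. z powi (- int j) * g (- 1 - y - int j)"
  let ?b = "\<lambda>j::nat. tau c j * z powi (int j + 1 - c) * g (- 1 - y - int j)"
  have ha: "(?a has_sum infsum ?t {..0}) UNIV"
  proof -
    have "(?a has_sum infsum ?t {..0}) UNIV \<longleftrightarrow> (?t has_sum infsum ?t {..0}) {..0}"
    proof (rule has_sum_reindex_bij_witness[where i = "\<lambda>m. nat (- m)" and j = "\<lambda>j. - int j"])
      fix j :: nat
      have a: "- int j - y - 1 = - 1 - y - int j" by simp
      show "?t (- int j) = ?a j" unfolding uu_def a by simp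
    qed auto
    then show ?thesis using has_sum_infsum[OF SX] by blast
  qed
  have hb: "(?b has_sum infsum ?t ?M) UNIV"
  proof -
    let ?J = "{j::nat. c = 1 \<longrightarrow> j \<ge> 1}"
    have "(?b has_sum infsum ?t ?M) ?J \<longleftrightarrow> (?t has_sum infsum ?t ?M) ?M"
    proof (rule has_sum_reindex_bij_witness[where i = "\<lambda>m. nat (m - 1 + c)" and j = "\<lambda>j. int j + 1 - c"])
      fix j assume j: "j \<in> ?J"
      then have t: "tau c j = of_int c" by (auto simp: tau_def)
      have a: "- y - (int j + 1 - c) - c = - 1 - y - int j" by simp
      have "uu c g y (int j + 1 - c) = of_int c * g (- 1 - y - int j)"
        using j c unfolding uu_def a by auto
      then show "?t (int j + 1 - c) = ?b j" by (simp add: t)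
    qed (use c in auto)
    then have "(?b has_sum infsum ?t ?M) ?J" using has_sum_infsum[OF SX] by blast
    then show ?thesis
      by (rule has_sum_cong_neutral[THEN iffD1, rotated -1]) (auto simp: tau_def)
  qed
  have "infsum ?t UNIV = infsum ?t ({..0} \<union> {1..})"
  proof -
    have "({..0} \<union> {1..}) = (UNIV :: int set)" by auto
    then show ?thesis by simp
  qed
  also have "\<dots> = infsum ?t {..0} + infsum ?t {1..}"
    by (rule infsum_Un_disjoint[OF SX SX]) auto
  also have "infsum ?t {1..} = infsum ?t ?M"
    by (rule infsum_cong_neutral) (auto simp: uu_def)
  also have "infsum ?t {..0} + infsum ?t ?M = (\<Sum>\<^sub>\<infinity>j. ?a j + ?b j)"
    using infsumI[OF has_sum_add[OF ha hb]] by simp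
  also have "\<dots> = conv (cf (rr c z)) g (- 1 - y)"
    unfolding conv_def
    by (subst infsum_int_ge0) (auto intro!: infsum_cong simp: rr_def distrib_right)
  finally show ?thesis using S by (simp add: has_sum_iff)
qed

text \<open>Residues in w for fixed z, then in z: the inner integral extracts the coefficient at -1
  - b, where w^b shifts the index by b, and the outer one the coefficient at a + 1.\<close>

lemma corr_kernel_contour_integral:
  assumes rp: "rp > 0" and rm: "rm > 0"
    and pp: "(\<lambda>j. pp j / of_nat j) \<in> O(\<lambda>j. complex_of_real (rp ^ j))"
    and pm: "(\<lambda>j. pm j / of_nat j) \<in> O(\<lambda>j. complex_of_real (rm ^ j))"
    and ct: "admissible_contours rp rm gz gw" and c: "c = 1 \<or> c = -1"
  shows "contour_integral gz (\<lambda>z. contour_integral gw (\<lambda>w.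
        Ffun pp pm z / Ffun pp pm w * (if c = 1 then 1 - w ^ 2 else 1 - z ^ 2) / ((1 - w * z) * (1 - w / z))
        / (z powi (a + 2) * w powi (- b)))) / (2 * pi * \<i>) ^ 2
     = corr_kernel c (H_fps pp) (inverse (H_fps pm)) a b"
proof -
  let ?f = "ff (H_fps pp) (inverse (H_fps pm))" and ?g = "ff (inverse (H_fps pp)) (H_fps pm)"
  let ?F = "Ffun pp pm"
  let ?N = "\<lambda>w z. if c = 1 then 1 - w ^ 2 else 1 - z ^ 2 :: complex"
  define S where "S z = conv (cf (rr c z)) ?g (- 1 - b)" for z
  have pz: "valid_path gz" "pathfinish gz = pathstart gz" "winding_number gz 0 = 1"
    and pw: "valid_path gw" "pathfinish gw = pathstart gw" "winding_number gw 0 = 1"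
    using ct by (auto simp: admissible_contours_def)
  have dom: "rm < norm w" "norm w < norm z" "norm z < 1 / norm w" "norm z < 1 / rp" "norm z < 1 / rm"
    if "z \<in> path_image gz" "w \<in> path_image gw" for z w
    using ct that unfolding admissible_contours_def by blast+
  obtain w0 where w0: "w0 \<in> path_image gw" using path_image_nonempty[of gw] by blast
  obtain z0 where z0: "z0 \<in> path_image gz" using path_image_nonempty[of gz] by blast
  \<comment> \<open>The contours need not be circles. The modulus of any point of the inner contour
    lies between r_- and the moduli on the whole outer contour, so it can serve as the weight for
    1/F.\<close>
  define W where "W = norm w0"
  have W: "rm < W" "0 < W" using dom(1)[OF z0 w0] rm by (auto simp: W_def)
  have Wz: "W < norm z" "norm z < 1 / W" if "z \<in> path_image gz" for z
    using dom[OF that w0] by (auto simp: W_def)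
  have Wlt: "W < 1 / W" "W < 1 / rp" "W < 1 / rm"
    using Wz[OF z0] dom[OF z0 w0] by (auto simp: W_def)
  have wlg: "wl W ?g"
  proof -
    note P = H_fps_analytic[OF rp pp] and M = H_fps_analytic[OF rm pm]
    have "1 / W < 1 / rm" using W rm by (intro divide_strict_left_mono) auto
    then show ?thesis
      by (intro wl_ff_of_radius W radius_less[OF Wlt(2) P(3)] radius_less[OF Wlt(3) M(1)] radius_less[OF _ M(1)])
  qed
  have inner: "contour_integral gw (\<lambda>w. ?F z / ?F w * ?N w z / ((1 - w * z) * (1 - w / z)) / (z powi (a + 2) * w powi (- b)))
      = 2 * of_real pi * \<i> * (z powi (- (a + 2)) * (?F z * S z))" if z: "z \<in> path_image gz" for z
  proof -
    have nz: "norm z > 0" "z \<noteq> 0" using Wz[OF z] W by auto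
    let ?h = "\<lambda>w. w powi b * (?N w z / ((1 - w * z) * (1 - w / z)) * (1 / ?F w))"
    have "(?h has_contour_integral (2 * of_real pi * \<i> * conv (cf (rr c z)) ?g (- 1 - b))) gw"
    proof (rule laurent_contour_integral[where c = "\<lambda>n. conv (cf (rr c z)) ?g (n - b)" and ?s1.0 = rm and ?s2.0 = "min (norm z) (1 / norm z)"])
      show "rm < min (norm z) (1 / norm z)" 
      proof -
        have "W < 1 / norm z" using Wz[OF z] W nz by (simp add: field_simps)
        then show ?thesis using Wz(1)[OF z] W(1) by simp
      qed
      show "rm < norm w \<and> norm w < min (norm z) (1 / norm z)" if "w \<in> path_image gw" for w
      proof -
        have "norm w > 0" using dom(1)[OF z that] rm by linarith
        then have "norm z * norm w < 1" using dom(3)[OF z that] by (simp add: pos_less_divide_eq)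
        then have "norm w < 1 / norm z" using nz by (simp add: pos_less_divide_eq mult.commute)
        then show ?thesis using dom[OF z that] by simp
      qed
      fix w :: complex assume w: "rm < norm w" "norm w < min (norm z) (1 / norm z)"
      have w0': "w \<noteq> 0" using w rm by auto
      have wz: "norm w < norm z" "norm (w * z) < 1" using w nz by (auto simp: norm_mult field_simps)
      have wb: "norm w < 1 / rp" "norm w < 1 / rm" using wz(1) dom[OF z w0] by linarith+
      show "((\<lambda>n. conv (cf (rr c z)) ?g (n - b) * w powi n) has_sum ?h w) UNIV"
        by (rule laurent_shift[OF w0'], rule laurent_mult[OF w0' rr_has_sum[OF c nz(2) wz] Ffun_laurent(2)[OF rp rm pp pm w(1) wb]])
    qed (use rm pw in auto)
    then have "((\<lambda>w. (z powi (- (a + 2)) * ?F z) * ?h w) has_contour_integral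
        ((z powi (- (a + 2)) * ?F z) * (2 * of_real pi * \<i> * S z))) gw"
      unfolding S_def by (rule has_contour_integral_lmul)
    moreover have "(z powi (- (a + 2)) * ?F z) * ?h w =
        ?F z / ?F w * ?N w z / ((1 - w * z) * (1 - w / z)) / (z powi (a + 2) * w powi (- b))" for w
      by (simp only: power_int_minus divide_inverse inverse_mult_distrib inverse_inverse_eq mult_1_left mult_ac)
    ultimately have "((\<lambda>w. ?F z / ?F w * ?N w z / ((1 - w * z) * (1 - w / z)) / (z powi (a + 2) * w powi (- b)))
        has_contour_integral ((z powi (- (a + 2)) * ?F z) * (2 * of_real pi * \<i> * S z))) gw"
      by (simp only:)
    from contour_integral_unique[OF this] show ?thesis by (simp only: mult_ac)
  qed
  have "((\<lambda>z. z powi (- (a + 2)) * (?F z * S z)) has_contour_integral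
      (2 * of_real pi * \<i> * conv ?f (uu c ?g b) (- 1 - (- (a + 2))))) gz"
  proof (rule laurent_contour_integral[where c = "\<lambda>n. conv ?f (uu c ?g b) (n - (- (a + 2)))"
        and ?s1.0 = W and ?s2.0 = "min (1 / W) (min (1 / rp) (1 / rm))"])
    show "W < min (1 / W) (min (1 / rp) (1 / rm))" using Wlt by simp
    show "W < norm z \<and> norm z < min (1 / W) (min (1 / rp) (1 / rm))" if "z \<in> path_image gz" for z
      using Wz[OF that] dom[OF that w0] by simp
    fix z :: complex assume z: "W < norm z" "norm z < min (1 / W) (min (1 / rp) (1 / rm))"
    have z': "rm < norm z" "norm z < 1 / rp" "norm z < 1 / rm" "norm z < 1 / W" "z \<noteq> 0" using z W by auto
    show "((\<lambda>n. conv ?f (uu c ?g b) (n - (- (a + 2))) * z powi n) has_sum z powi (- (a + 2)) * (?F z * S z)) UNIV"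
      unfolding S_def
      by (rule laurent_shift[OF z'(5)], rule laurent_mult[OF z'(5) Ffun_laurent(1)[OF rp rm pp pm z'(1-3)]
            uu_has_sum[OF c W(2) z(1) z'(4) wlg]])
  qed (use W pz in auto)
  moreover have "- 1 - (- (a + 2)) = a + 1" by simp
  ultimately have "((\<lambda>z. z powi (- (a + 2)) * (?F z * S z)) has_contour_integral
      (2 * of_real pi * \<i> * conv ?f (uu c ?g b) (a + 1))) gz"
    by (simp only:)
  from has_contour_integral_lmul[OF this, of "2 * of_real pi * \<i>"]
  have outer: "contour_integral gz (\<lambda>z. 2 * of_real pi * \<i> * (z powi (- (a + 2)) * (?F z * S z))) =
      (2 * of_real pi * \<i>) * (2 * of_real pi * \<i> * conv ?f (uu c ?g b) (a + 1))"
    by (rule contour_integral_unique)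
  have inv: "inverse (inverse (H_fps pm)) = H_fps pm" by (rule fps_inverse_idempotent) (simp add: H_fps_0)
  have "contour_integral gz (\<lambda>z. contour_integral gw (\<lambda>w.
        ?F z / ?F w * ?N w z / ((1 - w * z) * (1 - w / z)) / (z powi (a + 2) * w powi (- b)))) =
     contour_integral gz (\<lambda>z. 2 * of_real pi * \<i> * (z powi (- (a + 2)) * (?F z * S z)))"
    by (rule contour_integral_eq) (rule inner)
  also have "\<dots> = (2 * pi * \<i>) ^ 2 * conv (uu c ?g b) ?f (a + 1)"
    unfolding outer conv_commute[of ?f] by (simp add: power2_eq_square mult_ac)
  finally show ?thesis by (simp add: corr_kernel_def inv)
qed

section \<open>The symplectic and orthogonal Schur measures\<close>

lemma hh_eq: "hh p = cf (H_fps p)"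
  by (rule ext) (simp add: hh_def cf_def)

lemma schur_eq: "schur p l = jt_det (cf (H_fps p)) (\<lambda>_. 0) c l"
  unfolding schur_def jt_det_def
  by (rule detn_cong) (simp add: hh_eq jt_fun_def part_pt_def algebra_simps)

lemma orth_eq: "orth p l = jt_det (cf (H_fps p)) (tau (-1)) (-1) l"
  unfolding orth_def jt_det_def
  by (rule detn_cong) (simp add: hh_eq jt_fun_def tau_def part_pt_def algebra_simps)

lemma detn_scale_columns: "detn n (\<lambda>i j. d j * B i j) = (\<Prod>j<n. d j) * detn n B"
  unfolding detn_def sum_distrib_left
proof (rule sum.cong[OF refl])
  fix s assume "s \<in> {s. s permutes {..<n}}"
  then have "(\<Prod>i<n. d (s i)) = (\<Prod>j<n. d j)" using prod.permute[of s "{..<n}" d] by (simp add: o_def)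
  then show "of_int (sign s) * (\<Prod>i<n. d (s i) * B i (s i)) = (\<Prod>j<n. d j) * (of_int (sign s) * (\<Prod>i<n. B i (s i)))"
    by (simp add: prod.distrib)
qed

text \<open>The first column of the symplectic determinant is twice a complete symmetric function; the factor \<open>1/2\<close> removes this.\<close>
lemma sympl_eq: "sympl p l = jt_det (cf (H_fps p)) (tau 1) 1 l"
proof (cases l)
  case Nil
  then show ?thesis by (simp add: sympl_def jt_det_def)
next
  case (Cons x xs)
  let ?d = "\<lambda>j::nat. if j = 0 then 2 else 1 :: complex"
  have "detn (length l) (\<lambda>i j. hh p (int (parts l (Suc i)) - int i + int j) + hh p (int (parts l (Suc i)) - int i - int j))
     = detn (length l) (\<lambda>i j. ?d j * jt_fun (cf (H_fps p)) (tau 1) 1 j (part_pt l i))"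
    by (rule detn_cong) (simp add: hh_eq jt_fun_def tau_def part_pt_def algebra_simps)
  also have "\<dots> = (\<Prod>j<length l. ?d j) * jt_det (cf (H_fps p)) (tau 1) 1 l"
    by (simp only: detn_scale_columns jt_det_def)
  also have "(\<Prod>j<length l. ?d j) = 2"
    using Cons by (simp add: prod.lessThan_Suc_shift del: prod.lessThan_Suc)
  finally show ?thesis using Cons by (simp add: sympl_def)
qed

lemma log_series_pair_of_specializations:
  assumes q: "0 < q1" "q1 < q2" "q2 < 1" "rm < q1" "q2 < 1 / rp" and rp: "rp > 0" and rm: "rm > 0"
    and pp: "(\<lambda>j. pp j / of_nat j) \<in> O(\<lambda>j. complex_of_real (rp ^ j))"
    and pm: "(\<lambda>j. pm j / of_nat j) \<in> O(\<lambda>j. complex_of_real (rm ^ j))"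
  shows "log_series_pair q1 q2 (H_fps pp) (inverse (H_fps pm)) (fps_X * fps_deriv (log_fps pp)) (- (fps_X * fps_deriv (log_fps pm)))"
proof -
  note P = H_fps_analytic[OF rp pp] and M = H_fps_analytic[OF rm pm]
  have Q: "0 < 1 / q1" "1 / q1 < 1 / rm" "0 < q2" using q rm by (auto intro!: divide_strict_left_mono)
  have inv: "inverse (inverse (H_fps pm)) = H_fps pm" by (rule fps_inverse_idempotent) (simp add: H_fps_0)
  have dlog: "wl s (cf (fps_X * fps_deriv (log_fps p)))" if "0 < s" "ereal s < fps_conv_radius (log_fps p)" for s p
  proof (rule wl_cf_of_radius[OF that(1)])
    have "fps_conv_radius (fps_X * fps_deriv (log_fps p)) \<ge> min (fps_conv_radius (fps_X :: complex fps)) (fps_conv_radius (fps_deriv (log_fps p)))"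
      by (rule fps_conv_radius_mult)
    then have "fps_conv_radius (fps_X * fps_deriv (log_fps p)) \<ge> fps_conv_radius (log_fps p)"
      using fps_conv_radius_deriv[of "log_fps p"] by simp
    then show "ereal s < fps_conv_radius (fps_X * fps_deriv (log_fps p))" by (rule less_le_trans[OF that(2)])
  qed
  have neg: "cf (- F) = (\<lambda>k. - cf F k)" for F by (auto simp: cf_def)
  show ?thesis
  proof unfold_locales
    show "wl q2 (cf (H_fps pp))" "wl q2 (cf (inverse (H_fps pp)))"
      by (intro wl_cf_of_radius Q radius_less[OF q(5) P(1)] radius_less[OF q(5) P(3)])+
    show "wl (1 / q1) (cf (inverse (H_fps pm)))" "wl (1 / q1) (cf (inverse (inverse (H_fps pm))))"
      unfolding inv by (intro wl_cf_of_radius Q radius_less[OF Q(2) M(1)] radius_less[OF Q(2) M(3)])+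
    show "wl q2 (cf (fps_X * fps_deriv (log_fps pp)))"
      by (intro dlog Q radius_less[OF q(5) log_fps_radius[OF rp pp]])
    show "wl (1 / q1) (cf (- (fps_X * fps_deriv (log_fps pm))))"
      unfolding neg by (intro wl_minus dlog Q radius_less[OF Q(2) log_fps_radius[OF rm pm]])
    show "fps_X * fps_deriv (H_fps pp) = fps_X * fps_deriv (log_fps pp) * H_fps pp" by (rule H_fps_euler)
    show "fps_X * fps_deriv (inverse (H_fps pm)) = - (fps_X * fps_deriv (log_fps pm)) * inverse (H_fps pm)"
      by (rule fps_log_deriv_inverse[OF H_fps_euler H_fps_0])
  qed (use q H_fps_0 in auto)
qed

lemma log_deriv_nth: "fps_nth (fps_X * fps_deriv (log_fps p)) (Suc n) = p (Suc n)"
  by (simp add: log_fps_def field_simps del: of_nat_Suc)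

definition Z_c :: "int \<Rightarrow> (nat \<Rightarrow> complex) \<Rightarrow> (nat \<Rightarrow> complex) \<Rightarrow> complex" where
  "Z_c c pp pm = (if c = 1 then Z_sp pp pm else Z_o pp pm)"

theorem jt_weight_correlation_contours:
  assumes rp: "rp > 0" and rm: "rm > 0" and r: "min 1 (1 / rp) > rm"
    and pp: "(\<lambda>j. pp j / of_nat j) \<in> O(\<lambda>j. complex_of_real (rp ^ j))"
    and pm: "(\<lambda>j. pm j / of_nat j) \<in> O(\<lambda>j. complex_of_real (rm ^ j))"
    and inj: "inj_on k {..<n}" and c: "c = 1 \<or> c = -1"
  shows "((\<lambda>l. jt_weight c (H_fps pp) (inverse (H_fps pm)) l / Z_c c pp pm) has_sum
      detn n (\<lambda>i j. corr_kernel c (H_fps pp) (inverse (H_fps pm)) (k i) (k j)))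
     {l \<in> partitions. k ` {..<n} \<subseteq> shifted_set l}"
proof -
  \<comment> \<open>The hypothesis leaves room for two radii strictly between r_- and min(1,
    1/r_+).\<close>
  obtain q1 where q1: "rm < q1" "q1 < min 1 (1 / rp)" using dense[OF r] by blast
  obtain q2 where q2: "q1 < q2" "q2 < min 1 (1 / rp)" using dense[OF q1(2)] by blast
  interpret L: log_series_pair q1 q2 "H_fps pp" "inverse (H_fps pm)"
    "fps_X * fps_deriv (log_fps pp)" "- (fps_X * fps_deriv (log_fps pm))"
    by (rule log_series_pair_of_specializations[of q1 q2 rm rp]) (use q1 q2 rm rp pp pm in auto)
  have u: "L.uc (Suc m) = pp (Suc m) * pm (Suc m)" for m
    unfolding L.uc_def by (simp only: fps_neg_nth log_deriv_nth) simp
  have v: "L.vc c (Suc m) = of_int c * pm (2 * Suc m) - (pm (Suc m))^2" for m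
  proof -
    have "fps_nth (fps_X * fps_deriv (log_fps pm)) (2 * Suc m) = pm (2 * Suc m)"
      using log_deriv_nth[of pm "2 * m + 1"] by simp
    then show ?thesis unfolding L.vc_def by (simp only: fps_neg_nth log_deriv_nth) simp
  qed
  have "summable (\<lambda>m. norm (L.uc m * 1 ^ m))" "summable (\<lambda>m. norm (L.vc c m * 1 ^ m))"
    by (rule L.uc_vc_summable[of 1]; use q1 q2 c in simp)+
  then have su: "summable (\<lambda>m. norm (L.uc m))" and sv: "summable (\<lambda>m. norm (L.vc c m))" by simp_all
  have div: "summable (\<lambda>m. f (Suc m) / of_nat (Suc m))" if "summable (\<lambda>m. norm (f m))" for f :: "nat \<Rightarrow> complex"
  proof (rule summable_comparison_test')
    show "summable (\<lambda>m. norm (f (Suc m)))" using that by (subst summable_Suc_iff)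
    show "norm (f (Suc m) / of_nat (Suc m)) \<le> norm (f (Suc m))" for m
    proof -
      have "norm (f (Suc m)) / real (Suc m) \<le> norm (f (Suc m)) / 1" by (intro divide_left_mono) auto
      then show ?thesis by (simp add: norm_divide del: of_nat_Suc)
    qed
  qed
  \<comment> \<open>Merging the two series term by term: the factor 1/2 turns the denominator k of
    the second one into the 2k of the stated constant.\<close>
  have "(\<Sum>m. L.uc (Suc m) / of_nat (Suc m)) + (\<Sum>m. L.vc c (Suc m) / of_nat (Suc m)) / 2
     = (\<Sum>m. L.uc (Suc m) / of_nat (Suc m) + L.vc c (Suc m) / of_nat (Suc m) / 2)"
    unfolding suminf_divide[OF div[OF sv], symmetric]
    by (rule suminf_add[OF div[OF su] summable_divide[OF div[OF sv]]])
  also have "\<dots> = (\<Sum>m. pp (Suc m) * pm (Suc m) / of_nat (Suc m) + of_int c * pm (2 * Suc m) / of_nat (2 * Suc m)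
       - (pm (Suc m))^2 / of_nat (2 * Suc m))"
  proof (rule suminf_cong)
    fix m
    have e: "complex_of_nat (2 * Suc m) = 2 * complex_of_nat (Suc m)" by simp
    show "L.uc (Suc m) / of_nat (Suc m) + L.vc c (Suc m) / of_nat (Suc m) / 2 =
      pp (Suc m) * pm (Suc m) / of_nat (Suc m) + of_int c * pm (2 * Suc m) / of_nat (2 * Suc m)
       - (pm (Suc m))^2 / of_nat (2 * Suc m)"
      unfolding u v e
      by (simp only: diff_divide_distrib divide_divide_eq_left mult.commute[of "2 :: complex"] add_diff_eq)
  qed
  finally have Z: "infsum (jt_weight c (H_fps pp) (inverse (H_fps pm))) partitions = Z_c c pp pm"
    unfolding L.total_weight[OF c] using c by (auto simp: Z_c_def Z_sp_def Z_o_def Let_def simp del: of_nat_Suc of_nat_mult)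
  have "Z_c c pp pm \<noteq> 0" by (simp add: Z_c_def Z_sp_def Z_o_def)
  then show ?thesis
    using has_sum_divide_const[OF L.jt_weight_correlation_limit[OF c inj], of "Z_c c pp pm"] by (simp add: Z)
qed

theorem theorem1:
  fixes pp pm :: "nat \<Rightarrow> complex" and rp rm :: real and n :: nat and k :: "nat \<Rightarrow> int"
    and gz gw :: "real \<Rightarrow> complex"
  assumes "rp > 0" and "rm > 0" and "min 1 (1 / rp) > rm"
    and "(\<lambda>j. pp j / of_nat j) \<in> O(\<lambda>j. complex_of_real (rp ^ j))"
    and "(\<lambda>j. pm j / of_nat j) \<in> O(\<lambda>j. complex_of_real (rm ^ j))"
    and "n \<ge> 1" and "inj_on k {..<n}"
    and "admissible_contours rp rm gz gw"
  shows "(m_sp pp pm has_sum detn n (\<lambda>i j. K_sp pp pm gz gw (k i) (k j)))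
           {l \<in> partitions. k ` {..<n} \<subseteq> shifted_set l} \<and>
         (m_o pp pm has_sum detn n (\<lambda>i j. K_o pp pm gz gw (k i) (k j)))
           {l \<in> partitions. k ` {..<n} \<subseteq> shifted_set l}"
proof -
  let ?S = "{l \<in> partitions. k ` {..<n} \<subseteq> shifted_set l}"
  let ?A = "H_fps pp" and ?E = "inverse (H_fps pm)"
  have K: "K_sp pp pm gz gw a b = corr_kernel 1 ?A ?E a b" "K_o pp pm gz gw a b = corr_kernel (-1) ?A ?E a b" for a b
    using corr_kernel_contour_integral[OF assms(1,2,4,5,8), of 1 a b]
      corr_kernel_contour_integral[OF assms(1,2,4,5,8), of "-1" a b]
    by (simp_all add: K_sp_def K_o_def)
  have inv: "inverse (inverse (H_fps pm)) = H_fps pm" by (rule fps_inverse_idempotent) (simp add: H_fps_0)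
  have sp: "m_sp pp pm = (\<lambda>l. jt_weight 1 ?A ?E l / Z_c 1 pp pm)"
    by (rule ext) (simp add: m_sp_def sympl_eq schur_eq[of pm _ 1] jt_weight_def inv Z_c_def)
  have o: "m_o pp pm = (\<lambda>l. jt_weight (-1) ?A ?E l / Z_c (-1) pp pm)"
    by (rule ext) (simp add: m_o_def orth_eq schur_eq[of pm _ "-1"] jt_weight_def inv Z_c_def)
  show ?thesis
    unfolding sp o K
    using jt_weight_correlation_contours[OF assms(1-5,7), of 1] jt_weight_correlation_contours[OF assms(1-5,7), of "-1"]
    by simp
qed

end
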